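(* A regular transition system is fibrant in $\mathbf L_{\underline{\mathrm{Cub}}}\mathbf{RTS}$ if and only if it is fibrant in $\mathbf L_{\underline{\mathrm{Cub}}}\mathbf{CTS}$.
   Context: Fix a nonempty set $\Sigma$ of labels. A weak transition system is a triple $X=(S,\mu:L\to\Sigma,T=\bigcup_{n\ge1}T_n)$ where $S$ is a set (states), $L$ a set (actions), $\mu$ a map (labelling map), $T_n\subset S\times L^n\times S$ ($n$-transitions), such that: (Multiset axiom) if $(\alpha,u_1,\dots,u_n,\beta)$ is a transition with $n\ge2$, so is $(\alpha,u_{\sigma(1)},\dots,u_{\sigma(n)},\beta)$ for every permutation $\sigma$; (Composition axiom) for $n\ge3$ and $p,q\ge1$ with $p+q<n$, if $(\alpha,u_1,\dots,u_n,\beta)$, $(\alpha,u_1,\dots,u_p,\nu_1)$, $(\nu_1,u_{p+1},\dots,u_n,\beta)$, $(\alpha,u_1,\dots,u_{p+q},\nu_2)$, $(\nu_2,u_{p+q+1},\dots,u_n,\beta)$ are transitions, then so is $(\nu_1,u_{p+1},\dots,u_{p+q},\nu_2)$. A map consists of a map on states and a map on actions commuting with the labelling maps to $\Sigma$, sending transitions to transitions. The category is $\mathbf{WTS}$. Intermediate state axiom: for every transition $(\alpha,u_1,\dots,u_n,\beta)$ with $n\ge2$ and every $1\le p<n$ there is a state $\nu$ with $(\alpha,u_1,\dots,u_p,\nu)$ and $(\nu,u_{p+1},\dots,u_n,\beta)$ transitions. CSA2: same with $\nu$ unique. $X$ is cubical if every action $u$ occurs in some $1$-transition $(\alpha,u,\beta)$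 and the Intermediate state axiom holds; regular if moreover CSA2 holds. Full subcategories: $\mathbf{RTS}\subset\mathbf{CTS}\subset\mathbf{WTS}$ (regular, cubical). A set is viewed as a transition system with that set of states and no actions. For $x_1,\dots,x_n\in\Sigma$, the $n$-cube $C_n[x_1,\dots,x_n]$ has states $\{0,1\}^n$, actions $(x_1,1),\dots,(x_n,n)$ with $\mu(x_i,i)=x_i$, and transitions $((\epsilon_i),(x_{i_1},i_1),\dots,(x_{i_d},i_d),(\epsilon'_i))$, $d\geq1$, with $i_1,\dots,i_d$ distinct, $\epsilon_i\le\epsilon'_i$ for all $i$, and $\epsilon_i\ne\epsilon_i'$ iff $i\in\{i_1,\dots,i_d\}$. For $n\ge1$, the boundary $\partial C_n[x_1,\dots,x_n]$ is obtained by removing from the $n$-cube all its $n$-transitions (for $n=1$ it is the two-state set $\{0,1\}$, with no action). The double transition $\uparrow\! x\!\uparrow$ ($x\in\Sigma$) has states $1,2,3,4$, one action $x$ labelled $x$, and transitions $(1,x,2),(3,x,4)$. Let $\mathcal I=\{\varnothing\to\{0\},\ \{0,1\}\to\{0\}\}\cup\{\partial C_n[x_1,\dots,x_n]\to C_n[x_1,\dots,x_n]\mid n\ge1,\ x_i\in\Sigma\}\cup\{C_1[x]\to\ \uparrow\! x\!\uparrow\ \mid x\in\Sigma\}$. For $x\in\Sigma$, $p_x:C_1[x]\sqcup C_1[x]\to\ \uparrow\! x\!\uparrow$ is the map bijective on states sending the $1$-transitions of the two copies of $C_1[x]$ to $(1,x,2)$ and $(3,x,4)$ respectively. $\mathcal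 S=\{p_x\mid x\in\Sigma\}$. Each of $\mathbf{CTS}$ and $\mathbf{RTS}$ carries a left determined (combinatorial, left proper) model structure with generating cofibrations $\mathcal I$: its weak equivalences form the smallest Grothendieck localizer, where, $\mathcal C$ being the class of cofibrations, a Grothendieck localizer is a class of maps satisfying two-out-of-three, containing all maps with the right lifting property with respect to $\mathcal C$, and whose intersection with $\mathcal C$ is closed under pushouts and transfinite compositions. $\mathbf L_{\underline{\mathrm{Cub}}}\mathbf{CTS}$ (resp. $\mathbf L_{\underline{\mathrm{Cub}}}\mathbf{RTS}$) is the left Bousfield localization of $\mathbf{CTS}$ (resp. $\mathbf{RTS}$) with respect to the cubification functor, i.e. with respect to the class of maps $f$ such that $\underline{\mathrm{Cub}}(f)$ is a weak equivalence, where $\underline{\mathrm{Cub}}(X)$ is the canonical colimit of all cubes $C_n[x_1,\dots,x_n]$, $n\ge0$, mapping to $X$; in both cases it coincides with the left Bousfield localization with respect to $\mathcal S$. *)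

theory Defs
  imports
    Main
    "HOL-Library.FuncSet"
    "HOL-Combinatorics.Permutations"
begin

section \<open>Categories, lifting properties, model structures, localizations\<close>

record ('o, 'm) category =
  obj :: "'o set"
  arr :: "'m set"
  src :: "'m \<Rightarrow> 'o"
  tgt :: "'m \<Rightarrow> 'o"
  ident :: "'o \<Rightarrow> 'm"
  cmp :: "'m \<Rightarrow> 'm \<Rightarrow> 'm"  \<comment> \<open>\<open>cmp K g f\<close> is \<open>g\<close> after \<open>f\<close>\<close>

definition homs :: "('o, 'm) category \<Rightarrow> 'o \<Rightarrow> 'o \<Rightarrow> 'm set" where
  "homs K A B = {f \<in> arr K. src K f = A \<and> tgt K f = B}"

definition has_lifting :: "('o, 'm) category \<Rightarrow> 'm \<Rightarrow> 'm \<Rightarrow> bool" where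
  "has_lifting K i p \<longleftrightarrow>
     (\<forall>u \<in> homs K (src K i) (src K p). \<forall>v \<in> homs K (tgt K i) (tgt K p).
        cmp K p u = cmp K v i \<longrightarrow>
        (\<exists>h \<in> homs K (tgt K i) (src K p). cmp K h i = u \<and> cmp K p h = v))"

definition rlp :: "('o, 'm) category \<Rightarrow> 'm set \<Rightarrow> 'm set" where
  "rlp K M = {p \<in> arr K. \<forall>i \<in> M. has_lifting K i p}"

definition llp :: "('o, 'm) category \<Rightarrow> 'm set \<Rightarrow> 'm set" where
  "llp K M = {i \<in> arr K. \<forall>p \<in> M. has_lifting K i p}"

definition cof :: "('o, 'm) category \<Rightarrow> 'm set \<Rightarrow> 'm set" where
  "cof K I = llp K (rlp K I)"

definition two_out_of_three :: "('o, 'm) category \<Rightarrow> 'm set \<Rightarrow> bool" where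
  "two_out_of_three K W \<longleftrightarrow>
     (\<forall>f \<in> arr K. \<forall>g \<in> arr K. tgt K f = src K g \<longrightarrow>
        (f \<in> W \<and> g \<in> W \<longrightarrow> cmp K g f \<in> W) \<and>
        (f \<in> W \<and> cmp K g f \<in> W \<longrightarrow> g \<in> W) \<and>
        (g \<in> W \<and> cmp K g f \<in> W \<longrightarrow> f \<in> W))"

definition retract_of :: "('o, 'm) category \<Rightarrow> 'm \<Rightarrow> 'm \<Rightarrow> bool" where
  "retract_of K f g \<longleftrightarrow>
     (\<exists>a \<in> homs K (src K f) (src K g). \<exists>a' \<in> homs K (src K g) (src K f).
      \<exists>b \<in> homs K (tgt K f) (tgt K g). \<exists>b' \<in> homs K (tgt K g) (tgt K f).
        cmp K a' a = ident K (src K f) \<and> cmp K b' b = ident K (tgt K f) \<and>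
        cmp K g a = cmp K b f \<and> cmp K f a' = cmp K b' g)"

definition retract_closed :: "('o, 'm) category \<Rightarrow> 'm set \<Rightarrow> bool" where
  "retract_closed K M \<longleftrightarrow> (\<forall>f \<in> arr K. \<forall>g \<in> M. retract_of K f g \<longrightarrow> f \<in> M)"

text \<open>
  Quillen's axioms for cofibrations \<open>C\<close>, weak equivalences \<open>W\<close> and fibrations \<open>F\<close>
  (completeness and cocompleteness are properties of \<open>K\<close>, not of the structure).
\<close>

definition model_structure ::
    "('o, 'm) category \<Rightarrow> 'm set \<Rightarrow> 'm set \<Rightarrow> 'm set \<Rightarrow> bool" where
  "model_structure K C W F \<longleftrightarrow>
     C \<subseteq> arr K \<and> W \<subseteq> arr K \<and> F \<subseteq> arr K \<and>
     two_out_of_three K W \<and>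
     retract_closed K C \<and> retract_closed K W \<and> retract_closed K F \<and>
     (\<forall>i \<in> C. \<forall>p \<in> F. i \<in> W \<or> p \<in> W \<longrightarrow> has_lifting K i p) \<and>
     (\<forall>f \<in> arr K. \<exists>i \<in> C \<inter> W. \<exists>p \<in> F.
        src K i = src K f \<and> tgt K i = src K p \<and> tgt K p = tgt K f \<and> f = cmp K p i) \<and>
     (\<forall>f \<in> arr K. \<exists>i \<in> C. \<exists>p \<in> F \<inter> W.
        src K i = src K f \<and> tgt K i = src K p \<and> tgt K p = tgt K f \<and> f = cmp K p i)"

text \<open>\<open>f'\<close> is the pushout of \<open>f\<close> along \<open>g\<close>.\<close>

definition is_pushout :: "('o, 'm) category \<Rightarrow> 'm \<Rightarrow> 'm \<Rightarrow> 'm \<Rightarrow> 'm \<Rightarrow> bool" where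
  "is_pushout K f g f' g' \<longleftrightarrow>
     f \<in> arr K \<and> g \<in> homs K (src K f) (src K f') \<and>
     f' \<in> arr K \<and> g' \<in> homs K (tgt K f) (tgt K f') \<and>
     cmp K g' f = cmp K f' g \<and>
     (\<forall>Z \<in> obj K. \<forall>u \<in> homs K (tgt K f) Z. \<forall>v \<in> homs K (tgt K g) Z.
        cmp K u f = cmp K v g \<longrightarrow>
        (\<exists>!h. h \<in> homs K (tgt K f') Z \<and> cmp K h g' = u \<and> cmp K h f' = v))"

text \<open>
  Diagrams indexed by a well-order \<open>r\<close> (reflexive on its field): objects \<open>D i\<close> and
  transition maps \<open>d i j : D i \<rightarrow> D j\<close> for \<open>(i, j) \<in> r\<close>.
\<close>

definition is_chain ::
    "('o, 'm) category \<Rightarrow> 'i rel \<Rightarrow> ('i \<Rightarrow> 'o) \<Rightarrow> ('i \<Rightarrow> 'i \<Rightarrow> 'm) \<Rightarrow> bool" where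
  "is_chain K r D d \<longleftrightarrow>
     (\<forall>i \<in> Field r. D i \<in> obj K \<and> d i i = ident K (D i)) \<and>
     (\<forall>i j. (i, j) \<in> r \<longrightarrow> d i j \<in> homs K (D i) (D j)) \<and>
     (\<forall>i j k. (i, j) \<in> r \<and> (j, k) \<in> r \<longrightarrow> d i k = cmp K (d j k) (d i j))"

definition chain_cocone ::
    "('o, 'm) category \<Rightarrow> 'i rel \<Rightarrow> 'i set \<Rightarrow> ('i \<Rightarrow> 'o) \<Rightarrow> ('i \<Rightarrow> 'i \<Rightarrow> 'm) \<Rightarrow>
     'o \<Rightarrow> ('i \<Rightarrow> 'm) \<Rightarrow> bool" where
  "chain_cocone K r A D d Q q \<longleftrightarrow>
     (\<forall>i \<in> A. q i \<in> homs K (D i) Q) \<and>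
     (\<forall>i \<in> A. \<forall>j \<in> A. (i, j) \<in> r \<longrightarrow> cmp K (q j) (d i j) = q i)"

definition chain_colimit ::
    "('o, 'm) category \<Rightarrow> 'i rel \<Rightarrow> 'i set \<Rightarrow> ('i \<Rightarrow> 'o) \<Rightarrow> ('i \<Rightarrow> 'i \<Rightarrow> 'm) \<Rightarrow>
     'o \<Rightarrow> ('i \<Rightarrow> 'm) \<Rightarrow> bool" where
  "chain_colimit K r A D d Q q \<longleftrightarrow>
     Q \<in> obj K \<and> chain_cocone K r A D d Q q \<and>
     (\<forall>Z \<in> obj K. \<forall>z. chain_cocone K r A D d Z z \<longrightarrow>
        (\<exists>!h. h \<in> homs K Q Z \<and> (\<forall>i \<in> A. cmp K h (q i) = z i)))"

definition immediate_succ :: "'i rel \<Rightarrow> 'i \<Rightarrow> 'i \<Rightarrow> bool" where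
  "immediate_succ r i j \<longleftrightarrow>
     (i, j) \<in> r \<and> i \<noteq> j \<and> (\<forall>k. (i, k) \<in> r \<and> (k, j) \<in> r \<longrightarrow> k = i \<or> k = j)"

definition limit_elem :: "'i rel \<Rightarrow> 'i \<Rightarrow> bool" where
  "limit_elem r l \<longleftrightarrow>
     l \<in> Field r \<and> underS r l \<noteq> {} \<and> \<not> (\<exists>i. immediate_succ r i l)"

definition is_transfinite_composite ::
    "('o, 'm) category \<Rightarrow> 'i rel \<Rightarrow> 'm set \<Rightarrow> 'm \<Rightarrow> bool" where
  "is_transfinite_composite K r M f \<longleftrightarrow>
     (\<exists>D d Q q bot.
        is_chain K r D d \<and>
        (\<forall>l. limit_elem r l \<longrightarrow>
           chain_colimit K r (underS r l) D d (D l) (\<lambda>i. d i l)) \<and>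
        (\<forall>i j. immediate_succ r i j \<longrightarrow> d i j \<in> M) \<and>
        chain_colimit K r (Field r) D d Q q \<and>
        bot \<in> Field r \<and> (\<forall>i \<in> Field r. (bot, i) \<in> r) \<and> f = q bot)"

text \<open>\<open>Ords\<close> is the class of well-orders along which transfinite compositions are taken.\<close>

definition grothendieck_localizer ::
    "('o, 'm) category \<Rightarrow> 'i rel set \<Rightarrow> 'm set \<Rightarrow> 'm set \<Rightarrow> bool" where
  "grothendieck_localizer K Ords C W \<longleftrightarrow>
     W \<subseteq> arr K \<and> two_out_of_three K W \<and> rlp K C \<subseteq> W \<and>
     (\<forall>f g f' g'. f \<in> C \<inter> W \<and> is_pushout K f g f' g' \<longrightarrow> f' \<in> C \<inter> W) \<and>
     (\<forall>r \<in> Ords. \<forall>f. is_transfinite_composite K r (C \<inter> W) f \<longrightarrow> f \<in> C \<inter> W)"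

definition least_localizer ::
    "('o, 'm) category \<Rightarrow> 'i rel set \<Rightarrow> 'm set \<Rightarrow> 'm set" where
  "least_localizer K Ords C = \<Inter> {W. grothendieck_localizer K Ords C W}"

text \<open>
  Weak equivalences of the left Bousfield localization with respect to \<open>S\<close> of a model
  structure with cofibrations \<open>C\<close> and weak equivalences \<open>W\<close>: the localization is the model
  structure with the same cofibrations and the least class of weak equivalences containing
  \<open>W\<close> and \<open>S\<close>.
\<close>

definition left_bousfield_weqs ::
    "('o, 'm) category \<Rightarrow> 'm set \<Rightarrow> 'm set \<Rightarrow> 'm set \<Rightarrow> 'm set" where
  "left_bousfield_weqs K C W S = \<Inter> {W'. (\<exists>F'. model_structure K C W' F') \<and> W \<union> S \<subseteq> W'}"

definition terminal :: "('o, 'm) category \<Rightarrow> 'o \<Rightarrow> bool" where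
  "terminal K T \<longleftrightarrow> T \<in> obj K \<and> (\<forall>X \<in> obj K. \<exists>!f. f \<in> homs K X T)"

text \<open>
  The cofibrations and weak equivalences determine the fibrations of a model structure:
  they are the maps with the right lifting property against \<open>C \<inter> W\<close>.
\<close>

definition fibrant :: "('o, 'm) category \<Rightarrow> 'm set \<Rightarrow> 'm set \<Rightarrow> 'o \<Rightarrow> bool" where
  "fibrant K C W X \<longleftrightarrow>
     X \<in> obj K \<and> (\<exists>T. terminal K T \<and> (\<exists>t \<in> homs K X T. t \<in> rlp K (C \<inter> W)))"


section \<open>Weak transition systems\<close>

text \<open>
  The set of labels is the type \<open>'x\<close>. A transition \<open>(\<alpha>, u\<^sub>1, \<dots>, u\<^sub>n, \<beta>)\<close> is
  the triple \<open>(\<alpha>, [u\<^sub>1, \<dots>, u\<^sub>n], \<beta>)\<close>.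
\<close>

record ('s, 'a, 'x) wts =
  states :: "'s set"
  acts :: "'a set"
  lab :: "'a \<Rightarrow> 'x"
  transitions :: "('s \<times> 'a list \<times> 's) set"

definition multiset_axiom :: "('s, 'a, 'x) wts \<Rightarrow> bool" where
  "multiset_axiom X \<longleftrightarrow>
     (\<forall>\<alpha> us \<beta> \<sigma>. (\<alpha>, us, \<beta>) \<in> transitions X \<and> length us \<ge> 2 \<and> \<sigma> permutes {..<length us} \<longrightarrow>
        (\<alpha>, permute_list \<sigma> us, \<beta>) \<in> transitions X)"

definition composition_axiom :: "('s, 'a, 'x) wts \<Rightarrow> bool" where
  "composition_axiom X \<longleftrightarrow>
     (\<forall>\<alpha> \<beta> \<nu>1 \<nu>2 us vs ws. us \<noteq> [] \<and> vs \<noteq> [] \<and> ws \<noteq> [] \<and>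
        (\<alpha>, us @ vs @ ws, \<beta>) \<in> transitions X \<and>
        (\<alpha>, us, \<nu>1) \<in> transitions X \<and> (\<nu>1, vs @ ws, \<beta>) \<in> transitions X \<and>
        (\<alpha>, us @ vs, \<nu>2) \<in> transitions X \<and> (\<nu>2, ws, \<beta>) \<in> transitions X \<longrightarrow>
        (\<nu>1, vs, \<nu>2) \<in> transitions X)"

text \<open>\<open>lab X\<close> is a total HOL function; extensionality makes it a map defined on \<open>acts X\<close> only.\<close>

definition weak_ts :: "('s, 'a, 'x) wts \<Rightarrow> bool" where
  "weak_ts X \<longleftrightarrow>
     lab X \<in> extensional (acts X) \<and>
     (\<forall>(\<alpha>, us, \<beta>) \<in> transitions X.
        \<alpha> \<in> states X \<and> \<beta> \<in> states X \<and> us \<noteq> [] \<and> set us \<subseteq> acts X) \<and>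
     multiset_axiom X \<and> composition_axiom X"

definition intermediate_state_axiom :: "('s, 'a, 'x) wts \<Rightarrow> bool" where
  "intermediate_state_axiom X \<longleftrightarrow>
     (\<forall>\<alpha> us vs \<beta>. us \<noteq> [] \<and> vs \<noteq> [] \<and> (\<alpha>, us @ vs, \<beta>) \<in> transitions X \<longrightarrow>
        (\<exists>\<nu>. (\<alpha>, us, \<nu>) \<in> transitions X \<and> (\<nu>, vs, \<beta>) \<in> transitions X))"

definition csa2 :: "('s, 'a, 'x) wts \<Rightarrow> bool" where
  "csa2 X \<longleftrightarrow>
     (\<forall>\<alpha> us vs \<beta>. us \<noteq> [] \<and> vs \<noteq> [] \<and> (\<alpha>, us @ vs, \<beta>) \<in> transitions X \<longrightarrow>
        (\<exists>!\<nu>. (\<alpha>, us, \<nu>) \<in> transitions X \<and> (\<nu>, vs, \<beta>) \<in> transitions X))"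

definition cubical_ts :: "('s, 'a, 'x) wts \<Rightarrow> bool" where
  "cubical_ts X \<longleftrightarrow>
     weak_ts X \<and> (\<forall>u \<in> acts X. \<exists>\<alpha> \<beta>. (\<alpha>, [u], \<beta>) \<in> transitions X) \<and>
     intermediate_state_axiom X"

definition regular_ts :: "('s, 'a, 'x) wts \<Rightarrow> bool" where
  "regular_ts X \<longleftrightarrow> cubical_ts X \<and> csa2 X"

text \<open>
  Maps are pairs (map on states, map on actions), extensional so that equality of maps is
  equality of pairs.  The state and action types of source and target may differ.
\<close>

type_synonym ('s, 'a, 't, 'b) ts_map = "('s \<Rightarrow> 't) \<times> ('a \<Rightarrow> 'b)"

definition ts_maps ::
    "('s, 'a, 'x) wts \<Rightarrow> ('t, 'b, 'x) wts \<Rightarrow> ('s, 'a, 't, 'b) ts_map set" where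
  "ts_maps X Y =
     {(f, g). f \<in> states X \<rightarrow>\<^sub>E states Y \<and> g \<in> acts X \<rightarrow>\<^sub>E acts Y \<and>
        (\<forall>u \<in> acts X. lab Y (g u) = lab X u) \<and>
        (\<forall>(\<alpha>, us, \<beta>) \<in> transitions X. (f \<alpha>, map g us, f \<beta>) \<in> transitions Y)}"

definition ts_id :: "('s, 'a, 'x) wts \<Rightarrow> ('s, 'a, 's, 'a) ts_map" where
  "ts_id X = (restrict id (states X), restrict id (acts X))"

text \<open>\<open>ts_comp X k h\<close> is \<open>k\<close> after \<open>h\<close>, where \<open>X\<close> is the source of \<open>h\<close>.\<close>

definition ts_comp ::
    "('s, 'a, 'x) wts \<Rightarrow> ('t, 'b, 'v, 'c) ts_map \<Rightarrow> ('s, 'a, 't, 'b) ts_map \<Rightarrow>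
     ('s, 'a, 'v, 'c) ts_map" where
  "ts_comp X k h = (compose (states X) (fst k) (fst h), compose (acts X) (snd k) (snd h))"

definition ts_isos ::
    "('s, 'a, 'x) wts \<Rightarrow> ('t, 'b, 'x) wts \<Rightarrow> ('s, 'a, 't, 'b) ts_map set" where
  "ts_isos X Y =
     {h \<in> ts_maps X Y. \<exists>k \<in> ts_maps Y X. ts_comp X k h = ts_id X \<and> ts_comp Y h k = ts_id Y}"


section \<open>The categories of weak, cubical and regular transition systems\<close>

text \<open>
  The type \<open>'u\<close> plays the role of the universe of sets: the (small) sets are the subsets of
  \<open>'u\<close> of cardinality less than that of \<open>'u\<close>.  The cardinality \<open>\<kappa>\<close> of \<open>'u\<close>
  is only required to be regular, uncountable and greater than the cardinality of the
  set \<open>'x\<close> of labels.  When \<open>\<kappa>\<close> is inaccessible, i.e. when \<open>\<kappa>\<close> is the cardinality of a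
  Grothendieck universe, the small sets are, up to equivalence of categories, the sets of
  that universe.
\<close>

definition small :: "'u set \<Rightarrow> bool" where
  "small A \<longleftrightarrow> (card_of A, card_of (UNIV :: 'u set)) \<in> ordLess"

definition universe_for_labels :: "'u itself \<Rightarrow> 'x itself \<Rightarrow> bool" where
  "universe_for_labels _ _ \<longleftrightarrow>
     regularCard (card_of (UNIV :: 'u set)) \<and>
     (natLeq, card_of (UNIV :: 'u set)) \<in> ordLess \<and>
     (card_of (UNIV :: 'x set), card_of (UNIV :: 'u set)) \<in> ordLess"

definition small_ordinals :: "'u rel set" where
  "small_ordinals = {r. Well_order r \<and> small (Field r)}"

type_synonym ('u, 'x) ts = "('u, 'u, 'x) wts"
type_synonym ('u, 'x) ts_arrow = "('u, 'x) ts \<times> ('u, 'u, 'u, 'u) ts_map \<times> ('u, 'x) ts"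

text \<open>The full subcategory of the category of weak transition systems on those satisfying \<open>P\<close>.\<close>

definition ts_category ::
    "(('u, 'x) ts \<Rightarrow> bool) \<Rightarrow> (('u, 'x) ts, ('u, 'x) ts_arrow) category" where
  "ts_category P =
     (let Obs = {X. weak_ts X \<and> small (states X) \<and> small (acts X) \<and> P X} in
      \<lparr> obj = Obs,
        arr = {(X, h, Y). X \<in> Obs \<and> Y \<in> Obs \<and> h \<in> ts_maps X Y},
        src = (\<lambda>(X, h, Y). X),
        tgt = (\<lambda>(X, h, Y). Y),
        ident = (\<lambda>X. (X, ts_id X, X)),
        cmp = (\<lambda>(Y, k, Z) (X, h, Y'). (X, ts_comp X k h, Z)) \<rparr>)"

definition WTS :: "(('u, 'x) ts, ('u, 'x) ts_arrow) category" where
  "WTS = ts_category (\<lambda>_. True)"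

definition CTS :: "(('u, 'x) ts, ('u, 'x) ts_arrow) category" where
  "CTS = ts_category cubical_ts"

definition RTS :: "(('u, 'x) ts, ('u, 'x) ts_arrow) category" where
  "RTS = ts_category regular_ts"


section \<open>Cubes, generating cofibrations, cubification\<close>

definition discrete_ts :: "'s set \<Rightarrow> ('s, 'a, 'x) wts" where
  "discrete_ts A = \<lparr> states = A, acts = {}, lab = (\<lambda>_. undefined), transitions = {} \<rparr>"

text \<open>Coordinates are numbered from \<open>0\<close>: the actions are the pairs \<open>(x\<^sub>i, i)\<close> with \<open>i < n\<close>.\<close>

definition cube :: "'x list \<Rightarrow> (bool list, 'x \<times> nat, 'x) wts" where
  "cube xs =
     \<lparr> states = {e. length e = length xs},
       acts = {(xs ! i, i) | i. i < length xs},
       lab = restrict fst {(xs ! i, i) | i. i < length xs},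
       transitions =
         {(e, map (\<lambda>i. (xs ! i, i)) is, e') | e is e'.
            length e = length xs \<and> length e' = length xs \<and>
            is \<noteq> [] \<and> distinct is \<and> set is \<subseteq> {..<length xs} \<and>
            (\<forall>i < length xs. e ! i \<le> e' ! i \<and> (e ! i \<noteq> e' ! i \<longleftrightarrow> i \<in> set is))} \<rparr>"

text \<open>By convention the boundary of a \<open>1\<close>-cube has no action, so the action is removed as well.\<close>

definition cube_boundary :: "'x list \<Rightarrow> (bool list, 'x \<times> nat, 'x) wts" where
  "cube_boundary xs =
     (if length xs = 1 then discrete_ts (states (cube xs))
      else cube xs \<lparr> transitions := {(e, us, e') \<in> transitions (cube xs). length us \<noteq> length xs} \<rparr>)"

definition double_transition :: "'x \<Rightarrow> (nat, 'x, 'x) wts" where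
  "double_transition x =
     \<lparr> states = {1, 2, 3, 4}, acts = {x}, lab = restrict id {x},
       transitions = {(1, [x], 2), (3, [x], 4)} \<rparr>"

text \<open>
  All maps of \<open>WTS\<close> that are isomorphic, in the category of maps, to a given map
  \<open>h : A \<rightarrow> B\<close> between systems over arbitrary types of states and actions.
\<close>

definition copies ::
    "('s, 'a, 'x) wts \<Rightarrow> ('s, 'a, 't, 'b) ts_map \<Rightarrow> ('t, 'b, 'x) wts \<Rightarrow>
     ('u, 'x) ts_arrow set" where
  "copies A h B =
     {(X, k, Y) \<in> arr WTS. \<exists>i \<in> ts_isos A X. \<exists>j \<in> ts_isos B Y. ts_comp A k i = ts_comp A j h}"

definition gen_cofs :: "('u, 'x) ts_arrow set" where
  "gen_cofs =
     copies (discrete_ts {} :: (nat, nat, 'x) wts) (ts_id (discrete_ts {} :: (nat, nat, 'x) wts))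
            (discrete_ts {0} :: (nat, nat, 'x) wts) \<union>
     copies (discrete_ts {0, 1} :: (nat, nat, 'x) wts) (\<lambda>e \<in> {0, 1}. 0, \<lambda>_. undefined)
            (discrete_ts {0} :: (nat, nat, 'x) wts) \<union>
     (\<Union>xs \<in> {xs. length xs \<ge> 1}. copies (cube_boundary xs) (ts_id (cube_boundary xs)) (cube xs)) \<union>
     (\<Union>x. copies (cube [x])
             (\<lambda>e \<in> states (cube [x]). if e = [False] then 1 else 2, \<lambda>u \<in> acts (cube [x]). x)
             (double_transition x))"

text \<open>
  \<open>cube_cocone X Z k\<close>: \<open>k\<close> is a cocone with vertex \<open>Z\<close> on the canonical diagram of \<open>X\<close>,
  whose objects are all maps \<open>h : cube xs \<rightarrow> X\<close> and whose morphisms are the maps of cubes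
  over \<open>X\<close>.
\<close>

definition cube_cocone ::
    "('u, 'x) ts \<Rightarrow> ('u, 'x) ts \<Rightarrow>
     ('x list \<Rightarrow> (bool list, 'x \<times> nat, 'u, 'u) ts_map \<Rightarrow> (bool list, 'x \<times> nat, 'u, 'u) ts_map) \<Rightarrow>
     bool" where
  "cube_cocone X Z k \<longleftrightarrow>
     (\<forall>xs. \<forall>h \<in> ts_maps (cube xs) X. k xs h \<in> ts_maps (cube xs) Z) \<and>
     (\<forall>xs ys. \<forall>c \<in> ts_maps (cube xs) (cube ys). \<forall>h \<in> ts_maps (cube ys) X.
        ts_comp (cube xs) (k ys h) c = k xs (ts_comp (cube xs) h c))"

definition is_cubification ::
    "('u, 'x) ts \<Rightarrow> ('u, 'x) ts \<Rightarrow>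
     ('x list \<Rightarrow> (bool list, 'x \<times> nat, 'u, 'u) ts_map \<Rightarrow> (bool list, 'x \<times> nat, 'u, 'u) ts_map) \<Rightarrow>
     bool" where
  "is_cubification X Q q \<longleftrightarrow>
     Q \<in> obj WTS \<and> cube_cocone X Q q \<and>
     (\<forall>Z \<in> obj WTS. \<forall>k. cube_cocone X Z k \<longrightarrow>
        (\<exists>!g. g \<in> ts_maps Q Z \<and>
           (\<forall>xs. \<forall>h \<in> ts_maps (cube xs) X. ts_comp (cube xs) g (q xs h) = k xs h)))"

text \<open>
  \<open>is_cub_of_map f f'\<close>: \<open>f'\<close> is the image of \<open>f\<close> under the cubification functor, which is
  defined only up to the choice of the colimits.
\<close>

definition is_cub_of_map :: "('u, 'x) ts_arrow \<Rightarrow> ('u, 'x) ts_arrow \<Rightarrow> bool" where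
  "is_cub_of_map f f' \<longleftrightarrow>
     (case f of (X, h, Y) \<Rightarrow> case f' of (Q, g, R) \<Rightarrow>
        g \<in> ts_maps Q R \<and>
        (\<exists>q r. is_cubification X Q q \<and> is_cubification Y R r \<and>
           (\<forall>xs. \<forall>c \<in> ts_maps (cube xs) X.
              ts_comp (cube xs) g (q xs c) = r xs (ts_comp (cube xs) h c))))"


section \<open>The model structures\<close>

text \<open>In this section \<open>K\<close> is \<open>CTS\<close> or \<open>RTS\<close>.\<close>

definition ts_cofs ::
    "(('u, 'x) ts, ('u, 'x) ts_arrow) category \<Rightarrow> ('u, 'x) ts_arrow set" where
  "ts_cofs K = cof K gen_cofs"

definition ts_weqs ::
    "(('u, 'x) ts, ('u, 'x) ts_arrow) category \<Rightarrow> ('u, 'x) ts_arrow set" where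
  "ts_weqs K = least_localizer K (small_ordinals :: 'u rel set) (ts_cofs K)"

definition cub_local_maps ::
    "(('u, 'x) ts, ('u, 'x) ts_arrow) category \<Rightarrow> ('u, 'x) ts_arrow set" where
  "cub_local_maps K = {f \<in> arr K. \<exists>f'. is_cub_of_map f f' \<and> f' \<in> ts_weqs K}"

definition LCub_weqs ::
    "(('u, 'x) ts, ('u, 'x) ts_arrow) category \<Rightarrow> ('u, 'x) ts_arrow set" where
  "LCub_weqs K = left_bousfield_weqs K (ts_cofs K) (ts_weqs K) (cub_local_maps K)"

definition LCub_fibrant ::
    "(('u, 'x) ts, ('u, 'x) ts_arrow) category \<Rightarrow> ('u, 'x) ts \<Rightarrow> bool" where
  "LCub_fibrant K X = fibrant K (ts_cofs K) (LCub_weqs K) X"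

end

theory Submission
  imports Defs
begin

text \<open>
  In both categories, \<open>X\<close> is fibrant in the localization iff it is saturated: replacing actions of a
  transition by actions with the same labels yields a transition. The statement follows since this
  condition does not mention the category.

  Saturated objects are fibrant. Say that \<open>Z\<close> is label-injective if its actions are determined by
  their labels. The maps orthogonal to all label-injective objects are the weak equivalences of a
  model structure with the given cofibrations; they form a localizer and contain the maps inverted by
  the cubification, because maps from a cubical system to a label-injective one only depend on its
  cubes. If \<open>X\<close> is saturated, identifying the actions with equal labels is a trivial fibration
  from \<open>X\<close> to a label-injective object, so \<open>X\<close> lifts against the trivial cofibrations.

  Fibrant objects are saturated. The map \<open>p\<^sub>x\<close> is inverted by the cubification, so the inclusion of
  two disjoint \<open>x\<close>-edges into two \<open>x\<close>-edges with both actions on both edges is a trivial cofibration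
  of the localization. Lifting against it saturates the \<open>1\<close>-transitions. The other transitions are
  saturated by lifting against the inclusion of \<open>X\<close> with a copy of an action acting in
  \<open>1\<close>-transitions only into \<open>X\<close> with a full copy of that action.
\<close>

section \<open>Lifting properties and localizations\<close>

text \<open>\<open>LCub_weqs\<close> is an intersection over all classes of weak equivalences that
  fit the given cofibrations and contain the old equivalences and the local maps. The two
  implications attack it from opposite sides. The upper bound \<open>LCub_weqs_W\<close> exhibits
  one such candidate, the class \<open>W\<close>. The lower bound has to put a map into every
  candidate, so it can draw only on two-out-of-three, retracts, lifting, trivial fibrations and the
  cubification-local maps.

  The pivot is the explicit form \<open>nice\<close> of the trivial fibrations, the same for cubical
  and for regular systems. It makes every map injective on actions a cofibration and allows both
  factorizations to be written down. The delicate one is the factorization for \<open>W\<close>: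
  reflections and subobjects of products may lose intermediate states, and in the regular case their
  uniqueness has to survive. Uniqueness is inherited from the systems mapped into, and
  \<open>core\<close> repairs existence afterwards.\<close>

locale category_laws =
  fixes K :: "('o, 'm) category"
  assumes homs_obj: "f \<in> homs K A B \<Longrightarrow> A \<in> obj K \<and> B \<in> obj K"
    and ident_homs: "A \<in> obj K \<Longrightarrow> ident K A \<in> homs K A A"
    and cmp_homs: "f \<in> homs K A B \<Longrightarrow> g \<in> homs K B C \<Longrightarrow> cmp K g f \<in> homs K A C"
    and cmp_assoc: "f \<in> homs K A B \<Longrightarrow> g \<in> homs K B C \<Longrightarrow> h \<in> homs K C D \<Longrightarrow>
          cmp K h (cmp K g f) = cmp K (cmp K h g) f"
    and cmp_ident_right: "f \<in> homs K A B \<Longrightarrow> cmp K f (ident K A) = f"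
    and cmp_ident_left: "f \<in> homs K A B \<Longrightarrow> cmp K (ident K B) f = f"
begin

section \<open>Lifting properties and retracts\<close>

lemma arr_homs: "f \<in> arr K \<Longrightarrow> f \<in> homs K (src K f) (tgt K f)"
  by (simp add: homs_def)

lemma homsD: "f \<in> homs K A B \<Longrightarrow> f \<in> arr K \<and> src K f = A \<and> tgt K f = B"
  by (simp add: homs_def)

lemma has_liftingE:
  assumes "has_lifting K i p" "i \<in> homs K A B" "p \<in> homs K E F"
    "u \<in> homs K A E" "v \<in> homs K B F" "cmp K p u = cmp K v i"
  obtains h where "h \<in> homs K B E" "cmp K h i = u" "cmp K p h = v"
  using assms unfolding has_lifting_def homs_def by auto

lemma has_liftingI:
  assumes "i \<in> homs K A B" "p \<in> homs K E F"
    "\<And>u v. u \<in> homs K A E \<Longrightarrow> v \<in> homs K B F \<Longrightarrow> cmp K p u = cmp K v i \<Longrightarrow>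
       \<exists>h \<in> homs K B E. cmp K h i = u \<and> cmp K p h = v"
  shows "has_lifting K i p"
  using assms unfolding has_lifting_def homs_def by auto

lemma has_lifting_cmp_right:
  assumes i: "i \<in> homs K A B" and p: "p \<in> homs K E F" and q: "q \<in> homs K F G"
    and "has_lifting K i p" "has_lifting K i q"
  shows "has_lifting K i (cmp K q p)"
proof (rule has_liftingI[OF i cmp_homs[OF p q]])
  fix u v assume u: "u \<in> homs K A E" and v: "v \<in> homs K B G"
    and eq: "cmp K (cmp K q p) u = cmp K v i"
  obtain h where h: "h \<in> homs K B F" "cmp K h i = cmp K p u" "cmp K q h = v"
    using has_liftingE[OF assms(5) i q cmp_homs[OF u p] v] eq cmp_assoc[OF u p q] by metis
  obtain k where "k \<in> homs K B E" "cmp K k i = u" "cmp K p k = h"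
    using has_liftingE[OF assms(4) i p u h(1)] h by metis
  then show "\<exists>k \<in> homs K B E. cmp K k i = u \<and> cmp K (cmp K q p) k = v"
    using cmp_assoc[OF _ p q] h(3) by metis
qed

lemma retract_ofE:
  assumes "retract_of K f g" "f \<in> homs K A B" "g \<in> homs K X Y"
  obtains a a' b b' where "a \<in> homs K A X" "a' \<in> homs K X A" "b \<in> homs K B Y" "b' \<in> homs K Y B"
    "cmp K a' a = ident K A" "cmp K b' b = ident K B" "cmp K g a = cmp K b f" "cmp K f a' = cmp K b' g"
  using assms unfolding retract_of_def homs_def by auto

lemma has_lifting_retract_right:
  assumes ret: "retract_of K p q" and p: "p \<in> homs K E F" and q: "q \<in> homs K E' F'"
    and i: "i \<in> homs K A B" and l: "has_lifting K i q"
  shows "has_lifting K i p"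
proof (rule has_liftingI[OF i p])
  fix u v assume u: "u \<in> homs K A E" and v: "v \<in> homs K B F" and eq: "cmp K p u = cmp K v i"
  obtain a a' b b' where a: "a \<in> homs K E E'" "a' \<in> homs K E' E" "b \<in> homs K F F'" "b' \<in> homs K F' F"
    "cmp K a' a = ident K E" "cmp K b' b = ident K F" "cmp K q a = cmp K b p" "cmp K p a' = cmp K b' q"
    using retract_ofE[OF ret p q] by blast
  have "cmp K q (cmp K a u) = cmp K (cmp K b v) i"
    using cmp_assoc[OF u a(1) q] a(7) cmp_assoc[OF u p a(3)] eq cmp_assoc[OF i v a(3)] by simp
  then obtain h where h: "h \<in> homs K B E'" "cmp K h i = cmp K a u" "cmp K q h = cmp K b v"
    using has_liftingE[OF l i q cmp_homs[OF u a(1)] cmp_homs[OF v a(3)]] by metis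
  have "cmp K (cmp K a' h) i = u"
    using cmp_assoc[OF i h(1) a(2)] h(2) cmp_assoc[OF u a(1,2)] a(5) cmp_ident_left[OF u] by simp
  moreover have "cmp K p (cmp K a' h) = v"
    using cmp_assoc[OF h(1) a(2) p] a(8) cmp_assoc[OF h(1) q a(4)] h(3) cmp_assoc[OF v a(3,4)] a(6) cmp_ident_left[OF v] by simp
  ultimately show "\<exists>h \<in> homs K B E. cmp K h i = u \<and> cmp K p h = v"
    using cmp_homs[OF h(1) a(2)] by blast
qed

lemma has_lifting_retract_left:
  assumes ret: "retract_of K i j" and i: "i \<in> homs K A B" and j: "j \<in> homs K A' B'"
    and p: "p \<in> homs K E F" and l: "has_lifting K j p"
  shows "has_lifting K i p"
proof (rule has_liftingI[OF i p])
  fix u v assume u: "u \<in> homs K A E" and v: "v \<in> homs K B F" and eq: "cmp K p u = cmp K v i"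
  obtain a a' b b' where a: "a \<in> homs K A A'" "a' \<in> homs K A' A" "b \<in> homs K B B'" "b' \<in> homs K B' B"
    "cmp K a' a = ident K A" "cmp K b' b = ident K B" "cmp K j a = cmp K b i" "cmp K i a' = cmp K b' j"
    using retract_ofE[OF ret i j] by blast
  have "cmp K p (cmp K u a') = cmp K (cmp K v b') j"
    using cmp_assoc[OF a(2) u p] eq cmp_assoc[OF a(2) i v] a(8) cmp_assoc[OF j a(4) v] by simp
  then obtain h where h: "h \<in> homs K B' E" "cmp K h j = cmp K u a'" "cmp K p h = cmp K v b'"
    using has_liftingE[OF l j p cmp_homs[OF a(2) u] cmp_homs[OF a(4) v]] by metis
  have "cmp K (cmp K h b) i = u"
    using cmp_assoc[OF i a(3) h(1)] a(7) cmp_assoc[OF a(1) j h(1)] h(2) cmp_assoc[OF a(1,2) u] a(5) cmp_ident_right[OF u] by simp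
  moreover have "cmp K p (cmp K h b) = v"
    using cmp_assoc[OF a(3) h(1) p] h(3) cmp_assoc[OF a(3,4) v] a(6) cmp_ident_right[OF v] by simp
  ultimately show "\<exists>h \<in> homs K B E. cmp K h i = u \<and> cmp K p h = v"
    using cmp_homs[OF a(3) h(1)] by blast
qed

lemma retract_closed_rlp: "M \<subseteq> arr K \<Longrightarrow> retract_closed K (rlp K M)"
  unfolding retract_closed_def rlp_def
  by (auto intro: has_lifting_retract_right[OF _ arr_homs arr_homs arr_homs])

lemma retract_closed_llp: "M \<subseteq> arr K \<Longrightarrow> retract_closed K (llp K M)"
  unfolding retract_closed_def llp_def
  by (auto intro: has_lifting_retract_left[OF _ arr_homs arr_homs arr_homs])

text \<open>Filling the square with top \<open>c\<close> and bottom the identity of \<open>B\<close>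
  yields a section \<open>h\<close> of \<open>p\<close>. The pair \<open>h\<close>,
  \<open>p\<close>, together with identities on \<open>A\<close>, exhibits the composite as a
  retract of \<open>c\<close>.\<close>

lemma retract_of_left_factor:
  assumes c: "c \<in> homs K A E" and p: "p \<in> homs K E B" and l: "has_lifting K (cmp K p c) p"
  shows "retract_of K (cmp K p c) c"
proof -
  let ?i = "cmp K p c"
  have i: "?i \<in> homs K A B" using cmp_homs[OF c p] .
  have o: "A \<in> obj K" "B \<in> obj K" using homs_obj[OF i] by auto
  have "cmp K p c = cmp K (ident K B) ?i" using cmp_ident_left[OF i] by simp
  then obtain h where h: "h \<in> homs K B E" "cmp K h ?i = c" "cmp K p h = ident K B"
    using has_liftingE[OF l i p c ident_homs[OF o(2)]] by metis
  show ?thesis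
    unfolding retract_of_def
    apply (rule bexI[of _ "ident K A"], rule bexI[of _ "ident K A"], rule bexI[of _ h], rule bexI[of _ p])
    using h homsD[OF i] homsD[OF c] ident_homs[OF o(1)] p
    by (auto simp: cmp_ident_right[OF ident_homs[OF o(1)]] cmp_ident_right[OF c] cmp_ident_right[OF i])
qed

lemma retract_of_right_factor:
  assumes c: "c \<in> homs K A E" and p: "p \<in> homs K E B" and l: "has_lifting K c (cmp K p c)"
  shows "retract_of K (cmp K p c) p"
proof -
  let ?i = "cmp K p c"
  have i: "?i \<in> homs K A B" using cmp_homs[OF c p] .
  have o: "A \<in> obj K" "B \<in> obj K" using homs_obj[OF i] by auto
  have "cmp K ?i (ident K A) = cmp K p c" using cmp_ident_right[OF i] by simp
  then obtain h where h: "h \<in> homs K E A" "cmp K h c = ident K A" "cmp K ?i h = p"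
    using has_liftingE[OF l c i ident_homs[OF o(1)] p] by metis
  show ?thesis
    unfolding retract_of_def
    apply (rule bexI[of _ c], rule bexI[of _ h], rule bexI[of _ "ident K B"], rule bexI[of _ "ident K B"])
    using h homsD[OF i] homsD[OF p] ident_homs[OF o(2)] c
    by (auto simp: cmp_ident_left[OF ident_homs[OF o(2)]] cmp_ident_left[OF p] cmp_ident_left[OF i])
qed

text \<open>Factor \<open>i\<close> as a trivial cofibration followed by a map \<open>p\<close> in
  \<open>F\<close>; lifting against \<open>p\<close> makes \<open>i\<close> a retract of the first
  factor. Later this places a map in an arbitrary candidate class, where a lifting property is
  easier to check than membership.\<close>

lemma retract_argument:
  assumes ms: "model_structure K C W F" and i: "i \<in> arr K"
    and l: "\<And>p. p \<in> F \<Longrightarrow> has_lifting K i p"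
  shows "i \<in> C \<inter> W"
proof -
  obtain c p where c: "c \<in> C \<inter> W" "p \<in> F" "src K c = src K i" "tgt K c = src K p"
    "tgt K p = tgt K i" "i = cmp K p c"
    using ms i unfolding model_structure_def by blast
  have "C \<subseteq> arr K" "F \<subseteq> arr K" using ms unfolding model_structure_def by auto
  then have "c \<in> homs K (src K i) (src K p)" "p \<in> homs K (src K p) (tgt K i)"
    using c unfolding homs_def by auto
  then have "retract_of K i c"
    using retract_of_left_factor l[OF c(2)] c(6) by metis
  then show ?thesis
    using ms i c(1) unfolding model_structure_def retract_closed_def by blast
qed

section \<open>Closure of left lifting classes under pushouts and transfinite compositions\<close>

lemma llp_pushout:
  assumes M: "M \<subseteq> arr K" and f: "f \<in> llp K M" and po: "is_pushout K f g f' g'"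
  shows "f' \<in> llp K M"
proof -
  have f': "f' \<in> arr K" using po unfolding is_pushout_def by simp
  define A B A' B' where "A = src K f" "B = tgt K f" "A' = src K f'" "B' = tgt K f'"
  note d = this
  have h: "f \<in> homs K A B" "f' \<in> homs K A' B'" "g \<in> homs K A A'" "g' \<in> homs K B B'"
    "cmp K g' f = cmp K f' g" and tg: "tgt K g = A'"
    using po unfolding is_pushout_def d homs_def by auto
  have U: "\<exists>!h. h \<in> homs K B' Z \<and> cmp K h g' = u \<and> cmp K h f' = v"
    if "Z \<in> obj K" "u \<in> homs K B Z" "v \<in> homs K A' Z" "cmp K u f = cmp K v g" for Z u v
    using po that tg unfolding is_pushout_def d by auto
  have "has_lifting K f' p" if p: "p \<in> M" for p
  proof -
    obtain E F where p': "p \<in> homs K E F" using M p arr_homs by blast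
    have l: "has_lifting K f p" using f p unfolding llp_def by auto
    show ?thesis
    proof (rule has_liftingI[OF h(2) p'])
      fix u v assume u: "u \<in> homs K A' E" and v: "v \<in> homs K B' F" and eq: "cmp K p u = cmp K v f'"
      have "cmp K p (cmp K u g) = cmp K (cmp K v g') f"
        using cmp_assoc[OF h(3) u p'] eq cmp_assoc[OF h(3,2) v] h(5) cmp_assoc[OF h(1,4) v] by simp
      then obtain k where k: "k \<in> homs K B E" "cmp K k f = cmp K u g" "cmp K p k = cmp K v g'"
        using has_liftingE[OF l h(1) p' cmp_homs[OF h(3) u] cmp_homs[OF h(4) v]] by metis
      obtain m where m: "m \<in> homs K B' E" "cmp K m g' = k" "cmp K m f' = u"
        using U[OF _ k(1) u k(2)] homs_obj[OF u] by blast
      have "cmp K p m \<in> homs K B' F \<and> cmp K (cmp K p m) g' = cmp K v g' \<and> cmp K (cmp K p m) f' = cmp K v f'"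
        using cmp_assoc[OF h(4) m(1) p'] cmp_assoc[OF h(2) m(1) p'] cmp_homs[OF m(1) p'] eq k(3) m by simp
      moreover have "\<exists>!h. h \<in> homs K B' F \<and> cmp K h g' = cmp K v g' \<and> cmp K h f' = cmp K v f'"
        apply (rule U)
        using homs_obj[OF v] cmp_homs[OF h(4) v] cmp_homs[OF h(2) v] h(5) cmp_assoc[OF h(1,4) v] cmp_assoc[OF h(3,2) v] by simp_all
      ultimately have "cmp K p m = v" using v by blast
      with m show "\<exists>h \<in> homs K B' E. cmp K h f' = u \<and> cmp K p h = v" by blast
    qed
  qed
  with f' show ?thesis unfolding llp_def by auto
qed

text \<open>A lift is built by well-founded recursion: chosen at successors, forced by the colimit
  property at limits. The induction carries compatibility with all earlier stages, because at a
  limit the whole initial segment has to form a cocone.\<close>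

lemma llp_transfinite_composite:
  assumes M: "M \<subseteq> arr K" and r: "Well_order r"
    and tc: "is_transfinite_composite K r (llp K M) f"
  shows "f \<in> llp K M"
proof -
  obtain D d Q q bot where ch: "is_chain K r D d"
    and lim: "\<And>l. limit_elem r l \<Longrightarrow> chain_colimit K r (underS r l) D d (D l) (\<lambda>i. d i l)"
    and suc: "\<And>i j. immediate_succ r i j \<Longrightarrow> d i j \<in> llp K M"
    and col: "chain_colimit K r (Field r) D d Q q"
    and bot: "bot \<in> Field r" "\<And>i. i \<in> Field r \<Longrightarrow> (bot, i) \<in> r" and f: "f = q bot"
    using tc unfolding is_transfinite_composite_def by blast
  have q: "q i \<in> homs K (D i) Q" if "i \<in> Field r" for i
    using col that unfolding chain_colimit_def chain_cocone_def by simp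
  have qd: "cmp K (q j) (d i j) = q i" if "(i, j) \<in> r" for i j
    using col that FieldI1[OF that] FieldI2[OF that] unfolding chain_colimit_def chain_cocone_def by blast
  have d: "d i j \<in> homs K (D i) (D j)" if "(i, j) \<in> r" for i j
    using ch that unfolding is_chain_def by blast
  have dd: "cmp K (d j k) (d i j) = d i k" if "(i, j) \<in> r" "(j, k) \<in> r" for i j k
    using ch that unfolding is_chain_def by metis
  have di: "d i i = ident K (D i)" "D i \<in> obj K" if "i \<in> Field r" for i
    using ch that unfolding is_chain_def by auto
  have refl: "(i, i) \<in> r" if "i \<in> Field r" for i
    using r that by (simp add: order_on_defs refl_on_def)
  have antisym: "i = j" if "(i, j) \<in> r" "(j, i) \<in> r" for i j
    using r that by (auto simp: order_on_defs antisym_def)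
  have trans: "(i, k) \<in> r" if "(i, j) \<in> r" "(j, k) \<in> r" for i j k
    using r that by (auto simp: order_on_defs dest: transD)
  have total: "(i, j) \<in> r \<or> (j, i) \<in> r" if "i \<in> Field r" "j \<in> Field r" for i j
    using r that refl by (cases "i = j") (auto simp: order_on_defs total_on_def)
  have wf: "wf (r - Id)" using r by (simp add: well_order_on_def)
  have f_arr: "f \<in> homs K (D bot) Q" using q[OF bot(1)] f by simp
  have "has_lifting K f p" if p: "p \<in> M" for p
  proof -
    obtain E F where p': "p \<in> homs K E F" using M p arr_homs by blast
    show ?thesis
    proof (rule has_liftingI[OF f_arr p'])
      fix u v assume u: "u \<in> homs K (D bot) E" and v: "v \<in> homs K Q F"
        and eq: "cmp K p u = cmp K v f"
      define prd where "prd i = (SOME j. immediate_succ r j i)" for i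
      \<comment> \<open>The branches are the bottom, the successors and the limits. Each reads
        \<open>H\<close> strictly below \<open>i\<close> only, so the cut-off argument of
        \<open>wfrec\<close> still gives the plain equation \<open>H i = G H i\<close>.\<close>
      define G where "G H i = (if i = bot then u
         else if \<exists>j. immediate_succ r j i then
           (SOME l. l \<in> homs K (D i) E \<and> cmp K l (d (prd i) i) = H (prd i) \<and> cmp K p l = cmp K v (q i))
         else (THE l. l \<in> homs K (D i) E \<and> (\<forall>j \<in> underS r i. cmp K l (d j i) = H j)))" for H i
      define H where "H = wfrec (r - Id) G"
      have prd: "immediate_succ r (prd i) i" if "\<exists>j. immediate_succ r j i" for i
        unfolding prd_def using someI_ex[OF that] .
      have H: "H i = G H i" for i
      proof -
        have "H i = G (cut H (r - Id) i) i" unfolding H_def using wfrec[OF wf, of G i] by simp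
        also have "\<dots> = G H i"
        proof (cases "i = bot \<or> \<not> (\<exists>j. immediate_succ r j i)")
          case True
          have "cut H (r - Id) i j = H j" if "j \<in> underS r i" for j
            using that by (auto simp: cut_def underS_def)
          then show ?thesis using True unfolding G_def by auto
        next
          case False
          then have "cut H (r - Id) i (prd i) = H (prd i)"
            using prd[of i] by (auto simp: cut_def immediate_succ_def)
          then show ?thesis using False unfolding G_def by simp
        qed
        finally show ?thesis .
      qed
      let ?P = "\<lambda>i. H i \<in> homs K (D i) E \<and> cmp K p (H i) = cmp K v (q i) \<and>
                    (\<forall>j. (j, i) \<in> r \<longrightarrow> cmp K (H i) (d j i) = H j)"
      have P: "i \<in> Field r \<longrightarrow> ?P i" for i
      proof (induction i rule: wf_induct[OF wf])
        case (1 i)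
        have IH: "?P j" if "(j, i) \<in> r" "j \<noteq> i" for j
          using 1 that FieldI1[OF that(1)] by blast
        show ?case
        proof
          assume i: "i \<in> Field r"
          note Hi = H[of i, unfolded G_def]
          consider "i = bot" | "i \<noteq> bot" "\<exists>j. immediate_succ r j i"
            | "i \<noteq> bot" "\<not> (\<exists>j. immediate_succ r j i)" by blast
          then show "?P i"
          proof cases
            case 1
            then have "H i = u" using Hi by simp
            moreover have "j = bot" if "(j, bot) \<in> r" for j
              using antisym[OF that bot(2)] FieldI1[OF that] by simp
            then have "\<forall>j. (j, i) \<in> r \<longrightarrow> j = bot" using 1 by blast
            ultimately show ?thesis using 1 u eq f cmp_ident_right[OF u] di[OF bot(1)] by metis
          next
            case 2
            let ?j = "prd i"
            have j: "(?j, i) \<in> r" "?j \<noteq> i" "\<And>k. (?j, k) \<in> r \<Longrightarrow> (k, i) \<in> r \<Longrightarrow> k = ?j \<or> k = i"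
              using prd[OF 2(2)] unfolding immediate_succ_def by auto
            have Pj: "?P ?j" using IH j by blast
            have "has_lifting K (d ?j i) p" using suc[OF prd[OF 2(2)]] p unfolding llp_def by auto
            moreover have "cmp K p (H ?j) = cmp K (cmp K v (q i)) (d ?j i)"
              using Pj qd[OF j(1)] cmp_assoc[OF d[OF j(1)] q[OF i] v] by simp
            ultimately have "\<exists>l. l \<in> homs K (D i) E \<and> cmp K l (d ?j i) = H ?j \<and> cmp K p l = cmp K v (q i)"
              using has_liftingE[OF _ d[OF j(1)] p' _ cmp_homs[OF q[OF i] v]] Pj by metis
            from someI_ex[OF this] have Hp: "H i \<in> homs K (D i) E" "cmp K (H i) (d ?j i) = H ?j"
              "cmp K p (H i) = cmp K v (q i)"
              using Hi 2 by simp_all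
            have "cmp K (H i) (d k i) = H k" if k: "(k, i) \<in> r" for k
            proof (cases "k = i")
              case True
              then show ?thesis using di[OF i] cmp_ident_right[OF Hp(1)] by simp
            next
              case False
              have kj: "(k, ?j) \<in> r"
                using total[OF FieldI1[OF k] FieldI1[OF j(1)]] j(3)[OF _ k] False refl[OF FieldI1[OF j(1)]] by auto
              have "cmp K (H i) (d k i) = cmp K (cmp K (H i) (d ?j i)) (d k ?j)"
                using dd[OF kj j(1)] cmp_assoc[OF d[OF kj] d[OF j(1)] Hp(1)] by simp
              then show ?thesis using Hp(2) Pj kj by simp
            qed
            with Hp show ?thesis by blast
          next
            case 3
            \<comment> \<open>Excludes the degenerate limit: \<open>limit_elem\<close> asks for a
              nonempty initial segment.\<close>
            have "bot \<in> underS r i" using bot(2)[OF i] 3 by (auto simp: underS_def)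
            then have "limit_elem r i" using i 3 unfolding limit_elem_def by auto
            note c = lim[OF this]
            have coc: "chain_cocone K r (underS r i) D d E H"
              unfolding chain_cocone_def using IH by (auto simp: underS_def)
            then have ex: "\<exists>!h. h \<in> homs K (D i) E \<and> (\<forall>j \<in> underS r i. cmp K h (d j i) = H j)"
              using c homs_obj[OF p'] unfolding chain_colimit_def by blast
            have Hp: "H i \<in> homs K (D i) E" "\<And>j. j \<in> underS r i \<Longrightarrow> cmp K (H i) (d j i) = H j"
              using theI'[OF ex] Hi 3 by simp_all
            have vq: "cmp K v (q i) \<in> homs K (D i) F" using cmp_homs[OF q[OF i] v] .
            have "chain_cocone K r (underS r i) D d F (\<lambda>j. cmp K v (q j))"
              unfolding chain_cocone_def
            proof (intro conjI ballI impI)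
              fix j assume "j \<in> underS r i"
              then have "j \<in> Field r" by (auto simp: underS_def dest: FieldI1)
              then show "cmp K v (q j) \<in> homs K (D j) F" using cmp_homs[OF q v] by blast
            next
              fix j k assume jk: "(j, k) \<in> r"
              show "cmp K (cmp K v (q k)) (d j k) = cmp K v (q j)"
                using cmp_assoc[OF d[OF jk] q[OF FieldI2[OF jk]] v] qd[OF jk] by simp
            qed
            \<comment> \<open>Both \<open>p\<close> after the new stage and \<open>v\<close> after
              \<open>q i\<close> restrict to the same cocone into \<open>F\<close>, so uniqueness
              shows that the limit stage still lies over \<open>v\<close>.\<close>
            then have ex2: "\<exists>!h. h \<in> homs K (D i) F \<and> (\<forall>j \<in> underS r i. cmp K h (d j i) = cmp K v (q j))"
              using c homs_obj[OF p'] unfolding chain_colimit_def by blast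
            have "cmp K (cmp K p (H i)) (d j i) = cmp K v (q j)" if j: "j \<in> underS r i" for j
            proof -
              have ji: "(j, i) \<in> r" "j \<noteq> i" using j by (auto simp: underS_def)
              show ?thesis using cmp_assoc[OF d[OF ji(1)] Hp(1) p'] Hp(2)[OF j] IH[OF ji] by simp
            qed
            moreover have "cmp K (cmp K v (q i)) (d j i) = cmp K v (q j)" if j: "j \<in> underS r i" for j
            proof -
              have ji: "(j, i) \<in> r" using j by (auto simp: underS_def)
              show ?thesis using cmp_assoc[OF d[OF ji(1)] q[OF i] v] qd[OF ji] by simp
            qed
            ultimately have "cmp K p (H i) = cmp K v (q i)"
              using ex2 vq cmp_homs[OF Hp(1) p'] by blast
            moreover have "cmp K (H i) (d j i) = H j" if j: "(j, i) \<in> r" for j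
              using Hp(2)[of j] j di[OF i] cmp_ident_right[OF Hp(1)] by (cases "j = i") (auto simp: underS_def)
            ultimately show ?thesis using Hp(1) by blast
          qed
        qed
      qed
      have "chain_cocone K r (Field r) D d E H"
        unfolding chain_cocone_def using P by blast
      then obtain h where h: "h \<in> homs K Q E" "\<And>i. i \<in> Field r \<Longrightarrow> cmp K h (q i) = H i"
        using col homs_obj[OF p'] unfolding chain_colimit_def by blast
      have "chain_cocone K r (Field r) D d F (\<lambda>j. cmp K v (q j))"
        unfolding chain_cocone_def
      proof (intro conjI ballI impI)
        fix j assume "j \<in> Field r"
        then show "cmp K v (q j) \<in> homs K (D j) F" using cmp_homs[OF q v] by blast
      next
        fix j k assume jk: "(j, k) \<in> r"
        show "cmp K (cmp K v (q k)) (d j k) = cmp K v (q j)"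
          using cmp_assoc[OF d[OF jk] q[OF FieldI2[OF jk]] v] qd[OF jk] by simp
      qed
      then have ex2: "\<exists>!h. h \<in> homs K Q F \<and> (\<forall>j \<in> Field r. cmp K h (q j) = cmp K v (q j))"
        using col homs_obj[OF p'] unfolding chain_colimit_def by blast
      moreover have "cmp K (cmp K p h) (q i) = cmp K v (q i)" if i: "i \<in> Field r" for i
        using cmp_assoc[OF q[OF i] h(1) p'] h(2)[OF i] P i by simp
      ultimately have "cmp K p h = v" using v cmp_homs[OF h(1) p'] by blast
      moreover have "cmp K h f = u" using h(2)[OF bot(1)] f H[of bot] by (simp add: G_def)
      ultimately show "\<exists>h \<in> homs K Q E. cmp K h f = u \<and> cmp K p h = v" using h(1) by blast
    qed
  qed
  then show ?thesis using homsD[OF f_arr] unfolding llp_def by auto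
qed

section \<open>Maps orthogonal to a set of objects\<close>

definition orth :: "'o set \<Rightarrow> 'm set" where
  "orth Zs = {f \<in> arr K. \<forall>Z \<in> Zs. \<forall>h \<in> homs K (src K f) Z.
     \<exists>!k. k \<in> homs K (tgt K f) Z \<and> cmp K k f = h}"

lemma orth_arr: "orth Zs \<subseteq> arr K"
  unfolding orth_def by auto

lemma orthD:
  assumes "f \<in> orth Zs" "f \<in> homs K A B" "Z \<in> Zs" "h \<in> homs K A Z"
  shows "\<exists>k. k \<in> homs K B Z \<and> cmp K k f = h"
  using assms unfolding orth_def homs_def by blast

lemma orth_unique:
  assumes "f \<in> orth Zs" "f \<in> homs K A B" "Z \<in> Zs" "k \<in> homs K B Z" "k' \<in> homs K B Z"
    "cmp K k f = cmp K k' f"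
  shows "k = k'"
proof -
  have s: "src K f = A" "tgt K f = B" using homsD[OF assms(2)] by auto
  have "\<exists>!l. l \<in> homs K B Z \<and> cmp K l f = cmp K k f"
    using assms(1,3) cmp_homs[OF assms(2,4)] s unfolding orth_def by blast
  then show ?thesis using assms by metis
qed

lemma orthI:
  assumes "f \<in> homs K A B"
    and "\<And>Z h. Z \<in> Zs \<Longrightarrow> h \<in> homs K A Z \<Longrightarrow> \<exists>k. k \<in> homs K B Z \<and> cmp K k f = h"
    and "\<And>Z k k'. Z \<in> Zs \<Longrightarrow> k \<in> homs K B Z \<Longrightarrow> k' \<in> homs K B Z \<Longrightarrow> cmp K k f = cmp K k' f \<Longrightarrow> k = k'"
  shows "f \<in> orth Zs"
proof -
  have s: "f \<in> arr K" "src K f = A" "tgt K f = B" using homsD[OF assms(1)] by auto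
  show ?thesis unfolding orth_def using assms(2,3) s by simp metis
qed

text \<open>Orthogonality means that, for each object of \<open>Zs\<close>, precomposition with
  \<open>f\<close> is a bijection from maps out of its target to maps out of its source. Bijections
  satisfy two-out-of-three; existence of extensions alone would not suffice.\<close>

lemma two_out_of_three_orth: "two_out_of_three K (orth Zs)"
  unfolding two_out_of_three_def
proof (intro ballI impI)
  fix f g assume "f \<in> arr K" "g \<in> arr K" "tgt K f = src K g"
  then obtain A B D where f: "f \<in> homs K A B" and g: "g \<in> homs K B D"
    unfolding homs_def by auto
  note gf = cmp_homs[OF f g]
  have 1: "cmp K g f \<in> orth Zs" if o: "f \<in> orth Zs" "g \<in> orth Zs"
  proof (rule orthI[OF gf])
    fix Z h assume Z: "Z \<in> Zs" and h: "h \<in> homs K A Z"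
    obtain k where k: "k \<in> homs K B Z" "cmp K k f = h" using orthD[OF o(1) f Z h] by blast
    obtain l where l: "l \<in> homs K D Z" "cmp K l g = k" using orthD[OF o(2) g Z k(1)] by blast
    show "\<exists>k. k \<in> homs K D Z \<and> cmp K k (cmp K g f) = h"
      using k l cmp_assoc[OF f g l(1)] by auto
  next
    fix Z k k' assume Z: "Z \<in> Zs" and k: "k \<in> homs K D Z" "k' \<in> homs K D Z"
      "cmp K k (cmp K g f) = cmp K k' (cmp K g f)"
    have "cmp K k g = cmp K k' g"
      using orth_unique[OF o(1) f Z cmp_homs[OF g k(1)] cmp_homs[OF g k(2)]] k(3)
        cmp_assoc[OF f g k(1)] cmp_assoc[OF f g k(2)] by simp
    then show "k = k'" using orth_unique[OF o(2) g Z k(1,2)] by blast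
  qed
  have 2: "g \<in> orth Zs" if o: "f \<in> orth Zs" "cmp K g f \<in> orth Zs"
  proof (rule orthI[OF g])
    fix Z h assume Z: "Z \<in> Zs" and h: "h \<in> homs K B Z"
    obtain k where k: "k \<in> homs K D Z" "cmp K k (cmp K g f) = cmp K h f"
      using orthD[OF o(2) gf Z cmp_homs[OF f h]] by blast
    have "cmp K k g = h"
      using orth_unique[OF o(1) f Z cmp_homs[OF g k(1)] h] k(2) cmp_assoc[OF f g k(1)] by simp
    then show "\<exists>k. k \<in> homs K D Z \<and> cmp K k g = h" using k(1) by blast
  next
    fix Z k k' assume Z: "Z \<in> Zs" and k: "k \<in> homs K D Z" "k' \<in> homs K D Z" "cmp K k g = cmp K k' g"
    then show "k = k'"
      using orth_unique[OF o(2) gf Z k(1,2)] cmp_assoc[OF f g k(1)] cmp_assoc[OF f g k(2)] by simp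
  qed
  have 3: "f \<in> orth Zs" if o: "g \<in> orth Zs" "cmp K g f \<in> orth Zs"
  proof (rule orthI[OF f])
    fix Z h assume Z: "Z \<in> Zs" and h: "h \<in> homs K A Z"
    obtain k where k: "k \<in> homs K D Z" "cmp K k (cmp K g f) = h" using orthD[OF o(2) gf Z h] by blast
    then show "\<exists>k. k \<in> homs K B Z \<and> cmp K k f = h"
      using cmp_homs[OF g k(1)] cmp_assoc[OF f g k(1)] by auto
  next
    fix Z k k' assume Z: "Z \<in> Zs" and k: "k \<in> homs K B Z" "k' \<in> homs K B Z" "cmp K k f = cmp K k' f"
    obtain l where l: "l \<in> homs K D Z" "cmp K l g = k" using orthD[OF o(1) g Z k(1)] by blast
    obtain l' where l': "l' \<in> homs K D Z" "cmp K l' g = k'" using orthD[OF o(1) g Z k(2)] by blast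
    have "l = l'"
      using orth_unique[OF o(2) gf Z l(1) l'(1)] cmp_assoc[OF f g l(1)] cmp_assoc[OF f g l'(1)] l l' k(3) by simp
    then show "k = k'" using l l' by simp
  qed
  show "(f \<in> orth Zs \<and> g \<in> orth Zs \<longrightarrow> cmp K g f \<in> orth Zs) \<and>
        (f \<in> orth Zs \<and> cmp K g f \<in> orth Zs \<longrightarrow> g \<in> orth Zs) \<and>
        (g \<in> orth Zs \<and> cmp K g f \<in> orth Zs \<longrightarrow> f \<in> orth Zs)"
    using 1 2 3 by blast
qed

text \<open>A retract of a bijection between hom sets is a bijection.\<close>

lemma retract_closed_orth: "retract_closed K (orth Zs)"
  unfolding retract_closed_def
proof (intro ballI impI)
  fix f g assume f: "f \<in> arr K" and g: "g \<in> orth Zs" and ret: "retract_of K f g"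
  define A B X Y where "A = src K f" "B = tgt K f" "X = src K g" "Y = tgt K g"
  then have f: "f \<in> homs K A B" and g': "g \<in> homs K X Y"
    using arr_homs f g orth_arr by auto
  obtain a a' b b' where a: "a \<in> homs K A X" "a' \<in> homs K X A" "b \<in> homs K B Y" "b' \<in> homs K Y B"
    "cmp K a' a = ident K A" "cmp K b' b = ident K B" "cmp K g a = cmp K b f" "cmp K f a' = cmp K b' g"
    using retract_ofE[OF ret f g'] by blast
  show "f \<in> orth Zs"
  proof (rule orthI[OF f])
    fix Z h assume Z: "Z \<in> Zs" and h: "h \<in> homs K A Z"
    obtain k where k: "k \<in> homs K Y Z" "cmp K k g = cmp K h a'"
      using orthD[OF g g' Z cmp_homs[OF a(2) h]] by blast
    have "cmp K (cmp K k b) f = h"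
      using cmp_assoc[OF f a(3) k(1)] a(7) cmp_assoc[OF a(1) g' k(1)] k(2) cmp_assoc[OF a(1,2) h] a(5)
        cmp_ident_right[OF h] by simp
    then show "\<exists>k. k \<in> homs K B Z \<and> cmp K k f = h" using cmp_homs[OF a(3) k(1)] by blast
  next
    fix Z k k' assume Z: "Z \<in> Zs" and k: "k \<in> homs K B Z" "k' \<in> homs K B Z" and e: "cmp K k f = cmp K k' f"
    have *: "cmp K (cmp K l b') g = cmp K (cmp K l f) a'" if "l \<in> homs K B Z" for l
      using that cmp_assoc[OF g' a(4) that] cmp_assoc[OF a(2) f that] a(8) by simp
    have "cmp K k b' = cmp K k' b'"
      using orth_unique[OF g g' Z cmp_homs[OF a(4) k(1)] cmp_homs[OF a(4) k(2)]] *[OF k(1)] *[OF k(2)] e by simp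
    then have "cmp K (cmp K k b') b = cmp K (cmp K k' b') b" by simp
    then show "k = k'"
      using cmp_assoc[OF a(3,4) k(1)] cmp_assoc[OF a(3,4) k(2)] a(6)
        cmp_ident_right[OF k(1)] cmp_ident_right[OF k(2)] by simp
  qed
qed

end

text \<open>
  \<open>T\<close> is the class of trivial fibrations. The left factor in \<open>fact_W\<close> need not be a cofibration:
  factoring it further by \<open>fact_C\<close> makes it one.
\<close>

locale localization = category_laws K for K :: "('o, 'm) category" +
  fixes C T W :: "'m set"
  assumes C_eq: "C = llp K T" and T_arr: "T \<subseteq> arr K" and T_retr: "retract_closed K T"
    and W_arr: "W \<subseteq> arr K" and W_two: "two_out_of_three K W" and W_retr: "retract_closed K W"
    and TW: "T \<subseteq> W"
    and fact_C: "f \<in> homs K A B \<Longrightarrow> \<exists>E. \<exists>i \<in> homs K A E. \<exists>p \<in> homs K E B. i \<in> C \<and> p \<in> T \<and> f = cmp K p i"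
    and fact_W: "f \<in> homs K A B \<Longrightarrow> \<exists>E. \<exists>i \<in> homs K A E. \<exists>p \<in> homs K E B. i \<in> W \<and> p \<in> rlp K W \<and> f = cmp K p i"
begin

section \<open>Model structure and localizer from the two factorizations\<close>

definition F where "F = rlp K (C \<inter> W)"

lemma C_arr: "C \<subseteq> arr K"
  unfolding C_eq llp_def by auto

lemma F_arr: "F \<subseteq> arr K"
  unfolding F_def rlp_def by auto

lemma C_T: "i \<in> C \<Longrightarrow> p \<in> T \<Longrightarrow> has_lifting K i p"
  unfolding C_eq llp_def by auto

lemma W_cancel_left:
  "c \<in> homs K A E \<Longrightarrow> p \<in> homs K E B \<Longrightarrow> p \<in> W \<Longrightarrow> cmp K p c \<in> W \<Longrightarrow> c \<in> W"
  using W_two unfolding two_out_of_three_def homs_def by auto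

text \<open>Factored through \<open>C\<close> and \<open>T\<close>, the map \<open>p\<close> lifts
  against the left factor and so is a retract of the right one.\<close>

lemma rlp_C: "rlp K C \<subseteq> T"
proof
  fix p assume p: "p \<in> rlp K C"
  then have "p \<in> homs K (src K p) (tgt K p)" unfolding rlp_def by (auto intro: arr_homs)
  from fact_C[OF this] obtain E i t where i: "i \<in> homs K (src K p) E" "t \<in> homs K E (tgt K p)"
    "i \<in> C" "t \<in> T" "p = cmp K t i" by blast
  then have "retract_of K p t" using retract_of_right_factor p unfolding rlp_def by blast
  then show "p \<in> T" using T_retr i(4) p unfolding retract_closed_def rlp_def by auto
qed

text \<open>Two-out-of-three puts the left factor of a factorization through \<open>C\<close> and
  \<open>T\<close> into \<open>W\<close>. Hence \<open>p\<close> lifts against it and is a retract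
  of the right factor.\<close>

lemma F_W: "p \<in> F \<Longrightarrow> p \<in> W \<Longrightarrow> p \<in> T"
proof -
  assume p: "p \<in> F" and pW: "p \<in> W"
  then have "p \<in> homs K (src K p) (tgt K p)" using F_arr by (auto intro: arr_homs)
  from fact_C[OF this] obtain E i t where i: "i \<in> homs K (src K p) E" "t \<in> homs K E (tgt K p)"
    "i \<in> C" "t \<in> T" "p = cmp K t i" by blast
  then have "i \<in> W" using W_cancel_left pW TW by blast
  then have "retract_of K p t"
    using retract_of_right_factor[OF i(1,2)] p i unfolding F_def rlp_def by blast
  then show "p \<in> T" using T_retr i(4) p F_arr unfolding retract_closed_def by blast
qed

lemma model: "model_structure K C W F"
  unfolding model_structure_def
proof (intro conjI ballI impI)
  show "C \<subseteq> arr K" "W \<subseteq> arr K" "F \<subseteq> arr K" "two_out_of_three K W" "retract_closed K W"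
    using C_arr W_arr F_arr W_two W_retr by auto
  show "retract_closed K C" unfolding C_eq by (rule retract_closed_llp[OF T_arr])
  show "retract_closed K F" unfolding F_def by (rule retract_closed_rlp) (use C_arr in auto)
next
  fix i p assume "i \<in> C" "p \<in> F" "i \<in> W \<or> p \<in> W"
  then show "has_lifting K i p" using C_T F_W unfolding F_def rlp_def by auto
next
  fix f assume "f \<in> arr K"
  then have "f \<in> homs K (src K f) (tgt K f)" by (rule arr_homs)
  from fact_C[OF this] obtain E i p where i: "i \<in> homs K (src K f) E" "p \<in> homs K E (tgt K f)"
    "i \<in> C" "p \<in> T" "f = cmp K p i" by blast
  have "p \<in> F \<inter> W" using i C_T TW homsD unfolding F_def rlp_def by auto
  with i show "\<exists>i \<in> C. \<exists>p \<in> F \<inter> W.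
        src K i = src K f \<and> tgt K i = src K p \<and> tgt K p = tgt K f \<and> f = cmp K p i"
    using homsD[OF i(1)] homsD[OF i(2)] by (intro bexI[of _ i] bexI[of _ p]) auto
next
  fix f assume "f \<in> arr K"
  then have "f \<in> homs K (src K f) (tgt K f)" by (rule arr_homs)
  from fact_W[OF this] obtain E w q where w: "w \<in> homs K (src K f) E" "q \<in> homs K E (tgt K f)"
    "w \<in> W" "q \<in> rlp K W" "f = cmp K q w" by blast
  from fact_C[OF w(1)] obtain D i p where i: "i \<in> homs K (src K f) D" "p \<in> homs K D E"
    "i \<in> C" "p \<in> T" "w = cmp K p i" by blast
  have iW: "i \<in> W" using W_cancel_left[OF i(1,2)] i w(3) TW by blast
  \<comment> \<open>\<open>p\<close> lifts against all of \<open>C\<close> and \<open>q\<close>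
    against all of \<open>W\<close>, so their composite lifts against the intersection.\<close>
  have "has_lifting K c (cmp K q p)" if "c \<in> C" "c \<in> W" for c
    using has_lifting_cmp_right[OF arr_homs i(2) w(2)] that C_T[OF _ i(4)] w(4) C_arr
    unfolding rlp_def by blast
  then have "cmp K q p \<in> F" using homsD[OF cmp_homs[OF i(2) w(2)]] unfolding F_def rlp_def by blast
  moreover have "f = cmp K (cmp K q p) i" using w i cmp_assoc[OF i(1,2) w(2)] by simp
  ultimately show "\<exists>i \<in> C \<inter> W. \<exists>p \<in> F.
        src K i = src K f \<and> tgt K i = src K p \<and> tgt K p = tgt K f \<and> f = cmp K p i"
    using i iW homsD[OF i(1)] homsD[OF cmp_homs[OF i(2) w(2)]] by (intro bexI[of _ i] bexI[of _ "cmp K q p"]) auto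
qed

lemma C_W_eq: "C \<inter> W = llp K F"
proof
  show "C \<inter> W \<subseteq> llp K F" using C_arr unfolding llp_def F_def rlp_def by auto
  show "llp K F \<subseteq> C \<inter> W" using retract_argument[OF model] unfolding llp_def by blast
qed

text \<open>As the left lifting class of \<open>F\<close>, the class \<open>C \<inter> W\<close> is
  closed under pushouts and under transfinite compositions along arbitrary well-orders.\<close>

lemma localizer: "Ords \<subseteq> {r. Well_order r} \<Longrightarrow> grothendieck_localizer K Ords C W"
  unfolding grothendieck_localizer_def C_W_eq
  using W_arr W_two rlp_C TW llp_pushout[OF F_arr] llp_transfinite_composite[OF F_arr] by blast

end

section \<open>Maps of weak transition systems\<close>

lemma weak_tsD:
  assumes "weak_ts X" "(\<alpha>, us, \<beta>) \<in> transitions X"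
  shows "\<alpha> \<in> states X" "\<beta> \<in> states X" "us \<noteq> []" "set us \<subseteq> acts X"
  using assms unfolding weak_ts_def by auto

lemma weak_ts_compose:
  assumes "weak_ts X" "us \<noteq> []" "vs \<noteq> []" "ws \<noteq> []"
    "(\<alpha>, us @ vs @ ws, \<beta>) \<in> transitions X"
    "(\<alpha>, us, \<nu>1) \<in> transitions X" "(\<nu>1, vs @ ws, \<beta>) \<in> transitions X"
    "(\<alpha>, us @ vs, \<nu>2) \<in> transitions X" "(\<nu>2, ws, \<beta>) \<in> transitions X"
  shows "(\<nu>1, vs, \<nu>2) \<in> transitions X"
  using assms unfolding weak_ts_def composition_axiom_def by blast

text \<open>The multiset axiom in the form used below: the order of the action list is irrelevant.
  Lists of length one, which the axiom leaves out, are harmless because a singleton multiset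
  determines its list.\<close>

lemma transition_mset_cong:
  assumes "weak_ts X" "(\<alpha>, us, \<beta>) \<in> transitions X" "mset vs = mset us"
  shows "(\<alpha>, vs, \<beta>) \<in> transitions X"
proof (cases "length us \<ge> 2")
  case True
  obtain p where "p permutes {..<length us}" "permute_list p us = vs"
    using mset_eq_permutation[OF assms(3)] .
  then show ?thesis using assms(1,2) True unfolding weak_ts_def multiset_axiom_def by blast
next
  case False
  then have "length us = 1"
    using weak_tsD(3)[OF assms(1,2)] by (cases us; cases "tl us") auto
  then obtain u where "us = [u]" by (auto simp: length_Suc_conv)
  then have "vs = us" using assms(3) by simp
  then show ?thesis using assms by simp
qed

lemma weak_tsI:
  assumes "lab X \<in> extensional (acts X)"
    and "\<And>\<alpha> us \<beta>. (\<alpha>, us, \<beta>) \<in> transitions X \<Longrightarrow>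
      \<alpha> \<in> states X \<and> \<beta> \<in> states X \<and> us \<noteq> [] \<and> set us \<subseteq> acts X"
    and "\<And>\<alpha> us \<beta> vs. (\<alpha>, us, \<beta>) \<in> transitions X \<Longrightarrow> mset vs = mset us \<Longrightarrow> (\<alpha>, vs, \<beta>) \<in> transitions X"
    and "\<And>\<alpha> us vs ws \<beta> \<nu>1 \<nu>2. us \<noteq> [] \<Longrightarrow> vs \<noteq> [] \<Longrightarrow> ws \<noteq> [] \<Longrightarrow>
      (\<alpha>, us @ vs @ ws, \<beta>) \<in> transitions X \<Longrightarrow>
      (\<alpha>, us, \<nu>1) \<in> transitions X \<Longrightarrow> (\<nu>1, vs @ ws, \<beta>) \<in> transitions X \<Longrightarrow>
      (\<alpha>, us @ vs, \<nu>2) \<in> transitions X \<Longrightarrow> (\<nu>2, ws, \<beta>) \<in> transitions X \<Longrightarrow> (\<nu>1, vs, \<nu>2) \<in> transitions X"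
  shows "weak_ts X"
  unfolding weak_ts_def
proof (intro conjI)
  show "lab X \<in> extensional (acts X)" by fact
  show "\<forall>(\<alpha>, us, \<beta>) \<in> transitions X.
        \<alpha> \<in> states X \<and> \<beta> \<in> states X \<and> us \<noteq> [] \<and> set us \<subseteq> acts X"
    using assms(2) by auto
  show "multiset_axiom X"
    unfolding multiset_axiom_def using assms(3) by (auto simp: mset_permute_list)
  show "composition_axiom X"
    unfolding composition_axiom_def using assms(4) by blast
qed

lemma intermediate_state:
  assumes "cubical_ts X" "(\<alpha>, us @ vs, \<beta>) \<in> transitions X" "us \<noteq> []" "vs \<noteq> []"
  obtains \<nu> where "(\<alpha>, us, \<nu>) \<in> transitions X" "(\<nu>, vs, \<beta>) \<in> transitions X"
  using assms unfolding cubical_ts_def intermediate_state_axiom_def by blast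

text \<open>The uniqueness half of CSA2, separated from existence so that it makes sense for systems
  that may lack intermediate states and to which \<open>core\<close> is applied afterwards.\<close>

definition intermediate_unique :: "('s, 'a, 'x) wts \<Rightarrow> bool" where
  "intermediate_unique X \<longleftrightarrow> (\<forall>\<alpha> us vs \<beta> \<nu> \<nu>'. us \<noteq> [] \<and> vs \<noteq> [] \<and> (\<alpha>, us @ vs, \<beta>) \<in> transitions X \<and>
     (\<alpha>, us, \<nu>) \<in> transitions X \<and> (\<nu>, vs, \<beta>) \<in> transitions X \<and>
     (\<alpha>, us, \<nu>') \<in> transitions X \<and> (\<nu>', vs, \<beta>) \<in> transitions X \<longrightarrow> \<nu> = \<nu>')"

text \<open>
  Cubical systems for \<open>r = False\<close> and regular ones for \<open>r = True\<close>, so that both model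
  categories are treated at once.
\<close>

definition cub_or_reg :: "bool \<Rightarrow> ('s, 'a, 'x) wts \<Rightarrow> bool" where
  "cub_or_reg r X \<longleftrightarrow> cubical_ts X \<and> (r \<longrightarrow> intermediate_unique X)"

lemma cub_or_reg_False: "cub_or_reg False = cubical_ts"
  by (auto simp: cub_or_reg_def)

lemma cub_or_reg_True: "cub_or_reg True = (regular_ts :: ('s, 'a, 'x) wts \<Rightarrow> bool)"
proof
  fix X :: "('s, 'a, 'x) wts"
  show "cub_or_reg True X = regular_ts X"
  proof
    assume X: "cub_or_reg True X"
    then have c: "cubical_ts X" and iu: "intermediate_unique X"
      by (auto simp: cub_or_reg_def)
    have "csa2 X"
      unfolding csa2_def
    proof (intro allI impI)
      fix \<alpha> us vs \<beta> assume a: "us \<noteq> [] \<and> vs \<noteq> [] \<and> (\<alpha>, us @ vs, \<beta>) \<in> transitions X"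
      then obtain \<nu> where n: "(\<alpha>, us, \<nu>) \<in> transitions X" "(\<nu>, vs, \<beta>) \<in> transitions X"
        using intermediate_state[OF c] by metis
      show "\<exists>!\<nu>. (\<alpha>, us, \<nu>) \<in> transitions X \<and> (\<nu>, vs, \<beta>) \<in> transitions X"
      proof (rule ex1I[of _ \<nu>])
        show "(\<alpha>, us, \<nu>) \<in> transitions X \<and> (\<nu>, vs, \<beta>) \<in> transitions X" using n by simp
        fix \<nu>' assume "(\<alpha>, us, \<nu>') \<in> transitions X \<and> (\<nu>', vs, \<beta>) \<in> transitions X"
        then show "\<nu>' = \<nu>" using iu[unfolded intermediate_unique_def] a n by metis
      qed
    qed
    then show "regular_ts X" using c by (simp add: regular_ts_def)
  next
    assume X: "regular_ts X"
    then have c: "cubical_ts X" and u: "csa2 X" by (auto simp: regular_ts_def)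
    have "intermediate_unique X"
      unfolding intermediate_unique_def using u[unfolded csa2_def] by blast
    then show "cub_or_reg True X" using c by (simp add: cub_or_reg_def)
  qed
qed

lemma cub_or_regI:
  assumes "weak_ts X" "\<And>u. u \<in> acts X \<Longrightarrow> \<exists>\<alpha> \<beta>. (\<alpha>, [u], \<beta>) \<in> transitions X"
    and "\<And>\<alpha> us vs \<beta>. us \<noteq> [] \<Longrightarrow> vs \<noteq> [] \<Longrightarrow> (\<alpha>, us @ vs, \<beta>) \<in> transitions X \<Longrightarrow>
      \<exists>\<nu>. (\<alpha>, us, \<nu>) \<in> transitions X \<and> (\<nu>, vs, \<beta>) \<in> transitions X"
    and "\<And>\<alpha> us vs \<beta> \<nu> \<nu>'. r \<Longrightarrow> us \<noteq> [] \<Longrightarrow> vs \<noteq> [] \<Longrightarrow> (\<alpha>, us @ vs, \<beta>) \<in> transitions X \<Longrightarrow>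
      (\<alpha>, us, \<nu>) \<in> transitions X \<Longrightarrow> (\<nu>, vs, \<beta>) \<in> transitions X \<Longrightarrow>
      (\<alpha>, us, \<nu>') \<in> transitions X \<Longrightarrow> (\<nu>', vs, \<beta>) \<in> transitions X \<Longrightarrow> \<nu> = \<nu>'"
  shows "cub_or_reg r X"
  unfolding cub_or_reg_def cubical_ts_def intermediate_state_axiom_def intermediate_unique_def
  using assms by (intro conjI impI allI ballI) blast+

lemma cub_or_regD:
  assumes "cub_or_reg r X"
  shows "weak_ts X" "cubical_ts X"
    and "u \<in> acts X \<Longrightarrow> \<exists>\<alpha> \<beta>. (\<alpha>, [u], \<beta>) \<in> transitions X"
    and "us \<noteq> [] \<Longrightarrow> vs \<noteq> [] \<Longrightarrow> (\<alpha>, us @ vs, \<beta>) \<in> transitions X \<Longrightarrow>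
      \<exists>\<nu>. (\<alpha>, us, \<nu>) \<in> transitions X \<and> (\<nu>, vs, \<beta>) \<in> transitions X"
    and "r \<Longrightarrow> us \<noteq> [] \<Longrightarrow> vs \<noteq> [] \<Longrightarrow> (\<alpha>, us @ vs, \<beta>) \<in> transitions X \<Longrightarrow>
      (\<alpha>, us, \<nu>) \<in> transitions X \<Longrightarrow> (\<nu>, vs, \<beta>) \<in> transitions X \<Longrightarrow>
      (\<alpha>, us, \<nu>') \<in> transitions X \<Longrightarrow> (\<nu>', vs, \<beta>) \<in> transitions X \<Longrightarrow> \<nu> = \<nu>'"
proof -
  have a: "weak_ts X" "\<forall>u \<in> acts X. \<exists>\<alpha> \<beta>. (\<alpha>, [u], \<beta>) \<in> transitions X"
    "intermediate_state_axiom X" "r \<longrightarrow> intermediate_unique X"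
    using assms unfolding cub_or_reg_def cubical_ts_def by auto
  show "weak_ts X" "cubical_ts X" using assms a by (auto simp: cub_or_reg_def)
  show "u \<in> acts X \<Longrightarrow> \<exists>\<alpha> \<beta>. (\<alpha>, [u], \<beta>) \<in> transitions X" using a(2) by blast
  show "us \<noteq> [] \<Longrightarrow> vs \<noteq> [] \<Longrightarrow> (\<alpha>, us @ vs, \<beta>) \<in> transitions X \<Longrightarrow>
      \<exists>\<nu>. (\<alpha>, us, \<nu>) \<in> transitions X \<and> (\<nu>, vs, \<beta>) \<in> transitions X"
    using a(3) unfolding intermediate_state_axiom_def by blast
  show "r \<Longrightarrow> us \<noteq> [] \<Longrightarrow> vs \<noteq> [] \<Longrightarrow> (\<alpha>, us @ vs, \<beta>) \<in> transitions X \<Longrightarrow>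
      (\<alpha>, us, \<nu>) \<in> transitions X \<Longrightarrow> (\<nu>, vs, \<beta>) \<in> transitions X \<Longrightarrow>
      (\<alpha>, us, \<nu>') \<in> transitions X \<Longrightarrow> (\<nu>', vs, \<beta>) \<in> transitions X \<Longrightarrow> \<nu> = \<nu>'"
    using a(4) unfolding intermediate_unique_def by blast
qed

section \<open>Maps given by total functions\<close>

definition is_map :: "('s, 'a, 'x) wts \<Rightarrow> ('t, 'b, 'x) wts \<Rightarrow> ('s \<Rightarrow> 't) \<Rightarrow> ('a \<Rightarrow> 'b) \<Rightarrow> bool" where
  "is_map A B f g \<longleftrightarrow> f ` states A \<subseteq> states B \<and> g ` acts A \<subseteq> acts B \<and>
     (\<forall>u \<in> acts A. lab B (g u) = lab A u) \<and>
     (\<forall>\<alpha> us \<beta>. (\<alpha>, us, \<beta>) \<in> transitions A \<longrightarrow> (f \<alpha>, map g us, f \<beta>) \<in> transitions B)"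

lemma is_mapI:
  assumes "\<And>a. a \<in> states A \<Longrightarrow> f a \<in> states B" "\<And>u. u \<in> acts A \<Longrightarrow> g u \<in> acts B"
    "\<And>u. u \<in> acts A \<Longrightarrow> lab B (g u) = lab A u"
    "\<And>\<alpha> us \<beta>. (\<alpha>, us, \<beta>) \<in> transitions A \<Longrightarrow> (f \<alpha>, map g us, f \<beta>) \<in> transitions B"
  shows "is_map A B f g"
  using assms unfolding is_map_def by auto

lemma is_mapD:
  assumes "is_map A B f g"
  shows "a \<in> states A \<Longrightarrow> f a \<in> states B" "u \<in> acts A \<Longrightarrow> g u \<in> acts B"
    "u \<in> acts A \<Longrightarrow> lab B (g u) = lab A u"
    "(\<alpha>, us, \<beta>) \<in> transitions A \<Longrightarrow> (f \<alpha>, map g us, f \<beta>) \<in> transitions B"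
  using assms unfolding is_map_def by auto

lemma is_map_cong:
  assumes "weak_ts A" "\<And>a. a \<in> states A \<Longrightarrow> f a = f' a" "\<And>u. u \<in> acts A \<Longrightarrow> g u = g' u"
  shows "is_map A B f g \<longleftrightarrow> is_map A B f' g'"
proof -
  have *: "is_map A B k l" if "is_map A B k' l'" "\<And>a. a \<in> states A \<Longrightarrow> k a = k' a"
    "\<And>u. u \<in> acts A \<Longrightarrow> l u = l' u" for k k' l l'
  proof (rule is_mapI)
    fix \<alpha> us \<beta> assume t: "(\<alpha>, us, \<beta>) \<in> transitions A"
    have "map l us = map l' us" using weak_tsD(4)[OF assms(1) t] that(3) by auto
    moreover have "k \<alpha> = k' \<alpha>" "k \<beta> = k' \<beta>" using weak_tsD(1,2)[OF assms(1) t] that(2) by auto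
    ultimately show "(k \<alpha>, map l us, k \<beta>) \<in> transitions B"
      using is_mapD(4)[OF that(1) t] by metis
  qed (use is_mapD[OF that(1)] that(2,3) in auto)
  show ?thesis using *[of f g f' g'] *[of f' g' f g] assms(2,3) by metis
qed

lemma is_map_comp:
  assumes "is_map A B f g" "is_map B D f' g'"
  shows "is_map A D (\<lambda>a. f' (f a)) (\<lambda>u. g' (g u))"
proof (rule is_mapI)
  fix \<alpha> us \<beta> assume "(\<alpha>, us, \<beta>) \<in> transitions A"
  from is_mapD(4)[OF assms(2) is_mapD(4)[OF assms(1) this]]
  show "(f' (f \<alpha>), map (\<lambda>u. g' (g u)) us, f' (f \<beta>)) \<in> transitions D"
    by (simp add: comp_def)
qed (use is_mapD[OF assms(1)] is_mapD[OF assms(2)] in auto)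

lemma is_map_id: "is_map A A (\<lambda>a. a) (\<lambda>u. u)"
  by (auto simp: is_map_def)

text \<open>\<open>is_map\<close> allows plain lambda terms with arbitrary values off the carriers;
  \<open>rst\<close> cuts them down to the extensional representative for which equality of maps is
  equality of pairs.\<close>

definition rst :: "('s, 'a, 'x) wts \<Rightarrow> ('s \<Rightarrow> 't) \<Rightarrow> ('a \<Rightarrow> 'b) \<Rightarrow> ('s, 'a, 't, 'b) ts_map" where
  "rst A f g = (restrict f (states A), restrict g (acts A))"

lemma rst_eq_iff: "rst A f g = rst A f' g' \<longleftrightarrow> (\<forall>a \<in> states A. f a = f' a) \<and> (\<forall>u \<in> acts A. g u = g' u)"
  unfolding rst_def by (auto simp: restrict_def fun_eq_iff)

lemma rst_simps [simp]:
  "a \<in> states A \<Longrightarrow> fst (rst A f g) a = f a" "u \<in> acts A \<Longrightarrow> snd (rst A f g) u = g u"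
  by (auto simp: rst_def)

lemma ts_mapsD:
  assumes "h \<in> ts_maps A B"
  shows "is_map A B (fst h) (snd h)"
proof -
  obtain f g where h: "h = (f, g)" by (cases h)
  have "f \<in> states A \<rightarrow>\<^sub>E states B" "g \<in> acts A \<rightarrow>\<^sub>E acts B" "\<forall>u \<in> acts A. lab B (g u) = lab A u"
    and t: "\<forall>(\<alpha>, us, \<beta>) \<in> transitions A. (f \<alpha>, map g us, f \<beta>) \<in> transitions B"
    using assms unfolding h ts_maps_def by simp_all
  then show ?thesis unfolding h fst_conv snd_conv
    by (intro is_mapI) (use t in \<open>auto dest: PiE_mem\<close>)
qed

lemma rst_ts_maps:
  assumes "weak_ts A"
  shows "rst A f g \<in> ts_maps A B \<longleftrightarrow> is_map A B f g"
proof -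
  have c: "is_map A B (fst (rst A f g)) (snd (rst A f g)) \<longleftrightarrow> is_map A B f g"
    by (rule is_map_cong[OF assms]) simp_all
  show ?thesis
  proof
    assume "rst A f g \<in> ts_maps A B"
    from ts_mapsD[OF this] show "is_map A B f g" unfolding c .
  next
    assume "is_map A B f g"
    then have m: "is_map A B (restrict f (states A)) (restrict g (acts A))"
      using c by (simp add: rst_def)
    have "restrict f (states A) \<in> states A \<rightarrow>\<^sub>E states B" "restrict g (acts A) \<in> acts A \<rightarrow>\<^sub>E acts B"
      using is_mapD(1,2)[OF m] by auto
    then show "rst A f g \<in> ts_maps A B"
      using is_mapD(3,4)[OF m] unfolding rst_def ts_maps_def by blast
  qed
qed

lemma ts_maps_rst:
  assumes "h \<in> ts_maps A B"
  shows "rst A (fst h) (snd h) = h"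
proof -
  obtain f g where h: "h = (f, g)" by (cases h)
  have "f \<in> states A \<rightarrow>\<^sub>E states B" "g \<in> acts A \<rightarrow>\<^sub>E acts B"
    using assms unfolding h ts_maps_def by simp_all
  then show ?thesis unfolding h rst_def by (simp add: PiE_restrict)
qed

lemma ts_maps_eqI:
  assumes "h \<in> ts_maps A B" "k \<in> ts_maps A D" "\<And>a. a \<in> states A \<Longrightarrow> fst h a = fst k a"
    "\<And>u. u \<in> acts A \<Longrightarrow> snd h u = snd k u"
  shows "h = k"
proof -
  have "rst A (fst h) (snd h) = rst A (fst k) (snd k)"
    unfolding rst_eq_iff using assms(3,4) by blast
  then show ?thesis unfolding ts_maps_rst[OF assms(1)] ts_maps_rst[OF assms(2)] .
qed

lemma ts_comp_rst: "ts_comp A k h = rst A (\<lambda>a. fst k (fst h a)) (\<lambda>u. snd k (snd h u))"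
  by (simp add: ts_comp_def rst_def compose_def)

lemma ts_id_rst: "ts_id A = rst A (\<lambda>a. a) (\<lambda>u. u)"
  by (simp add: ts_id_def rst_def id_def)

lemma ts_comp_maps:
  assumes "weak_ts A" "h \<in> ts_maps A B" "k \<in> ts_maps B D"
  shows "ts_comp A k h \<in> ts_maps A D"
  unfolding ts_comp_rst rst_ts_maps[OF assms(1)]
  by (rule is_map_comp[OF ts_mapsD[OF assms(2)] ts_mapsD[OF assms(3)]])

lemma ts_comp_eq_iff:
  "ts_comp A k h = ts_comp A k' h' \<longleftrightarrow> (\<forall>a \<in> states A. fst k (fst h a) = fst k' (fst h' a)) \<and>
     (\<forall>u \<in> acts A. snd k (snd h u) = snd k' (snd h' u))"
  unfolding ts_comp_rst rst_eq_iff ..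

lemma ts_comp_eq_map_iff:
  assumes "u \<in> ts_maps A B"
  shows "ts_comp A k h = u \<longleftrightarrow> (\<forall>a \<in> states A. fst k (fst h a) = fst u a) \<and>
     (\<forall>v \<in> acts A. snd k (snd h v) = snd u v)"
  using rst_eq_iff[of A "\<lambda>a. fst k (fst h a)" "\<lambda>u. snd k (snd h u)" "fst u" "snd u"]
  unfolding ts_comp_rst ts_maps_rst[OF assms] by simp

lemma ts_comp_assoc:
  assumes "h \<in> ts_maps A B"
  shows "ts_comp A (ts_comp B l k) h = ts_comp A l (ts_comp A k h)"
  using is_mapD(1,2)[OF ts_mapsD[OF assms]] by (simp add: ts_comp_rst rst_eq_iff)

section \<open>Full subcategories and concrete lifting problems\<close>

definition ts_objs :: "(('u, 'x) ts \<Rightarrow> bool) \<Rightarrow> ('u, 'x) ts set" where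
  "ts_objs P = {X. weak_ts X \<and> small (states X) \<and> small (acts X) \<and> P X}"

lemma ts_category_simps [simp]:
  "obj (ts_category P) = ts_objs P"
  "src (ts_category P) (X, h, Y) = X"
  "tgt (ts_category P) (X, h, Y) = Y"
  "ident (ts_category P) X = (X, ts_id X, X)"
  "cmp (ts_category P) (Y', k, Z) (X, h, Y) = (X, ts_comp X k h, Z)"
  "(X, h, Y) \<in> arr (ts_category P) \<longleftrightarrow> X \<in> ts_objs P \<and> Y \<in> ts_objs P \<and> h \<in> ts_maps X Y"
  unfolding ts_category_def ts_objs_def by (simp_all add: Let_def)

lemma ts_homs:
  "f \<in> homs (ts_category P) A B \<longleftrightarrow> A \<in> ts_objs P \<and> B \<in> ts_objs P \<and> (\<exists>h \<in> ts_maps A B. f = (A, h, B))"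
  unfolding homs_def by (cases f) auto

lemma ts_homs_triple [simp]:
  "(A', h, B') \<in> homs (ts_category P) A B \<longleftrightarrow>
     A \<in> ts_objs P \<and> B \<in> ts_objs P \<and> A' = A \<and> B' = B \<and> h \<in> ts_maps A B"
  unfolding ts_homs by auto

lemma ball_homs:
  "(\<forall>u \<in> homs (ts_category P) A B. Q u) \<longleftrightarrow>
     (A \<in> ts_objs P \<longrightarrow> B \<in> ts_objs P \<longrightarrow> (\<forall>h \<in> ts_maps A B. Q (A, h, B)))"
  unfolding ts_homs Ball_def by auto

lemma bex_homs:
  "(\<exists>u \<in> homs (ts_category P) A B. Q u) \<longleftrightarrow>
     A \<in> ts_objs P \<and> B \<in> ts_objs P \<and> (\<exists>h \<in> ts_maps A B. Q (A, h, B))"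
  unfolding ts_homs Bex_def by auto

lemma weak_ts_objs: "A \<in> ts_objs P \<Longrightarrow> weak_ts A"
  by (simp add: ts_objs_def)

lemma category_laws_ts_category: "category_laws (ts_category P)"
proof
  fix f A B assume "f \<in> homs (ts_category P) A B"
  then show "A \<in> obj (ts_category P) \<and> B \<in> obj (ts_category P)"
    unfolding ts_homs by simp
next
  fix A assume A: "A \<in> obj (ts_category P)"
  then show "ident (ts_category P) A \<in> homs (ts_category P) A A"
    by (simp add: ts_id_rst rst_ts_maps[OF weak_ts_objs] is_map_id)
next
  fix f g A B C assume "f \<in> homs (ts_category P) A B" "g \<in> homs (ts_category P) B C"
  then show "cmp (ts_category P) g f \<in> homs (ts_category P) A C"
    unfolding ts_homs using ts_comp_maps weak_ts_objs by fastforce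
next
  fix f g h A B C D assume "f \<in> homs (ts_category P) A B" "g \<in> homs (ts_category P) B C"
    "h \<in> homs (ts_category P) C D"
  then show "cmp (ts_category P) h (cmp (ts_category P) g f) = cmp (ts_category P) (cmp (ts_category P) h g) f"
    unfolding ts_homs
    by (auto simp: ts_comp_rst rst_eq_iff is_mapD(1,2) dest!: ts_mapsD)
next
  fix f A B assume "f \<in> homs (ts_category P) A B"
  then obtain h where h: "h \<in> ts_maps A B" "f = (A, h, B)" unfolding ts_homs by blast
  have m: "\<And>a. a \<in> states A \<Longrightarrow> fst h a \<in> states B" "\<And>u. u \<in> acts A \<Longrightarrow> snd h u \<in> acts B"
    using is_mapD(1,2)[OF ts_mapsD[OF h(1)]] by auto
  show "cmp (ts_category P) f (ident (ts_category P) A) = f" "cmp (ts_category P) (ident (ts_category P) B) f = f"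
    using h(2) m by (simp_all add: ts_comp_eq_map_iff[OF h(1)] ts_id_rst)
qed

text \<open>The lifting property over arbitrary types of states and actions. Cubes and the other
  generators are built over types of their own and are not objects of the category, yet lifting
  problems against them have to be solved directly.\<close>

definition lifts ::
    "('s, 'a, 'x) wts \<Rightarrow> ('t, 'b, 'x) wts \<Rightarrow> ('v, 'c, 'x) wts \<Rightarrow> ('w, 'd, 'x) wts \<Rightarrow>
     ('s \<Rightarrow> 't) \<Rightarrow> ('a \<Rightarrow> 'b) \<Rightarrow> ('v \<Rightarrow> 'w) \<Rightarrow> ('c \<Rightarrow> 'd) \<Rightarrow> bool" where
  "lifts A B E F hs ha ps pa \<longleftrightarrow>
     (\<forall>us ua vs va. is_map A E us ua \<and> is_map B F vs va \<and>
        (\<forall>a \<in> states A. ps (us a) = vs (hs a)) \<and> (\<forall>u \<in> acts A. pa (ua u) = va (ha u)) \<longrightarrow>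
        (\<exists>ls la. is_map B E ls la \<and>
           (\<forall>a \<in> states A. ls (hs a) = us a) \<and> (\<forall>u \<in> acts A. la (ha u) = ua u) \<and>
           (\<forall>b \<in> states B. ps (ls b) = vs b) \<and> (\<forall>u \<in> acts B. pa (la u) = va u)))"

lemma has_lifting_lifts:
  assumes "(A, h, B) \<in> arr (ts_category P)" "(E, k, F) \<in> arr (ts_category P)"
  shows "has_lifting (ts_category P) (A, h, B) (E, k, F) \<longleftrightarrow> lifts A B E F (fst h) (snd h) (fst k) (snd k)"
proof -
  let ?K = "ts_category P"
  have A: "weak_ts A" and B: "weak_ts B" and h: "is_map A B (fst h) (snd h)"
    and o: "A \<in> ts_objs P" "B \<in> ts_objs P" "E \<in> ts_objs P" "F \<in> ts_objs P"
    using assms by (auto dest: weak_ts_objs ts_mapsD)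
  have *: "has_lifting ?K (A, h, B) (E, k, F) \<longleftrightarrow>
      (\<forall>u \<in> ts_maps A E. \<forall>v \<in> ts_maps B F. ts_comp A k u = ts_comp A v h \<longrightarrow>
        (\<exists>l \<in> ts_maps B E. ts_comp A l h = u \<and> ts_comp B k l = v))"
    unfolding has_lifting_def using o by (simp add: ball_homs bex_homs)
  show ?thesis
  proof
    assume H: "has_lifting ?K (A, h, B) (E, k, F)"
    show "lifts A B E F (fst h) (snd h) (fst k) (snd k)"
      unfolding lifts_def
    proof (intro allI impI, elim conjE)
      fix us ua vs va
      assume u: "is_map A E us ua" and v: "is_map B F vs va"
        and e: "\<forall>a \<in> states A. fst k (us a) = vs (fst h a)" "\<forall>u \<in> acts A. snd k (ua u) = va (snd h u)"
      have "rst A us ua \<in> ts_maps A E" "rst B vs va \<in> ts_maps B F"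
        using u v A B by (simp_all add: rst_ts_maps)
      moreover have "ts_comp A k (rst A us ua) = ts_comp A (rst B vs va) h"
        using e is_mapD[OF h] by (simp add: ts_comp_eq_iff)
      ultimately obtain l where l: "l \<in> ts_maps B E" "ts_comp A l h = rst A us ua" "ts_comp B k l = rst B vs va"
        using H * by blast
      have "is_map B E (fst l) (snd l)" using ts_mapsD[OF l(1)] .
      moreover have "(\<forall>a \<in> states A. fst l (fst h a) = us a) \<and> (\<forall>u \<in> acts A. snd l (snd h u) = ua u)"
        using l(2) unfolding ts_comp_rst rst_eq_iff .
      moreover have "(\<forall>a \<in> states B. fst k (fst l a) = vs a) \<and> (\<forall>u \<in> acts B. snd k (snd l u) = va u)"
        using l(3) unfolding ts_comp_rst rst_eq_iff .
      ultimately show "\<exists>ls la. is_map B E ls la \<and>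
           (\<forall>a \<in> states A. ls (fst h a) = us a) \<and> (\<forall>u \<in> acts A. la (snd h u) = ua u) \<and>
           (\<forall>b \<in> states B. fst k (ls b) = vs b) \<and> (\<forall>u \<in> acts B. snd k (la u) = va u)"
        by blast
    qed
  next
    assume H: "lifts A B E F (fst h) (snd h) (fst k) (snd k)"
    show "has_lifting ?K (A, h, B) (E, k, F)"
      unfolding *
    proof (intro ballI impI)
      fix u v assume u: "u \<in> ts_maps A E" and v: "v \<in> ts_maps B F" and e: "ts_comp A k u = ts_comp A v h"
      obtain ls la where l: "is_map B E ls la"
           "\<forall>a \<in> states A. ls (fst h a) = fst u a" "\<forall>w \<in> acts A. la (snd h w) = snd u w"
           "\<forall>b \<in> states B. fst k (ls b) = fst v b" "\<forall>w \<in> acts B. snd k (la w) = snd v w"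
        using H[unfolded lifts_def, rule_format, of "fst u" "snd u" "fst v" "snd v"]
          ts_mapsD[OF u] ts_mapsD[OF v] e unfolding ts_comp_eq_iff by auto
      show "\<exists>l \<in> ts_maps B E. ts_comp A l h = u \<and> ts_comp B k l = v"
        using l is_mapD[OF h]
        by (intro bexI[of _ "rst B ls la"]) (auto simp: ts_comp_eq_map_iff[OF u] ts_comp_eq_map_iff[OF v] rst_ts_maps[OF B])
    qed
  qed
qed

text \<open>The trivial fibrations in explicit form: these turn out to be exactly the maps with the
  right lifting property against the generating cofibrations (\<open>rlp_gens\<close>).\<close>

definition nice :: "('s, 'a, 'x) wts \<Rightarrow> ('t, 'b, 'x) wts \<Rightarrow> ('s \<Rightarrow> 't) \<Rightarrow> ('a \<Rightarrow> 'b) \<Rightarrow> bool" where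
  "nice E F f g \<longleftrightarrow> is_map E F f g \<and> bij_betw f (states E) (states F) \<and> g ` acts E = acts F \<and>
     (\<forall>\<alpha> \<in> states E. \<forall>\<beta> \<in> states E. \<forall>us. set us \<subseteq> acts E \<and> (f \<alpha>, map g us, f \<beta>) \<in> transitions F \<longrightarrow>
        (\<alpha>, us, \<beta>) \<in> transitions E)"

text \<open>On states the lift is forced. On actions, injectivity of \<open>ha\<close> allows the
  values on the image of \<open>A\<close> to be prescribed, and elsewhere any preimage under
  \<open>pa\<close> will do. Because \<open>pa\<close> and \<open>ps\<close> reflect transitions,
  every such choice is a map.\<close>

lemma nice_lifts:
  assumes n: "nice E F ps pa" and h: "is_map A B hs ha" and inj: "inj_on ha (acts A)" and B: "weak_ts B"
  shows "lifts A B E F hs ha ps pa"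
  unfolding lifts_def
proof (intro allI impI, elim conjE)
  fix us ua vs va
  assume u: "is_map A E us ua" and v: "is_map B F vs va"
    and e: "\<forall>a \<in> states A. ps (us a) = vs (hs a)" "\<forall>u \<in> acts A. pa (ua u) = va (ha u)"
  define ls where "ls b = inv_into (states E) ps (vs b)" for b
  define la where "la w = (if w \<in> ha ` acts A then ua (inv_into (acts A) ha w)
                           else inv_into (acts E) pa (va w))" for w
  have p: "is_map E F ps pa" "bij_betw ps (states E) (states F)" "pa ` acts E = acts F"
    "\<And>\<alpha> \<beta> us. \<alpha> \<in> states E \<Longrightarrow> \<beta> \<in> states E \<Longrightarrow> set us \<subseteq> acts E \<Longrightarrow>
      (ps \<alpha>, map pa us, ps \<beta>) \<in> transitions F \<Longrightarrow> (\<alpha>, us, \<beta>) \<in> transitions E"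
    using n unfolding nice_def by auto
  have ls: "ls b \<in> states E" "ps (ls b) = vs b" if "b \<in> states B" for b
    using is_mapD(1)[OF v that] p(2) unfolding ls_def
    by (auto simp: bij_betw_def inv_into_into f_inv_into_f)
  have la: "la w \<in> acts E \<and> pa (la w) = va w" if w: "w \<in> acts B" for w
  proof (cases "w \<in> ha ` acts A")
    case True
    then show ?thesis using is_mapD(2)[OF u] e(2) unfolding la_def
      by (auto simp: inv_into_f_f[OF inj])
  next
    case False
    then show ?thesis using is_mapD(2)[OF v w] p(3) unfolding la_def
      by (auto simp: inv_into_into f_inv_into_f)
  qed
  have "is_map B E ls la"
  proof (rule is_mapI)
    fix w assume w: "w \<in> acts B"
    have "lab E (la w) = lab F (va w)" using la[OF w] is_mapD(3)[OF p(1)] by metis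
    then show "lab E (la w) = lab B w" using is_mapD(3)[OF v w] by simp
  next
    fix \<alpha> ws \<beta> assume t: "(\<alpha>, ws, \<beta>) \<in> transitions B"
    note d = weak_tsD[OF B t]
    have "map pa (map la ws) = map va ws" using la d(4) by auto
    then have "(ps (ls \<alpha>), map pa (map la ws), ps (ls \<beta>)) \<in> transitions F"
      using is_mapD(4)[OF v t] ls(2)[OF d(1)] ls(2)[OF d(2)] by metis
    moreover have "set (map la ws) \<subseteq> acts E" using la d(4) by auto
    ultimately show "(ls \<alpha>, map la ws, ls \<beta>) \<in> transitions E"
      using p(4) ls(1)[OF d(1)] ls(1)[OF d(2)] by blast
  qed (use ls la in auto)
  moreover have "ls (hs a) = us a" if "a \<in> states A" for a
    using is_mapD(1)[OF u that] e(1) that p(2) unfolding ls_def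
    by (metis bij_betw_inv_into_left)
  moreover have "la (ha w) = ua w" if "w \<in> acts A" for w
    using that by (simp add: la_def inv_into_f_f[OF inj])
  ultimately show "\<exists>ls la. is_map B E ls la \<and>
           (\<forall>a \<in> states A. ls (hs a) = us a) \<and> (\<forall>u \<in> acts A. la (ha u) = ua u) \<and>
           (\<forall>b \<in> states B. ps (ls b) = vs b) \<and> (\<forall>u \<in> acts B. pa (la u) = va u)"
    using ls la by blast
qed

lemma nice_cong:
  assumes E: "weak_ts E" and f: "\<And>a. a \<in> states E \<Longrightarrow> f a = f' a" and g: "\<And>u. u \<in> acts E \<Longrightarrow> g u = g' u"
    and n: "nice E F f g"
  shows "nice E F f' g'"
  unfolding nice_def
proof (intro conjI ballI allI impI)
  show "is_map E F f' g'" using n is_map_cong[OF E f g] by (simp add: nice_def)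
  show "bij_betw f' (states E) (states F)" using n bij_betw_cong[of "states E" f f' "states F"] f by (simp add: nice_def)
  have "g' ` acts E = g ` acts E" using g by (auto simp: image_iff)
  then show "g' ` acts E = acts F" using n unfolding nice_def by blast
  fix \<alpha> \<beta> us assume a: "\<alpha> \<in> states E" "\<beta> \<in> states E" "set us \<subseteq> acts E \<and> (f' \<alpha>, map g' us, f' \<beta>) \<in> transitions F"
  have "map g us = map g' us" using a(3) g by auto
  then have "(f \<alpha>, map g us, f \<beta>) \<in> transitions F" using a f by metis
  then show "(\<alpha>, us, \<beta>) \<in> transitions E" using n a unfolding nice_def by blast
qed

lemma nice_id: "nice A A (\<lambda>a. a) (\<lambda>u. u)"
  unfolding nice_def by (simp add: is_map_id bij_betw_def)

text \<open>The inverse image of the transition structure along a map of actions. It is used to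
  multiply actions (cofibration factorization, clones), to collapse actions with equal labels onto
  one chosen action, and to rename them.\<close>

definition pullback_acts :: "('s, 'a, 'x) wts \<Rightarrow> 'b set \<Rightarrow> ('b \<Rightarrow> 'a) \<Rightarrow> ('s, 'b, 'x) wts" where
  "pullback_acts X L p = \<lparr> states = states X, acts = L, lab = restrict (\<lambda>u. lab X (p u)) L,
     transitions = {(\<alpha>, us, \<beta>). set us \<subseteq> L \<and> (\<alpha>, map p us, \<beta>) \<in> transitions X} \<rparr>"

lemma pullback_acts_simps [simp]:
  "states (pullback_acts X L p) = states X" "acts (pullback_acts X L p) = L"
  "lab (pullback_acts X L p) = restrict (\<lambda>u. lab X (p u)) L"
  "(\<alpha>, us, \<beta>) \<in> transitions (pullback_acts X L p) \<longleftrightarrow> set us \<subseteq> L \<and> (\<alpha>, map p us, \<beta>) \<in> transitions X"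
  by (auto simp: pullback_acts_def)

lemma weak_ts_pullback_acts:
  assumes X: "weak_ts X"
  shows "weak_ts (pullback_acts X L p)"
proof (rule weak_tsI)
  fix \<alpha> us \<beta> vs assume "(\<alpha>, us, \<beta>) \<in> transitions (pullback_acts X L p)" "mset vs = mset us"
  then show "(\<alpha>, vs, \<beta>) \<in> transitions (pullback_acts X L p)"
    using transition_mset_cong[OF X, of \<alpha> "map p us" \<beta> "map p vs"] mset_eq_setD[of vs us] by auto
next
  fix \<alpha> us vs ws \<beta> \<nu>1 \<nu>2
  assume a: "us \<noteq> []" "vs \<noteq> []" "ws \<noteq> []" "(\<alpha>, us @ vs @ ws, \<beta>) \<in> transitions (pullback_acts X L p)"
    "(\<alpha>, us, \<nu>1) \<in> transitions (pullback_acts X L p)" "(\<nu>1, vs @ ws, \<beta>) \<in> transitions (pullback_acts X L p)"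
    "(\<alpha>, us @ vs, \<nu>2) \<in> transitions (pullback_acts X L p)" "(\<nu>2, ws, \<beta>) \<in> transitions (pullback_acts X L p)"
  then show "(\<nu>1, vs, \<nu>2) \<in> transitions (pullback_acts X L p)"
    using weak_ts_compose[OF X, of "map p us" "map p vs" "map p ws" \<alpha> \<beta> \<nu>1 \<nu>2] by simp
next
  fix \<alpha> us \<beta> assume "(\<alpha>, us, \<beta>) \<in> transitions (pullback_acts X L p)"
  then show "\<alpha> \<in> states (pullback_acts X L p) \<and> \<beta> \<in> states (pullback_acts X L p) \<and> us \<noteq> [] \<and>
      set us \<subseteq> acts (pullback_acts X L p)"
    using weak_tsD[OF X, of \<alpha> "map p us" \<beta>] by auto
qed auto

lemma cub_or_reg_pullback_acts:
  assumes X: "cub_or_reg r X" and p: "p ` L \<subseteq> acts X"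
  shows "cub_or_reg r (pullback_acts X L p)"
proof (rule cub_or_regI)
  show "weak_ts (pullback_acts X L p)" using weak_ts_pullback_acts cub_or_regD(1)[OF X] .
  fix u assume "u \<in> acts (pullback_acts X L p)"
  then show "\<exists>\<alpha> \<beta>. (\<alpha>, [u], \<beta>) \<in> transitions (pullback_acts X L p)"
    using p cub_or_regD(3)[OF X, of "p u"] by auto
next
  fix \<alpha> us vs \<beta> assume a: "us \<noteq> []" "vs \<noteq> []" "(\<alpha>, us @ vs, \<beta>) \<in> transitions (pullback_acts X L p)"
  then have a': "map p us \<noteq> []" "map p vs \<noteq> []" "(\<alpha>, map p us @ map p vs, \<beta>) \<in> transitions X"
    "set us \<subseteq> L" "set vs \<subseteq> L" by simp_all
  show "\<exists>\<nu>. (\<alpha>, us, \<nu>) \<in> transitions (pullback_acts X L p) \<and> (\<nu>, vs, \<beta>) \<in> transitions (pullback_acts X L p)"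
    using cub_or_regD(4)[OF X a'(1-3)] a'(4,5) by simp
  fix \<nu> \<nu>'
  assume r "(\<alpha>, us, \<nu>) \<in> transitions (pullback_acts X L p)" "(\<nu>, vs, \<beta>) \<in> transitions (pullback_acts X L p)"
    "(\<alpha>, us, \<nu>') \<in> transitions (pullback_acts X L p)" "(\<nu>', vs, \<beta>) \<in> transitions (pullback_acts X L p)"
  then show "\<nu> = \<nu>'"
    using cub_or_regD(5)[OF X _ a'(1-3), of \<nu> \<nu>'] by simp
qed

lemma nice_pullback_acts:
  assumes "p ` L = acts X"
  shows "nice (pullback_acts X L p) X (\<lambda>a. a) p"
proof -
  have "is_map (pullback_acts X L p) X (\<lambda>a. a) p"
    by (rule is_mapI) (use assms in auto)
  then show ?thesis using assms unfolding nice_def by (simp add: bij_betw_def)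
qed

text \<open>The coreflection into cubical systems: maps from a cubical system land in it
  (\<open>is_map_core\<close>). Splittings are demanded for every rearrangement of the list, so that
  the multiset axiom passes to the core.\<close>

definition core :: "('s, 'a, 'x) wts \<Rightarrow> ('s, 'a, 'x) wts" where
  "core X = \<lparr> states = states X, acts = {u. \<exists>\<alpha> \<beta>. (\<alpha>, [u], \<beta>) \<in> transitions X},
     lab = restrict (lab X) {u. \<exists>\<alpha> \<beta>. (\<alpha>, [u], \<beta>) \<in> transitions X},
     transitions = {(\<alpha>, us, \<beta>). (\<alpha>, us, \<beta>) \<in> transitions X \<and>
       (\<forall>ps qs. ps \<noteq> [] \<and> qs \<noteq> [] \<and> mset (ps @ qs) = mset us \<longrightarrow>
         (\<exists>\<nu>. (\<alpha>, ps, \<nu>) \<in> transitions X \<and> (\<nu>, qs, \<beta>) \<in> transitions X))} \<rparr>"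

lemma core_simps [simp]:
  "states (core X) = states X" "acts (core X) = {u. \<exists>\<alpha> \<beta>. (\<alpha>, [u], \<beta>) \<in> transitions X}"
  "lab (core X) = restrict (lab X) {u. \<exists>\<alpha> \<beta>. (\<alpha>, [u], \<beta>) \<in> transitions X}"
  by (auto simp: core_def)

lemma core_transitions:
  "(\<alpha>, us, \<beta>) \<in> transitions (core X) \<longleftrightarrow> (\<alpha>, us, \<beta>) \<in> transitions X \<and>
     (\<forall>ps qs. ps \<noteq> [] \<and> qs \<noteq> [] \<and> mset (ps @ qs) = mset us \<longrightarrow>
       (\<exists>\<nu>. (\<alpha>, ps, \<nu>) \<in> transitions X \<and> (\<nu>, qs, \<beta>) \<in> transitions X))"
  by (simp add: core_def)

lemma core_transitionsD:
  assumes "(\<alpha>, us, \<beta>) \<in> transitions (core X)"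
  shows "(\<alpha>, us, \<beta>) \<in> transitions X"
    and "ps \<noteq> [] \<Longrightarrow> qs \<noteq> [] \<Longrightarrow> mset (ps @ qs) = mset us \<Longrightarrow>
       \<exists>\<nu>. (\<alpha>, ps, \<nu>) \<in> transitions X \<and> (\<nu>, qs, \<beta>) \<in> transitions X"
  using assms unfolding core_transitions by blast+

lemma core_acts_subset: "weak_ts X \<Longrightarrow> acts (core X) \<subseteq> acts X"
  using weak_tsD(4) by fastforce

text \<open>
  Splitting off one more piece and applying the composition axiom shows that the pieces of a
  transition of the core are again in the core.
\<close>

lemma cub_or_reg_core:
  assumes X: "weak_ts X" and iu: "r \<Longrightarrow> intermediate_unique X"
  shows "cub_or_reg r (core X)"
proof (rule cub_or_regI)
  show "weak_ts (core X)"
  proof (rule weak_tsI)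
    fix \<alpha> us \<beta> assume t: "(\<alpha>, us, \<beta>) \<in> transitions (core X)"
    note t' = core_transitionsD(1)[OF t]
    note d = weak_tsD[OF X t']
    have "\<exists>\<alpha> \<beta>. (\<alpha>, [u], \<beta>) \<in> transitions X" if u: "u \<in> set us" for u
    proof (cases "remove1 u us = []")
      case True
      then have "us = [u]" using u by (cases us) (auto split: if_splits)
      then show ?thesis using t' by blast
    next
      case False
      then show ?thesis using core_transitionsD(2)[OF t, of "[u]" "remove1 u us"] u by auto
    qed
    then show "\<alpha> \<in> states (core X) \<and> \<beta> \<in> states (core X) \<and> us \<noteq> [] \<and> set us \<subseteq> acts (core X)"
      using d by auto
  next
    fix \<alpha> us \<beta> vs assume "(\<alpha>, us, \<beta>) \<in> transitions (core X)" "mset vs = mset us"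
    then show "(\<alpha>, vs, \<beta>) \<in> transitions (core X)"
      unfolding core_transitions using transition_mset_cong[OF X] by metis
  next
    fix \<alpha> us vs ws \<beta> \<nu>1 \<nu>2
    assume a: "us \<noteq> []" "vs \<noteq> []" "ws \<noteq> []"
     and t: "(\<alpha>, us @ vs @ ws, \<beta>) \<in> transitions (core X)"
      "(\<alpha>, us, \<nu>1) \<in> transitions (core X)" "(\<nu>1, vs @ ws, \<beta>) \<in> transitions (core X)"
      "(\<alpha>, us @ vs, \<nu>2) \<in> transitions (core X)" "(\<nu>2, ws, \<beta>) \<in> transitions (core X)"
    note T = t[THEN core_transitionsD(1)]
    have vs: "(\<nu>1, vs, \<nu>2) \<in> transitions X"
      using weak_ts_compose[OF X a T] .
    show "(\<nu>1, vs, \<nu>2) \<in> transitions (core X)"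
      unfolding core_transitions
    proof (intro conjI vs allI impI, elim conjE)
      fix ps qs assume p: "ps \<noteq> []" "qs \<noteq> []" "mset (ps @ qs) = mset vs"
      obtain \<nu> where n: "(\<nu>1, ps, \<nu>) \<in> transitions X" "(\<nu>, qs @ ws, \<beta>) \<in> transitions X"
        using core_transitionsD(2)[OF t(3), of ps "qs @ ws"] p a by auto
      have "(\<nu>1, ps @ qs @ ws, \<beta>) \<in> transitions X" "(\<nu>1, ps @ qs, \<nu>2) \<in> transitions X"
        by (rule transition_mset_cong[OF X T(3)], use p(3) in simp)
          (rule transition_mset_cong[OF X vs], use p(3) in simp)
      then have "(\<nu>, qs, \<nu>2) \<in> transitions X"
        using weak_ts_compose[OF X p(1,2) a(3)] n T(5) by blast
      then show "\<exists>\<nu>. (\<nu>1, ps, \<nu>) \<in> transitions X \<and> (\<nu>, qs, \<nu>2) \<in> transitions X" using n by blast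
    qed
  qed auto
next
  fix u assume "u \<in> acts (core X)"
  then obtain \<alpha> \<beta> where "(\<alpha>, [u], \<beta>) \<in> transitions X" by auto
  moreover have "ps = [] \<or> qs = []" if "mset (ps @ qs) = mset [u]" for ps qs :: "'b list"
    using arg_cong[OF that, of size] by (cases ps; cases qs) auto
  ultimately show "\<exists>\<alpha> \<beta>. (\<alpha>, [u], \<beta>) \<in> transitions (core X)"
    unfolding core_transitions by blast
next
  fix \<alpha> us vs \<beta> assume a: "us \<noteq> []" "vs \<noteq> []" and t: "(\<alpha>, us @ vs, \<beta>) \<in> transitions (core X)"
  note t' = core_transitionsD(1)[OF t]
  obtain \<nu> where n: "(\<alpha>, us, \<nu>) \<in> transitions X" "(\<nu>, vs, \<beta>) \<in> transitions X"
    using core_transitionsD(2)[OF t a] by auto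
  have "(\<alpha>, us, \<nu>) \<in> transitions (core X)"
    unfolding core_transitions
  proof (intro conjI n allI impI, elim conjE)
    fix ps qs assume p: "ps \<noteq> []" "qs \<noteq> []" "mset (ps @ qs) = mset us"
    obtain \<nu>' where n': "(\<alpha>, ps, \<nu>') \<in> transitions X" "(\<nu>', qs @ vs, \<beta>) \<in> transitions X"
      using core_transitionsD(2)[OF t, of ps "qs @ vs"] p a by auto
    have "(\<alpha>, ps @ qs @ vs, \<beta>) \<in> transitions X" "(\<alpha>, ps @ qs, \<nu>) \<in> transitions X"
      by (rule transition_mset_cong[OF X t'], use p(3) in simp)
        (rule transition_mset_cong[OF X n(1)], use p(3) in simp)
    then have "(\<nu>', qs, \<nu>) \<in> transitions X"
      using weak_ts_compose[OF X p(1,2) a(2)] n n' by blast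
    then show "\<exists>\<nu>'. (\<alpha>, ps, \<nu>') \<in> transitions X \<and> (\<nu>', qs, \<nu>) \<in> transitions X" using n' by blast
  qed
  moreover have "(\<nu>, vs, \<beta>) \<in> transitions (core X)"
    unfolding core_transitions
  proof (intro conjI n allI impI, elim conjE)
    fix ps qs assume p: "ps \<noteq> []" "qs \<noteq> []" "mset (ps @ qs) = mset vs"
    obtain \<nu>' where n': "(\<alpha>, us @ ps, \<nu>') \<in> transitions X" "(\<nu>', qs, \<beta>) \<in> transitions X"
      using core_transitionsD(2)[OF t, of "us @ ps" qs] p a by auto
    have "(\<alpha>, us @ ps @ qs, \<beta>) \<in> transitions X" "(\<nu>, ps @ qs, \<beta>) \<in> transitions X"
      by (rule transition_mset_cong[OF X t'], use p(3) in simp)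
        (rule transition_mset_cong[OF X n(2)], use p(3) in simp)
    then have "(\<nu>, ps, \<nu>') \<in> transitions X"
      using weak_ts_compose[OF X a(1) p(1,2)] n n' by blast
    then show "\<exists>\<nu>'. (\<nu>, ps, \<nu>') \<in> transitions X \<and> (\<nu>', qs, \<beta>) \<in> transitions X" using n' by blast
  qed
  ultimately show "\<exists>\<nu>. (\<alpha>, us, \<nu>) \<in> transitions (core X) \<and> (\<nu>, vs, \<beta>) \<in> transitions (core X)" by blast
next
  fix \<alpha> us vs \<beta> \<nu> \<nu>'
  assume r "us \<noteq> []" "vs \<noteq> []" "(\<alpha>, us @ vs, \<beta>) \<in> transitions (core X)"
    "(\<alpha>, us, \<nu>) \<in> transitions (core X)" "(\<nu>, vs, \<beta>) \<in> transitions (core X)"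
    "(\<alpha>, us, \<nu>') \<in> transitions (core X)" "(\<nu>', vs, \<beta>) \<in> transitions (core X)"
  then show "\<nu> = \<nu>'"
    using iu[unfolded intermediate_unique_def] by (meson core_transitionsD(1))
qed

text \<open>A splitting of a rearranged image list comes from a splitting of a rearrangement of the
  source list. There \<open>V\<close> provides an intermediate state, whose image is the one
  required.\<close>

lemma is_map_core:
  assumes V: "cubical_ts V" and f: "is_map V X f g"
  shows "is_map V (core X) f g"
proof (rule is_mapI)
  fix u assume u: "u \<in> acts V"
  obtain \<alpha> \<beta> where "(\<alpha>, [u], \<beta>) \<in> transitions V" using V u by (auto simp: cubical_ts_def)
  from is_mapD(4)[OF f this] show "g u \<in> acts (core X)" by auto
  then show "lab (core X) (g u) = lab V u" using is_mapD(3)[OF f u] by simp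
next
  have V': "weak_ts V" using V by (simp add: cubical_ts_def)
  fix \<alpha> us \<beta> assume t: "(\<alpha>, us, \<beta>) \<in> transitions V"
  show "(f \<alpha>, map g us, f \<beta>) \<in> transitions (core X)"
    unfolding core_transitions
  proof (intro conjI is_mapD(4)[OF f t] allI impI, elim conjE)
    fix ps qs assume p: "ps \<noteq> []" "qs \<noteq> []" "mset (ps @ qs) = mset (map g us)"
    obtain vs where vs: "ps @ qs = map g vs" "mset vs = mset us"
      using mset_eq_permutation[OF p(3)] by (metis length_map mset_permute_list permute_list_map)
    then obtain xs ys where xy: "ps = map g xs" "qs = map g ys" "vs = xs @ ys"
      by (metis append_eq_map_conv)
    then obtain \<nu> where "(\<alpha>, xs, \<nu>) \<in> transitions V" "(\<nu>, ys, \<beta>) \<in> transitions V"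
      using intermediate_state[OF V transition_mset_cong[OF V' t]] vs(2) p(1,2) by blast
    then show "\<exists>\<nu>. (f \<alpha>, ps, \<nu>) \<in> transitions X \<and> (\<nu>, qs, f \<beta>) \<in> transitions X"
      using is_mapD(4)[OF f] xy by blast
  qed
qed (use is_mapD[OF f] in auto)

section \<open>A model structure from systems whose actions are determined by their labels\<close>

lemma small_subset: "small B \<Longrightarrow> A \<subseteq> B \<Longrightarrow> small A"
  unfolding small_def by (meson card_of_mono1 ordLeq_ordLess_trans)

lemma small_image: "small A \<Longrightarrow> small (f ` A)" for f :: "'u \<Rightarrow> 'u"
  unfolding small_def by (meson card_of_image ordLeq_ordLess_trans)

locale ts_universe =
  fixes r :: bool and U :: "'u itself" and L :: "'x itself"
  assumes univ: "universe_for_labels TYPE('u) TYPE('x)"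
begin

lemma infinite_univ: "infinite (UNIV :: 'u set)"
proof
  assume "finite (UNIV :: 'u set)"
  then have "(card_of (UNIV :: 'u set), natLeq) \<in> ordLess"
    by (simp add: finite_iff_ordLess_natLeq)
  then show False
    using univ unfolding universe_for_labels_def using not_ordLess_ordLeq ordLess_imp_ordLeq by blast
qed

lemma small_finite: "finite A \<Longrightarrow> small (A :: 'u set)"
  unfolding small_def
  by (rule finite_ordLess_infinite) (auto simp: card_of_well_order_on Field_card_of infinite_univ)

lemma small_Un: "small A \<Longrightarrow> small B \<Longrightarrow> small (A \<union> B :: 'u set)"
  unfolding small_def by (rule card_of_Un_ordLess_infinite[OF infinite_univ])

lemma small_Times_image:
  fixes f :: "'u \<times> 'u \<Rightarrow> 'u"
  assumes "small A" "small B"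
  shows "small (f ` (A \<times> B))"
proof (cases "finite (A \<union> B)")
  case True
  then show ?thesis by (intro small_finite) simp
next
  case False
  let ?C = "A \<union> B"
  have "(card_of (f ` (A \<times> B)), card_of (A \<times> B)) \<in> ordLeq" by (rule card_of_image)
  moreover have "(card_of (A \<times> B), card_of (?C \<times> ?C)) \<in> ordLeq" by (rule card_of_mono1) blast
  moreover have "(card_of (?C \<times> ?C), card_of ?C) \<in> ordIso"
    by (rule card_of_Times_same_infinite[OF False])
  ultimately have "(card_of (f ` (A \<times> B)), card_of ?C) \<in> ordLeq"
    using ordLeq_transitive ordLeq_ordIso_trans by blast
  then show ?thesis using small_Un[OF assms] unfolding small_def by (rule ordLeq_ordLess_trans)
qed

lemma small_fresh: "small (A :: 'u set) \<Longrightarrow> \<exists>v. v \<notin> A"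
  unfolding small_def by (metis UNIV_eq_I ordLess_irreflexive)

lemma small_label_image: "small (range f)" for f :: "'x \<Rightarrow> 'u"
  unfolding small_def using univ unfolding universe_for_labels_def
  by (meson card_of_image ordLeq_ordLess_trans)

text \<open>A pairing inside \<open>'u\<close>, available because \<open>'u\<close> is infinite. It
  codes pairs of states in products and tagged copies of actions.\<close>

definition pr :: "'u \<times> 'u \<Rightarrow> 'u" where
  "pr = (SOME f. inj f)"

lemma inj_pr: "inj pr"
proof -
  have "(card_of ((UNIV :: 'u set) \<times> (UNIV :: 'u set)), card_of (UNIV :: 'u set)) \<in> ordIso"
    by (rule card_of_Times_same_infinite[OF infinite_univ])
  then obtain f :: "'u \<times> 'u \<Rightarrow> 'u" where "bij_betw f (UNIV \<times> UNIV) UNIV"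
    using card_of_ordIso by blast
  then have "\<exists>f :: 'u \<times> 'u \<Rightarrow> 'u. inj f" by (auto simp: bij_betw_def)
  then show ?thesis unfolding pr_def by (rule someI_ex)
qed

lemma pr_eq [simp]: "pr p = pr q \<longleftrightarrow> p = q"
  by (rule inj_eq[OF inj_pr])

lemma inv_pr [simp]: "inv pr (pr p) = p"
  by (rule inv_f_f[OF inj_pr])

text \<open>Labels serve as actions in the reflection and in the terminal object, so they are coded
  as elements of \<open>'u\<close>. An injection exists because there are fewer labels than elements
  of \<open>'u\<close>.\<close>

definition lb :: "'x \<Rightarrow> 'u" where
  "lb = (SOME f. inj f)"

lemma inj_lb: "inj lb"
proof -
  have "(card_of (UNIV :: 'x set), card_of (UNIV :: 'u set)) \<in> ordLeq"
    using univ unfolding universe_for_labels_def by (simp add: ordLess_imp_ordLeq)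
  then have "\<exists>f :: 'x \<Rightarrow> 'u. inj f \<and> range f \<subseteq> UNIV"
    by (simp only: card_of_ordLeq)
  then have "\<exists>f :: 'x \<Rightarrow> 'u. inj f" by (simp only: subset_UNIV simp_thms)
  then show ?thesis unfolding lb_def by (rule someI_ex)
qed

lemma inv_lb [simp]: "inv lb (lb x) = x"
  by (rule inv_f_f[OF inj_lb])

abbreviation K :: "(('u, 'x) ts, ('u, 'x) ts_arrow) category" where
  "K \<equiv> ts_category (cub_or_reg r)"

abbreviation Obs :: "('u, 'x) ts set" where
  "Obs \<equiv> ts_objs (cub_or_reg r)"

lemma ObsD:
  assumes "A \<in> Obs"
  shows "weak_ts A" "cub_or_reg r A" "cubical_ts A" "small (states A)" "small (acts A)"
  using assms by (auto simp: ts_objs_def dest: cub_or_regD(2))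

lemma ObsI:
  assumes "cub_or_reg r A" "small (states A)" "small (acts A)"
  shows "A \<in> Obs"
  using assms cub_or_regD(1) by (auto simp: ts_objs_def)

sublocale ts: category_laws K
  by (rule category_laws_ts_category)

section \<open>Label-injective objects and the maps orthogonal to them\<close>

definition Zs :: "('u, 'x) ts set" where
  "Zs = {Z \<in> Obs. inj_on (lab Z) (acts Z)}"

lemma Zs_Obs: "Z \<in> Zs \<Longrightarrow> Z \<in> Obs"
  by (simp add: Zs_def)

abbreviation W where "W \<equiv> ts.orth Zs"

text \<open>Consequently a map into an object of \<open>Zs\<close> is determined by its effect on
  states, which is why \<open>W_extend\<close>, \<open>W_unique\<close> and \<open>W_I\<close> speak
  about states alone.\<close>

lemma Zs_acts_unique:
  assumes "Z \<in> Zs" "is_map A Z f g" "is_map A Z f' g'" "u \<in> acts A"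
  shows "g u = g' u"
proof -
  have "lab Z (g u) = lab Z (g' u)"
    using is_mapD(3)[OF assms(2,4)] is_mapD(3)[OF assms(3,4)] by simp
  moreover have "inj_on (lab Z) (acts Z)" using assms(1) by (simp add: Zs_def)
  ultimately show ?thesis
    using inj_onD is_mapD(2)[OF assms(2,4)] is_mapD(2)[OF assms(3,4)] by metis
qed

lemma W_extend:
  assumes w: "(A, h, B) \<in> W" and Z: "Z \<in> Zs" and f: "is_map A Z f g"
  obtains f' g' where "is_map B Z f' g'" "\<And>a. a \<in> states A \<Longrightarrow> f' (fst h a) = f a"
proof -
  have arr: "(A, h, B) \<in> arr K" using w ts.orth_arr by blast
  then have A: "A \<in> Obs" "B \<in> Obs" "h \<in> ts_maps A B" by auto
  have "(A, rst A f g, Z) \<in> homs K A Z" using A Zs_Obs[OF Z] f by (simp add: rst_ts_maps[OF ObsD(1)[OF A(1)]])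
  moreover have "(A, h, B) \<in> homs K A B" using A by simp
  ultimately obtain k where k: "k \<in> homs K B Z" "cmp K k (A, h, B) = (A, rst A f g, Z)"
    using ts.orthD[OF w _ Z] by blast
  then obtain k' where k': "k = (B, k', Z)" "k' \<in> ts_maps B Z" unfolding ts_homs by blast
  have "is_map B Z (fst k') (snd k')" using ts_mapsD[OF k'(2)] .
  moreover have "fst k' (fst h a) = f a" if "a \<in> states A" for a
    using k(2) k' that by (simp add: ts_comp_rst rst_eq_iff)
  ultimately show ?thesis using that by blast
qed

lemma W_unique:
  assumes w: "(A, h, B) \<in> W" and Z: "Z \<in> Zs" and f: "is_map B Z f g" and f': "is_map B Z f' g'"
    and e: "\<And>a. a \<in> states A \<Longrightarrow> f (fst h a) = f' (fst h a)" and b: "b \<in> states B"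
  shows "f b = f' b"
proof -
  have arr: "(A, h, B) \<in> arr K" using w ts.orth_arr by blast
  then have A: "A \<in> Obs" "B \<in> Obs" "h \<in> ts_maps A B" by auto
  note h = ts_mapsD[OF A(3)]
  have k: "(B, rst B f g, Z) \<in> homs K B Z" "(B, rst B f' g', Z) \<in> homs K B Z"
    using A Zs_Obs[OF Z] f f' by (simp_all add: rst_ts_maps[OF ObsD(1)[OF A(2)]])
  have "g (snd h u) = g' (snd h u)" if "u \<in> acts A" for u
    using Zs_acts_unique[OF Z f f' is_mapD(2)[OF h that]] .
  then have "cmp K (B, rst B f g, Z) (A, h, B) = cmp K (B, rst B f' g', Z) (A, h, B)"
    using e is_mapD(1,2)[OF h] by (simp add: ts_comp_eq_iff)
  then have "(B, rst B f g, Z) = (B, rst B f' g', Z)"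
    using ts.orth_unique[OF w _ Z k] A by simp
  then show ?thesis using b by (simp add: rst_eq_iff)
qed

lemma W_I:
  assumes A: "A \<in> Obs" "B \<in> Obs" "h \<in> ts_maps A B"
    and ex: "\<And>Z f g. Z \<in> Zs \<Longrightarrow> is_map A Z f g \<Longrightarrow>
      \<exists>f' g'. is_map B Z f' g' \<and> (\<forall>a \<in> states A. f' (fst h a) = f a)"
    and un: "\<And>Z f g f' g' b. Z \<in> Zs \<Longrightarrow> is_map B Z f g \<Longrightarrow> is_map B Z f' g' \<Longrightarrow>
      (\<And>a. a \<in> states A \<Longrightarrow> f (fst h a) = f' (fst h a)) \<Longrightarrow> b \<in> states B \<Longrightarrow> f b = f' b"
  shows "(A, h, B) \<in> W"
proof (rule ts.orthI)
  show "(A, h, B) \<in> homs K A B" using A by simp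
next
  note h = ts_mapsD[OF A(3)]
  fix Z k assume Z: "Z \<in> Zs" and "k \<in> homs K A Z"
  then obtain k' where k: "k = (A, k', Z)" "k' \<in> ts_maps A Z" unfolding ts_homs by blast
  note m = ts_mapsD[OF k(2)]
  obtain f' g' where f': "is_map B Z f' g'" "\<forall>a \<in> states A. f' (fst h a) = fst k' a"
    using ex[OF Z m] by blast
  have "g' (snd h u) = snd k' u" if "u \<in> acts A" for u
    using Zs_acts_unique[OF Z is_map_comp[OF h f'(1)] m that] .
  then have "ts_comp A (rst B f' g') h = k'"
    using f'(2) is_mapD(1,2)[OF h] by (simp add: ts_comp_eq_map_iff[OF k(2)])
  then show "\<exists>l. l \<in> homs K B Z \<and> cmp K l (A, h, B) = k"
    using f'(1) A Zs_Obs[OF Z] k(1) by (intro exI[of _ "(B, rst B f' g', Z)"]) (simp add: rst_ts_maps[OF ObsD(1)])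
next
  note h = ts_mapsD[OF A(3)]
  fix Z k k' assume Z: "Z \<in> Zs" and "k \<in> homs K B Z" "k' \<in> homs K B Z" and e: "cmp K k (A, h, B) = cmp K k' (A, h, B)"
  then obtain l l' where l: "k = (B, l, Z)" "l \<in> ts_maps B Z" "k' = (B, l', Z)" "l' \<in> ts_maps B Z"
    unfolding ts_homs by blast
  have "fst l (fst h a) = fst l' (fst h a)" if "a \<in> states A" for a
    using e l that by (simp add: ts_comp_eq_iff)
  then have "l = l'"
    using un[OF Z ts_mapsD[OF l(2)] ts_mapsD[OF l(4)]] Zs_acts_unique[OF Z ts_mapsD[OF l(2)] ts_mapsD[OF l(4)]]
    by (intro ts_maps_eqI[OF l(2,4)]) blast+
  then show "k = k'" using l by simp
qed

section \<open>Trivial fibrations and the cofibration factorization\<close>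

definition nice_arrs :: "('u, 'x) ts_arrow set" where
  "nice_arrs = {(E, k, F) | E k F. (E, k, F) \<in> arr K \<and> nice E F (fst k) (snd k)}"

lemma nice_arrs_iff: "(E, k, F) \<in> nice_arrs \<longleftrightarrow> (E, k, F) \<in> arr K \<and> nice E F (fst k) (snd k)"
  unfolding nice_arrs_def by blast

lemma nice_arrs_arr: "nice_arrs \<subseteq> arr K"
  by (auto simp: nice_arrs_def)

lemma nice_arrsI:
  assumes E: "E \<in> Obs" and F: "F \<in> Obs" and n: "nice E F f g"
  shows "(E, rst E f g, F) \<in> nice_arrs"
proof -
  have "nice E F (fst (rst E f g)) (snd (rst E f g))"
    by (rule nice_cong[OF ObsD(1)[OF E] _ _ n]) simp_all
  moreover have "is_map E F f g" using n unfolding nice_def by blast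
  then have "rst E f g \<in> ts_maps E F" unfolding rst_ts_maps[OF ObsD(1)[OF E]] .
  ultimately show ?thesis using E F by (simp add: nice_arrs_iff)
qed

text \<open>Nice maps are bijective on states, which forces the lift there; conflicts can arise only
  on actions, and injectivity rules them out.\<close>

lemma inj_acts_llp:
  assumes "(A, h, B) \<in> arr K" "inj_on (snd h) (acts A)"
  shows "(A, h, B) \<in> llp K nice_arrs"
  unfolding llp_def
proof (intro CollectI conjI assms ballI)
  fix p assume p: "p \<in> nice_arrs"
  obtain E k F where p': "p = (E, k, F)" by (cases p)
  have n: "nice E F (fst k) (snd k)" "(E, k, F) \<in> arr K" using p unfolding p' nice_arrs_iff by blast+
  have h: "is_map A B (fst h) (snd h)" "B \<in> Obs" using assms(1) by (simp_all add: ts_mapsD)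
  show "has_lifting K (A, h, B) p"
    unfolding p' has_lifting_lifts[OF assms(1) n(2)]
    by (rule nice_lifts[OF n(1) h(1) assms(2) ObsD(1)[OF h(2)]])
qed

text \<open>Inverting on states and choosing preimages of actions gives a map back from
  \<open>B\<close> to \<open>A\<close>, since transitions are reflected. It is a two-sided inverse
  on states, and states decide about maps into objects of \<open>Zs\<close>.\<close>

lemma nice_W: "nice_arrs \<subseteq> W"
proof
  fix p assume p: "p \<in> nice_arrs"
  obtain A h B where p': "p = (A, h, B)" by (cases p)
  have A: "A \<in> Obs" "B \<in> Obs" "h \<in> ts_maps A B" and n: "nice A B (fst h) (snd h)"
    using p unfolding p' nice_arrs_iff by simp_all
  have h: "is_map A B (fst h) (snd h)" "bij_betw (fst h) (states A) (states B)" "snd h ` acts A = acts B"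
    "\<And>\<alpha> \<beta> us. \<alpha> \<in> states A \<Longrightarrow> \<beta> \<in> states A \<Longrightarrow> set us \<subseteq> acts A \<Longrightarrow>
      (fst h \<alpha>, map (snd h) us, fst h \<beta>) \<in> transitions B \<Longrightarrow> (\<alpha>, us, \<beta>) \<in> transitions A"
    using n unfolding nice_def by blast+
  define s where "s = inv_into (states A) (fst h)"
  define t where "t = inv_into (acts A) (snd h)"
  have s: "s b \<in> states A" "fst h (s b) = b" if "b \<in> states B" for b
    using h(2) that unfolding s_def bij_betw_def by (auto simp: inv_into_into f_inv_into_f)
  have sh: "s (fst h a) = a" if "a \<in> states A" for a
    using h(2) that unfolding s_def by (rule bij_betw_inv_into_left)
  have t: "t v \<in> acts A" "snd h (t v) = v" if "v \<in> acts B" for v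
    using h(3) that unfolding t_def by (auto simp: inv_into_into f_inv_into_f)
  show "p \<in> W"
    unfolding p'
  proof (rule W_I[OF A])
    fix Z f g assume Z: "Z \<in> Zs" and f: "is_map A Z f g"
    have "is_map B Z (\<lambda>b. f (s b)) (\<lambda>v. g (t v))"
    proof (rule is_mapI)
      fix v assume v: "v \<in> acts B"
      show "lab Z (g (t v)) = lab B v"
        using is_mapD(3)[OF f t(1)[OF v]] is_mapD(3)[OF h(1) t(1)[OF v]] t(2)[OF v] by simp
    next
      fix \<alpha> us \<beta> assume tr: "(\<alpha>, us, \<beta>) \<in> transitions B"
      note d = weak_tsD[OF ObsD(1)[OF A(2)] tr]
      have m: "map (snd h) (map t us) = us" using d(4) t(2) by (auto intro!: map_idI)
      have "(s \<alpha>, map t us, s \<beta>) \<in> transitions A"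
        by (rule h(4)) (use s d t m tr in auto)
      from is_mapD(4)[OF f this] show "(f (s \<alpha>), map (\<lambda>v. g (t v)) us, f (s \<beta>)) \<in> transitions Z"
        by (simp add: comp_def)
    qed (use is_mapD(1,2)[OF f] s(1) t(1) in blast)+
    then show "\<exists>f' g'. is_map B Z f' g' \<and> (\<forall>a \<in> states A. f' (fst h a) = f a)"
      using sh by (intro exI[of _ "\<lambda>b. f (s b)"] exI[of _ "\<lambda>v. g (t v)"]) auto
  next
    fix Z f g f' g' b
    assume "\<And>a. a \<in> states A \<Longrightarrow> f (fst h a) = f' (fst h a)" "b \<in> states B"
    then show "f b = f' b" using s[of b] by metis
  qed
qed

text \<open>An analogue of the mapping cylinder: keep the states of \<open>B\<close>, take disjoint
  copies of the actions of \<open>A\<close> and of \<open>B\<close>, and let each copy act in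
  \<open>B\<close> through its image. The copies from \<open>A\<close> make the first factor
  injective on actions, those from \<open>B\<close> make the second one onto.\<close>

lemma cofibration_factorization:
  assumes f: "f \<in> homs K A B"
  shows "\<exists>E. \<exists>i \<in> homs K A E. \<exists>p \<in> homs K E B. i \<in> llp K nice_arrs \<and> p \<in> nice_arrs \<and> f = cmp K p i"
proof -
  obtain h where h: "f = (A, h, B)" "h \<in> ts_maps A B" and A: "A \<in> Obs" "B \<in> Obs"
    using f unfolding ts_homs by blast
  note hm = ts_mapsD[OF h(2)]
  \<comment> \<open>Two tags: \<open>c\<close> marks copies of actions of \<open>A\<close>,
    \<open>d\<close> copies of actions of \<open>B\<close>.\<close>
  obtain c d :: 'u where cd: "c \<noteq> d"
    using ex_new_if_finite[OF infinite_univ, of "{undefined}"] by blast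
  define M where "M = (\<lambda>u. pr (c, u)) ` acts A \<union> (\<lambda>u. pr (d, u)) ` acts B"
  define p where "p w = (if fst (inv pr w) = c then snd h (snd (inv pr w)) else snd (inv pr w))" for w
  have p1: "p (pr (c, u)) = snd h u" and p2: "p (pr (d, u)) = u" for u
    using cd by (simp_all only: p_def inv_pr fst_conv snd_conv) simp_all
  have pM: "p ` M = acts B"
  proof -
    have "p ` M = snd h ` acts A \<union> acts B"
      by (simp only: M_def image_Un image_image p1 p2 image_ident)
    then show ?thesis using is_mapD(2)[OF hm] by auto
  qed
  let ?E = "pullback_acts B M p"
  have E: "?E \<in> Obs"
  proof (rule ObsI)
    show "cub_or_reg r ?E" by (rule cub_or_reg_pullback_acts[OF ObsD(2)[OF A(2)]]) (simp add: pM)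
    show "small (states ?E)" using ObsD(4)[OF A(2)] by simp
    show "small (acts ?E)"
      using small_Un[OF small_image[OF ObsD(5)[OF A(1)]] small_image[OF ObsD(5)[OF A(2)]]] by (simp add: M_def)
  qed
  have i: "is_map A ?E (fst h) (\<lambda>u. pr (c, u))"
  proof (rule is_mapI)
    fix u assume u: "u \<in> acts A"
    then show c: "pr (c, u) \<in> acts ?E" by (simp add: M_def)
    then show "lab ?E (pr (c, u)) = lab A u" using is_mapD(3)[OF hm u] by (simp add: p_def)
  next
    fix a assume "a \<in> states A"
    then show "fst h a \<in> states ?E" using is_mapD(1)[OF hm] by simp
  next
    fix \<alpha> us \<beta> assume t: "(\<alpha>, us, \<beta>) \<in> transitions A"
    have "map p (map (\<lambda>u. pr (c, u)) us) = map (snd h) us" by (simp add: p_def)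
    moreover have "set (map (\<lambda>u. pr (c, u)) us) \<subseteq> M"
      using weak_tsD(4)[OF ObsD(1)[OF A(1)] t] by (auto simp: M_def)
    ultimately show "(fst h \<alpha>, map (\<lambda>u. pr (c, u)) us, fst h \<beta>) \<in> transitions ?E"
      unfolding pullback_acts_simps using is_mapD(4)[OF hm t] by metis
  qed
  let ?i = "(A, rst A (fst h) (\<lambda>u. pr (c, u)), ?E)" and ?p = "(?E, rst ?E (\<lambda>a. a) p, B)"
  have "?i \<in> arr K" using A E i by (simp add: rst_ts_maps[OF ObsD(1)])
  moreover have "inj_on (snd (rst A (fst h) (\<lambda>u. pr (c, u)))) (acts A)"
    by (simp add: inj_on_def)
  ultimately have "?i \<in> llp K nice_arrs" by (rule inj_acts_llp)
  moreover have n: "?p \<in> nice_arrs"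
    by (rule nice_arrsI[OF E A(2) nice_pullback_acts[OF pM]])
  moreover have "f = cmp K ?p ?i"
  proof -
    have "ts_comp A (rst ?E (\<lambda>a. a) p) (rst A (fst h) (\<lambda>u. pr (c, u))) = h"
      unfolding ts_comp_eq_map_iff[OF h(2)]
    proof (intro conjI ballI)
      fix a assume "a \<in> states A"
      then show "fst (rst ?E (\<lambda>a. a) p) (fst (rst A (fst h) (\<lambda>u. pr (c, u))) a) = fst h a"
        using is_mapD(1)[OF i] by simp
    next
      fix u assume "u \<in> acts A"
      then show "snd (rst ?E (\<lambda>a. a) p) (snd (rst A (fst h) (\<lambda>u. pr (c, u))) u) = snd h u"
        using is_mapD(2)[OF i] by (simp add: p_def)
    qed
    then show ?thesis using h(1) by simp
  qed
  moreover have "?i \<in> homs K A ?E" "?p \<in> homs K ?E B"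
    using ts.arr_homs[OF \<open>?i \<in> arr K\<close>] ts.arr_homs[OF subsetD[OF nice_arrs_arr n]] by simp_all
  ultimately show ?thesis by blast
qed

section \<open>Reflection into label-injective objects\<close>

definition act_of :: "('u, 'x) ts \<Rightarrow> 'x \<Rightarrow> 'u" where
  "act_of Z = inv_into (acts Z) (lab Z)"

lemma act_of_lab: "Z \<in> Zs \<Longrightarrow> u \<in> acts Z \<Longrightarrow> act_of Z (lab Z u) = u"
  unfolding act_of_def Zs_def by simp

lemma act_of_is_map: "Z \<in> Zs \<Longrightarrow> is_map A Z f g \<Longrightarrow> u \<in> acts A \<Longrightarrow> act_of Z (lab A u) = g u"
  using act_of_lab[of Z "g u"] is_mapD(2,3)[of A Z f g u] by simp

definition indist :: "('u, 'x) ts \<Rightarrow> 'u \<Rightarrow> 'u \<Rightarrow> bool" where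
  "indist A a b \<longleftrightarrow> (\<forall>Z \<in> Zs. \<forall>f g. is_map A Z f g \<longrightarrow> f a = f b)"

text \<open>A chosen representative stands for its class, so the states of the quotient are again
  states of \<open>A\<close>. A map from \<open>A\<close> to an object of \<open>Zs\<close> can then
  be applied to the quotient as it stands.\<close>

definition rep :: "('u, 'x) ts \<Rightarrow> 'u \<Rightarrow> 'u" where
  "rep A a = (SOME b. b \<in> states A \<and> indist A a b)"

lemma rep: "a \<in> states A \<Longrightarrow> rep A a \<in> states A \<and> indist A a (rep A a)"
  unfolding rep_def by (rule someI[of _ a]) (simp add: indist_def)

lemma rep_eq: "indist A a b \<Longrightarrow> rep A a = rep A b"
proof -
  assume "indist A a b"
  then have e: "f a = f b" if "Z \<in> Zs" "is_map A Z f g" for Z f g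
    using that unfolding indist_def by blast
  have "indist A a c \<longleftrightarrow> indist A b c" for c
    unfolding indist_def
  proof (intro iffI ballI allI impI)
    fix Z f g assume "\<forall>Z \<in> Zs. \<forall>f g. is_map A Z f g \<longrightarrow> f a = f c" and Z: "Z \<in> Zs" "is_map A Z f g"
    then have "f a = f c" by blast
    then show "f b = f c" using e[OF Z] by simp
  next
    fix Z f g assume "\<forall>Z \<in> Zs. \<forall>f g. is_map A Z f g \<longrightarrow> f b = f c" and Z: "Z \<in> Zs" "is_map A Z f g"
    then have "f b = f c" by blast
    then show "f a = f c" using e[OF Z] by simp
  qed
  then show ?thesis unfolding rep_def by simp
qed

lemma is_map_rep: "Z \<in> Zs \<Longrightarrow> is_map A Z f g \<Longrightarrow> a \<in> states A \<Longrightarrow> f (rep A a) = f a"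
proof -
  assume a: "Z \<in> Zs" "is_map A Z f g" "a \<in> states A"
  then have "f a = f (rep A a)" using rep[OF a(3)] unfolding indist_def by blast
  then show ?thesis by simp
qed

text \<open>
  The reflection of \<open>A\<close> into the objects whose actions are determined by their labels. It is
  cut out by all maps to such objects, and \<open>core\<close> restores the intermediate states.
\<close>

definition pre_reflection :: "('u, 'x) ts \<Rightarrow> ('u, 'x) ts" where
  "pre_reflection A = \<lparr> states = rep A ` states A, acts = lb ` lab A ` acts A,
     lab = restrict (inv lb) (lb ` lab A ` acts A),
     transitions = {(a, us, b). a \<in> rep A ` states A \<and> b \<in> rep A ` states A \<and> us \<noteq> [] \<and>
       set us \<subseteq> lb ` lab A ` acts A \<and>
       (\<forall>Z \<in> Zs. \<forall>f g. is_map A Z f g \<longrightarrow> (f a, map (\<lambda>u. act_of Z (inv lb u)) us, f b) \<in> transitions Z)} \<rparr>"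

definition reflection :: "('u, 'x) ts \<Rightarrow> ('u, 'x) ts" where
  "reflection A = core (pre_reflection A)"

lemma pre_reflection_simps [simp]:
  "states (pre_reflection A) = rep A ` states A" "acts (pre_reflection A) = lb ` lab A ` acts A"
  "lab (pre_reflection A) = restrict (inv lb) (lb ` lab A ` acts A)"
  "(a, us, b) \<in> transitions (pre_reflection A) \<longleftrightarrow> a \<in> rep A ` states A \<and> b \<in> rep A ` states A \<and> us \<noteq> [] \<and>
       set us \<subseteq> lb ` lab A ` acts A \<and>
       (\<forall>Z \<in> Zs. \<forall>f g. is_map A Z f g \<longrightarrow> (f a, map (\<lambda>u. act_of Z (inv lb u)) us, f b) \<in> transitions Z)"
  unfolding pre_reflection_def by auto

lemma pre_reflection_transition:
  assumes "(a, us, b) \<in> transitions (pre_reflection A)" "Z \<in> Zs" "is_map A Z f g"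
  shows "(f a, map (\<lambda>u. act_of Z (inv lb u)) us, f b) \<in> transitions Z"
  using assms unfolding pre_reflection_simps by blast

text \<open>Each axiom is tested after all maps into objects of \<open>Zs\<close>, where it holds.
  Intermediate states are another matter: those found in the different targets need not come from
  one common state, hence the later passage to \<open>core\<close>.\<close>

lemma weak_ts_pre_reflection: "weak_ts (pre_reflection A)"
proof (rule weak_tsI)
  fix a us b vs assume t: "(a, us, b) \<in> transitions (pre_reflection A)" and m: "mset vs = mset us"
  have "(f a, map (\<lambda>u. act_of Z (inv lb u)) vs, f b) \<in> transitions Z" if Z: "Z \<in> Zs" "is_map A Z f g" for Z f g
    by (rule transition_mset_cong[OF ObsD(1)[OF Zs_Obs[OF Z(1)]] pre_reflection_transition[OF t Z]])
      (use m in simp)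
  then show "(a, vs, b) \<in> transitions (pre_reflection A)"
    using t m mset_eq_setD[OF m] by auto
next
  fix \<alpha> us vs ws \<beta> \<nu>1 \<nu>2
  assume a: "us \<noteq> []" "vs \<noteq> []" "ws \<noteq> []" "(\<alpha>, us @ vs @ ws, \<beta>) \<in> transitions (pre_reflection A)"
    "(\<alpha>, us, \<nu>1) \<in> transitions (pre_reflection A)" "(\<nu>1, vs @ ws, \<beta>) \<in> transitions (pre_reflection A)"
    "(\<alpha>, us @ vs, \<nu>2) \<in> transitions (pre_reflection A)" "(\<nu>2, ws, \<beta>) \<in> transitions (pre_reflection A)"
  have "(f \<nu>1, map (\<lambda>u. act_of Z (inv lb u)) vs, f \<nu>2) \<in> transitions Z" if Z: "Z \<in> Zs" "is_map A Z f g" for Z f g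
    using weak_ts_compose[OF ObsD(1)[OF Zs_Obs[OF Z(1)]] _ _ _
        a(4-8)[THEN pre_reflection_transition, OF Z, unfolded map_append]] a(1-3) by simp
  then show "(\<nu>1, vs, \<nu>2) \<in> transitions (pre_reflection A)"
    using a by auto
qed auto

lemma rep_rep: "a \<in> rep A ` states A \<Longrightarrow> rep A a = a"
  using rep rep_eq by fastforce

text \<open>In every target the images of two intermediate states agree by uniqueness there. The two
  states are therefore indistinguishable and, being representatives, equal.\<close>

lemma intermediate_unique_pre_reflection:
  assumes r
  shows "intermediate_unique (pre_reflection A)"
  unfolding intermediate_unique_def
proof (intro allI impI, elim conjE)
  fix \<alpha> us vs \<beta> \<nu> \<nu>'
  assume a: "us \<noteq> []" "vs \<noteq> []" "(\<alpha>, us @ vs, \<beta>) \<in> transitions (pre_reflection A)"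
    "(\<alpha>, us, \<nu>) \<in> transitions (pre_reflection A)" "(\<nu>, vs, \<beta>) \<in> transitions (pre_reflection A)"
    "(\<alpha>, us, \<nu>') \<in> transitions (pre_reflection A)" "(\<nu>', vs, \<beta>) \<in> transitions (pre_reflection A)"
  have "f \<nu> = f \<nu>'" if Z: "Z \<in> Zs" "is_map A Z f g" for Z f g
    using cub_or_regD(5)[OF ObsD(2)[OF Zs_Obs[OF Z(1)]] assms _ _
        a(3-7)[THEN pre_reflection_transition, OF Z, unfolded map_append]] a(1,2) by simp
  then have "indist A \<nu> \<nu>'" unfolding indist_def by blast
  then have e: "rep A \<nu> = rep A \<nu>'" by (rule rep_eq)
  have "\<nu> \<in> rep A ` states A" using a(4) unfolding pre_reflection_simps by (elim conjE)
  moreover have "\<nu>' \<in> rep A ` states A" using a(6) unfolding pre_reflection_simps by (elim conjE)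
  ultimately show "\<nu> = \<nu>'" using e by (simp only: rep_rep)
qed

lemma reflection_Zs:
  assumes A: "A \<in> Obs"
  shows "reflection A \<in> Zs"
proof -
  have sub: "acts (reflection A) \<subseteq> lb ` lab A ` acts A"
    using core_acts_subset[OF weak_ts_pre_reflection[of A]] unfolding reflection_def by (simp del: core_simps)
  have "small (acts (reflection A))"
    by (rule small_subset[OF small_image[OF ObsD(5)[OF A], of "\<lambda>u. lb (lab A u)"]]) (use sub in auto)
  then have "reflection A \<in> Obs"
    using cub_or_reg_core[OF weak_ts_pre_reflection intermediate_unique_pre_reflection] ObsD[OF A]
    by (intro ObsI) (auto simp: reflection_def intro!: small_image)
  moreover have "inj_on (lab (reflection A)) (acts (reflection A))"
  proof (rule inj_onI)
    fix u v assume u: "u \<in> acts (reflection A)" "v \<in> acts (reflection A)"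
      and e: "lab (reflection A) u = lab (reflection A) v"
    have "lab (reflection A) w = inv lb w" if "w \<in> acts (reflection A)" for w
      using that sub by (auto simp: reflection_def)
    then have "inv lb u = inv lb v" using u e by metis
    moreover have "u \<in> range lb" "v \<in> range lb" using u sub by blast+
    ultimately show "u = v" using inv_into_injective by metis
  qed
  ultimately show ?thesis by (simp add: Zs_def)
qed

lemma reflection_lab:
  assumes "u \<in> acts (reflection A)"
  shows "lb (lab (reflection A) u) = u"
proof -
  have u: "u \<in> lb ` lab A ` acts A"
    using subsetD[OF core_acts_subset[OF weak_ts_pre_reflection[of A]]] assms unfolding reflection_def by simp
  have "lab (reflection A) u = inv lb u"
    using assms u unfolding reflection_def by simp
  then show ?thesis using u f_inv_into_f[of u lb UNIV] by auto
qed

lemma reflection_states [simp]: "states (reflection A) = rep A ` states A"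
  by (simp add: reflection_def)

lemma is_map_reflection:
  assumes A: "A \<in> Obs"
  shows "is_map A (reflection A) (rep A) (\<lambda>u. lb (lab A u))"
  unfolding reflection_def
proof (rule is_map_core[OF ObsD(3)[OF A]], rule is_mapI)
  fix \<alpha> us \<beta> assume t: "(\<alpha>, us, \<beta>) \<in> transitions A"
  note d = weak_tsD[OF ObsD(1)[OF A] t]
  have "(f (rep A \<alpha>), map (\<lambda>u. act_of Z (inv lb u)) (map (\<lambda>u. lb (lab A u)) us), f (rep A \<beta>)) \<in> transitions Z"
    if Z: "Z \<in> Zs" "is_map A Z f g" for Z f g
  proof -
    have "map (\<lambda>u. act_of Z (inv lb u)) (map (\<lambda>u. lb (lab A u)) us) = map g us"
      using act_of_is_map[OF Z] d(4) by auto
    then show ?thesis using is_mapD(4)[OF Z(2) t] is_map_rep[OF Z] d(1,2) by metis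
  qed
  then show "(rep A \<alpha>, map (\<lambda>u. lb (lab A u)) us, rep A \<beta>) \<in> transitions (pre_reflection A)"
    using d by auto
qed auto

text \<open>As the states of the reflection are representatives in \<open>A\<close>, the map
  \<open>f\<close> itself is the extension on states. On actions the extension takes the only action
  of \<open>Z\<close> with the given label.\<close>

lemma reflection_extend:
  assumes A: "A \<in> Obs" and Z: "Z \<in> Zs" and f: "is_map A Z f g"
  shows "is_map (reflection A) Z f (\<lambda>u. act_of Z (inv lb u))"
proof (rule is_mapI)
  fix a assume "a \<in> states (reflection A)"
  then show "f a \<in> states Z" using is_mapD(1)[OF f] rep[of _ A] by auto
next
  fix u assume u: "u \<in> acts (reflection A)"
  then have "u \<in> lb ` lab A ` acts A"
    using core_acts_subset[OF weak_ts_pre_reflection[of A]] unfolding reflection_def by (auto simp del: core_simps)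
  then obtain w where w: "w \<in> acts A" "u = lb (lab A w)" by blast
  have *: "act_of Z (inv lb u) = g w" using act_of_is_map[OF Z f w(1)] w(2) by simp
  show "act_of Z (inv lb u) \<in> acts Z" using * is_mapD(2)[OF f w(1)] by simp
  show "lab Z (act_of Z (inv lb u)) = lab (reflection A) u"
    using * is_mapD(3)[OF f w(1)] u w by (auto simp: reflection_def)
next
  fix \<alpha> us \<beta> assume "(\<alpha>, us, \<beta>) \<in> transitions (reflection A)"
  then have "(\<alpha>, us, \<beta>) \<in> transitions (pre_reflection A)"
    unfolding reflection_def by (rule core_transitionsD(1))
  then show "(f \<alpha>, map (\<lambda>u. act_of Z (inv lb u)) us, f \<beta>) \<in> transitions Z"
    using Z f by auto
qed

text \<open>
  Full subobjects, on the set \<open>S\<close> of pairs of states, of the product of \<open>B\<close> with the reflection of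
  \<open>A\<close>; the label of an action of \<open>B\<close> determines its second component.
\<close>

definition product_on :: "('u, 'x) ts \<Rightarrow> ('u, 'x) ts \<Rightarrow> ('u \<times> 'u) set \<Rightarrow> ('u, 'x) ts" where
  "product_on A B S = \<lparr> states = pr ` S, acts = acts B, lab = lab B,
     transitions = {(p, us, q). p \<in> pr ` S \<and> q \<in> pr ` S \<and>
       (fst (inv pr p), us, fst (inv pr q)) \<in> transitions B \<and>
       (snd (inv pr p), map (\<lambda>u. lb (lab B u)) us, snd (inv pr q)) \<in> transitions (reflection A)} \<rparr>"

lemma product_on_simps [simp]:
  "states (product_on A B S) = pr ` S" "acts (product_on A B S) = acts B" "lab (product_on A B S) = lab B"
  "(p, us, q) \<in> transitions (product_on A B S) \<longleftrightarrow> p \<in> pr ` S \<and> q \<in> pr ` S \<and>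
       (fst (inv pr p), us, fst (inv pr q)) \<in> transitions B \<and>
       (snd (inv pr p), map (\<lambda>u. lb (lab B u)) us, snd (inv pr q)) \<in> transitions (reflection A)"
  unfolding product_on_def by simp_all

lemma product_on_transitionD:
  assumes "(p, us, q) \<in> transitions (product_on A B S)"
  shows "p \<in> pr ` S" "q \<in> pr ` S" "(fst (inv pr p), us, fst (inv pr q)) \<in> transitions B"
    "(snd (inv pr p), map (\<lambda>u. lb (lab B u)) us, snd (inv pr q)) \<in> transitions (reflection A)"
  using assms by (simp_all only: product_on_simps)

lemma weak_ts_product_on:
  assumes A: "A \<in> Obs" and B: "B \<in> Obs"
  shows "weak_ts (product_on A B S)"
proof (rule weak_tsI)
  note RA = ObsD(1)[OF Zs_Obs[OF reflection_Zs[OF A]]] and WB = ObsD(1)[OF B]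
  show "lab (product_on A B S) \<in> extensional (acts (product_on A B S))"
    using WB by (simp add: weak_ts_def)
  fix \<alpha> us \<beta> assume t: "(\<alpha>, us, \<beta>) \<in> transitions (product_on A B S)"
  then show "\<alpha> \<in> states (product_on A B S) \<and> \<beta> \<in> states (product_on A B S) \<and> us \<noteq> [] \<and>
      set us \<subseteq> acts (product_on A B S)"
    using weak_tsD(3,4)[OF WB, of "fst (inv pr \<alpha>)" us "fst (inv pr \<beta>)"] by simp
  fix vs assume m: "mset vs = mset us"
  then have m': "mset (map (\<lambda>u. lb (lab B u)) vs) = mset (map (\<lambda>u. lb (lab B u)) us)" by simp
  show "(\<alpha>, vs, \<beta>) \<in> transitions (product_on A B S)"
    using t transition_mset_cong[OF WB _ m] transition_mset_cong[OF RA _ m'] by simp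
next
  note RA = ObsD(1)[OF Zs_Obs[OF reflection_Zs[OF A]]] and WB = ObsD(1)[OF B]
  fix \<alpha> us vs ws \<beta> \<nu>1 \<nu>2
  assume a: "us \<noteq> []" "vs \<noteq> []" "ws \<noteq> []" "(\<alpha>, us @ vs @ ws, \<beta>) \<in> transitions (product_on A B S)"
    "(\<alpha>, us, \<nu>1) \<in> transitions (product_on A B S)" "(\<nu>1, vs @ ws, \<beta>) \<in> transitions (product_on A B S)"
    "(\<alpha>, us @ vs, \<nu>2) \<in> transitions (product_on A B S)" "(\<nu>2, ws, \<beta>) \<in> transitions (product_on A B S)"
  show "(\<nu>1, vs, \<nu>2) \<in> transitions (product_on A B S)"
    unfolding product_on_simps
  proof (intro conjI)
    show "\<nu>1 \<in> pr ` S" "\<nu>2 \<in> pr ` S" using a(5,7)[THEN product_on_transitionD(2)] .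
    show "(fst (inv pr \<nu>1), vs, fst (inv pr \<nu>2)) \<in> transitions B"
      by (rule weak_ts_compose[OF WB a(1-3) a(4-8)[THEN product_on_transitionD(3)]])
    show "(snd (inv pr \<nu>1), map (\<lambda>u. lb (lab B u)) vs, snd (inv pr \<nu>2)) \<in> transitions (reflection A)"
      using weak_ts_compose[OF RA _ _ _ a(4-8)[THEN product_on_transitionD(4), unfolded map_append]] a(1-3) by simp
  qed
qed

lemma intermediate_unique_product_on:
  assumes A: "A \<in> Obs" and B: "B \<in> Obs" and r
  shows "intermediate_unique (product_on A B S)"
  unfolding intermediate_unique_def
proof (intro allI impI, elim conjE)
  note RA = ObsD(2)[OF Zs_Obs[OF reflection_Zs[OF A]]] and WB = ObsD(2)[OF B]
  fix \<alpha> us vs \<beta> \<nu> \<nu>'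
  assume a: "us \<noteq> []" "vs \<noteq> []" "(\<alpha>, us @ vs, \<beta>) \<in> transitions (product_on A B S)"
    "(\<alpha>, us, \<nu>) \<in> transitions (product_on A B S)" "(\<nu>, vs, \<beta>) \<in> transitions (product_on A B S)"
    "(\<alpha>, us, \<nu>') \<in> transitions (product_on A B S)" "(\<nu>', vs, \<beta>) \<in> transitions (product_on A B S)"
  have "fst (inv pr \<nu>) = fst (inv pr \<nu>')"
    by (rule cub_or_regD(5)[OF WB \<open>r\<close> a(1,2) a(3-7)[THEN product_on_transitionD(3)]])
  moreover have "snd (inv pr \<nu>) = snd (inv pr \<nu>')"
    using cub_or_regD(5)[OF RA \<open>r\<close> _ _ a(3-7)[THEN product_on_transitionD(4), unfolded map_append]] a(1,2) by simp
  ultimately have "inv pr \<nu> = inv pr \<nu>'" by (rule prod_eqI)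
  moreover have "\<nu> \<in> pr ` S" "\<nu>' \<in> pr ` S" using a(4,6)[THEN product_on_transitionD(2)] .
  ultimately show "\<nu> = \<nu>'" by auto
qed

text \<open>The condition that makes the projection from \<open>core (product_on A B S)\<close> to
  \<open>B\<close> lift against \<open>W\<close>. The first coordinate of a lift is prescribed, the
  second extends because the reflection lies in \<open>Zs\<close>, and closure keeps the resulting
  pair in \<open>S\<close>.\<close>

definition orth_closed :: "('u, 'x) ts \<Rightarrow> ('u, 'x) ts \<Rightarrow> ('u \<times> 'u) set \<Rightarrow> bool" where
  "orth_closed A B S \<longleftrightarrow> (\<forall>X i Y f g k l. (X, i, Y) \<in> W \<and> is_map Y B f g \<and> is_map Y (reflection A) k l \<and>
     (\<forall>x \<in> states X. (f (fst i x), k (fst i x)) \<in> S) \<longrightarrow> (\<forall>y \<in> states Y. (f y, k y) \<in> S))"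

lemma is_map_product_on:
  assumes A: "A \<in> Obs" and Y: "Y \<in> Obs" and f: "is_map Y B f g" and k: "is_map Y (reflection A) k l"
    and S: "\<And>y. y \<in> states Y \<Longrightarrow> (f y, k y) \<in> S"
  shows "is_map Y (core (product_on A B S)) (\<lambda>y. pr (f y, k y)) g"
proof (rule is_map_core[OF ObsD(3)[OF Y]], rule is_mapI)
  fix \<alpha> us \<beta> assume t: "(\<alpha>, us, \<beta>) \<in> transitions Y"
  note d = weak_tsD[OF ObsD(1)[OF Y] t]
  have "lb (lab B (g u)) = l u" if u: "u \<in> acts Y" for u
    using reflection_lab[OF is_mapD(2)[OF k u]] is_mapD(3)[OF k u] is_mapD(3)[OF f u] by simp
  then have "map (\<lambda>u. lb (lab B u)) (map g us) = map l us" using d(4) by auto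
  then have "(k \<alpha>, map (\<lambda>u. lb (lab B u)) (map g us), k \<beta>) \<in> transitions (reflection A)"
    using is_mapD(4)[OF k t] by metis
  then show "(pr (f \<alpha>, k \<alpha>), map g us, pr (f \<beta>, k \<beta>)) \<in> transitions (product_on A B S)"
    using is_mapD(4)[OF f t] S[OF d(1)] S[OF d(2)] by simp
next
  fix y assume "y \<in> states Y"
  from S[OF this] show "pr (f y, k y) \<in> states (product_on A B S)" by simp
next
  fix u assume "u \<in> acts Y"
  then show "g u \<in> acts (product_on A B S)" "lab (product_on A B S) (g u) = lab Y u"
    using is_mapD(2,3)[OF f] by simp_all
qed

lemma product_on_fst:
  assumes B: "B \<in> Obs" and S: "\<And>p. p \<in> S \<Longrightarrow> fst p \<in> states B" and A: "A \<in> Obs"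
  shows "is_map (core (product_on A B S)) B (\<lambda>p. fst (inv pr p)) (\<lambda>u. u)"
proof (rule is_mapI)
  fix p assume "p \<in> states (core (product_on A B S))"
  then show "fst (inv pr p) \<in> states B" using S by auto
next
  fix u assume u: "u \<in> acts (core (product_on A B S))"
  then show "u \<in> acts B" using subsetD[OF core_acts_subset[OF weak_ts_product_on[OF A B]]] by simp
  show "lab B u = lab (core (product_on A B S)) u" using u by (simp only: core_simps restrict_apply if_True product_on_simps)
next
  fix \<alpha> us \<beta> assume "(\<alpha>, us, \<beta>) \<in> transitions (core (product_on A B S))"
  from core_transitionsD(1)[OF this]
  show "(fst (inv pr \<alpha>), map (\<lambda>u. u) us, fst (inv pr \<beta>)) \<in> transitions B" by simp
qed

lemma product_on_snd:
  assumes B: "B \<in> Obs" and S: "\<And>p. p \<in> S \<Longrightarrow> snd p \<in> rep A ` states A" and A: "A \<in> Obs"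
  shows "is_map (core (product_on A B S)) (reflection A) (\<lambda>p. snd (inv pr p)) (\<lambda>u. lb (lab B u))"
proof (rule is_mapI)
  fix p assume "p \<in> states (core (product_on A B S))"
  then obtain q where "p = pr q" "q \<in> S" by auto
  then show "snd (inv pr p) \<in> states (reflection A)" using S[of q] by simp
next
  note RA = ObsD(1)[OF Zs_Obs[OF reflection_Zs[OF A]]]
  fix u assume u: "u \<in> acts (core (product_on A B S))"
  then obtain p q where "(p, [u], q) \<in> transitions (product_on A B S)" by (simp only: core_simps) blast
  then have "(snd (inv pr p), [lb (lab B u)], snd (inv pr q)) \<in> transitions (reflection A)" by simp
  from weak_tsD(4)[OF RA this] show *: "lb (lab B u) \<in> acts (reflection A)" by simp
  have "lab (core (product_on A B S)) u = lab B u" using u by (simp only: core_simps restrict_apply if_True product_on_simps)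
  moreover have "lab (reflection A) (lb (lab B u)) = lab B u"
    using reflection_lab[OF *] injD[OF inj_lb] by blast
  ultimately show "lab (reflection A) (lb (lab B u)) = lab (core (product_on A B S)) u" by simp
next
  fix \<alpha> us \<beta> assume "(\<alpha>, us, \<beta>) \<in> transitions (core (product_on A B S))"
  from core_transitionsD(1)[OF this]
  show "(snd (inv pr \<alpha>), map (\<lambda>u. lb (lab B u)) us, snd (inv pr \<beta>)) \<in> transitions (reflection A)" by simp
qed

lemma core_product_on_Obs:
  assumes A: "A \<in> Obs" and B: "B \<in> Obs" and S: "S \<subseteq> states B \<times> rep A ` states A"
  shows "core (product_on A B S) \<in> Obs"
proof (rule ObsI)
  show "cub_or_reg r (core (product_on A B S))"
    by (rule cub_or_reg_core[OF weak_ts_product_on[OF A B] intermediate_unique_product_on[OF A B]])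
  show "small (states (core (product_on A B S)))"
    by (rule small_subset[OF small_Times_image[OF ObsD(4)[OF B] small_image[OF ObsD(4)[OF A]], of pr "rep A"]])
      (use S in auto)
  show "small (acts (core (product_on A B S)))"
    by (rule small_subset[OF ObsD(5)[OF B]])
      (use core_acts_subset[OF weak_ts_product_on[OF A B, of S]] in \<open>simp del: core_simps\<close>)
qed

text \<open>
  Taking the least \<open>orth_closed\<close> set of states containing the image of \<open>A\<close> makes \<open>A \<rightarrow> Q\<close>
  orthogonal: the locus where two maps out of \<open>Q\<close> agree is again closed.
\<close>

lemma orth_factorization:
  assumes f: "f \<in> homs K A B"
  shows "\<exists>E. \<exists>i \<in> homs K A E. \<exists>p \<in> homs K E B. i \<in> W \<and> p \<in> rlp K W \<and> f = cmp K p i"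
proof -
  obtain h where h: "f = (A, h, B)" "h \<in> ts_maps A B" and A: "A \<in> Obs" and B: "B \<in> Obs"
    using f unfolding ts_homs by blast
  note hm = ts_mapsD[OF h(2)]
  define im where "im = (\<lambda>a. (fst h a, rep A a)) ` states A"
  define S where "S = \<Inter> {S. S \<subseteq> states B \<times> rep A ` states A \<and> im \<subseteq> S \<and> orth_closed A B S}"
  have "orth_closed A B (states B \<times> rep A ` states A)"
    unfolding orth_closed_def
  proof (intro allI impI ballI, elim conjE)
    fix X i Y f g k l y
    assume f: "is_map Y B f g" and k: "is_map Y (reflection A) k l" and y: "y \<in> states Y"
    show "(f y, k y) \<in> states B \<times> rep A ` states A"
      using is_mapD(1)[OF f y] is_mapD(1)[OF k y] by simp
  qed
  moreover have im: "im \<subseteq> states B \<times> rep A ` states A"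
    using is_mapD(1)[OF hm] by (auto simp: im_def)
  ultimately have S_sub: "S \<subseteq> states B \<times> rep A ` states A" unfolding S_def by blast
  have S_im: "im \<subseteq> S" unfolding S_def by blast
  have S_closed: "orth_closed A B S"
    unfolding orth_closed_def
  proof (intro allI impI ballI, elim conjE)
    fix X i Y f g k l y
    assume a: "(X, i, Y) \<in> W" "is_map Y B f g" "is_map Y (reflection A) k l" and y: "y \<in> states Y"
      and S: "\<forall>x \<in> states X. (f (fst i x), k (fst i x)) \<in> S"
    show "(f y, k y) \<in> S"
      unfolding S_def
    proof (intro InterI, elim CollectE conjE)
      fix S' assume S': "S' \<subseteq> states B \<times> rep A ` states A" "im \<subseteq> S'" "orth_closed A B S'"
      then have "S \<subseteq> S'" unfolding S_def by blast
      then show "(f y, k y) \<in> S'" using S'(3) a y S unfolding orth_closed_def by blast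
    qed
  qed
  have S_least: "S \<subseteq> S'" if "S' \<subseteq> S" "im \<subseteq> S'" "orth_closed A B S'" for S'
  proof -
    have "S' \<subseteq> states B \<times> rep A ` states A" using that(1) S_sub by (rule subset_trans)
    then show ?thesis using that(2,3) unfolding S_def by (intro Inter_lower CollectI conjI)
  qed
  define Q where "Q = core (product_on A B S)"
  have Q: "Q \<in> Obs" unfolding Q_def by (rule core_product_on_Obs[OF A B S_sub])
  have Qfst: "is_map Q B (\<lambda>p. fst (inv pr p)) (\<lambda>u. u)"
    unfolding Q_def by (rule product_on_fst[OF B _ A]) (use S_sub in auto)
  have Qsnd: "is_map Q (reflection A) (\<lambda>p. snd (inv pr p)) (\<lambda>u. lb (lab B u))"
    unfolding Q_def by (rule product_on_snd[OF B _ A]) (use S_sub in auto)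
  have Q_in: "is_map Y Q (\<lambda>y. pr (f y, k y)) g"
    if "Y \<in> Obs" "is_map Y B f g" "is_map Y (reflection A) k l" "\<And>y. y \<in> states Y \<Longrightarrow> (f y, k y) \<in> S" for Y f g k l
    unfolding Q_def by (rule is_map_product_on[OF A that])
  have Q_states: "states Q = pr ` S" by (simp add: Q_def)
  have i: "is_map A Q (\<lambda>a. pr (fst h a, rep A a)) (snd h)"
    by (rule Q_in[OF A hm is_map_reflection[OF A]]) (use S_im in \<open>auto simp: im_def\<close>)
  let ?i = "(A, rst A (\<lambda>a. pr (fst h a, rep A a)) (snd h), Q)"
  let ?p = "(Q, rst Q (\<lambda>p. fst (inv pr p)) (\<lambda>u. u), B)"
  have ia: "?i \<in> arr K" using A Q i by (simp add: rst_ts_maps[OF ObsD(1)])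
  have pa: "?p \<in> arr K" using B Q Qfst by (simp add: rst_ts_maps[OF ObsD(1)])
  have "?i \<in> W"
  proof (rule W_I[OF A Q])
    show "rst A (\<lambda>a. pr (fst h a, rep A a)) (snd h) \<in> ts_maps A Q" using ia by simp
  next
    fix Z k l assume Z: "Z \<in> Zs" and k: "is_map A Z k l"
    \<comment> \<open>The required extension of \<open>k\<close> to \<open>Q\<close> is the
      projection to the reflection of \<open>A\<close> followed by the map that \<open>k\<close>
      induces there.\<close>
    note m = is_map_comp[OF Qsnd reflection_extend[OF A Z k]]
    have "k (snd (inv pr (pr (fst h a, rep A a)))) = k a" if "a \<in> states A" for a
      using is_map_rep[OF Z k that] by simp
    then show "\<exists>f' g'. is_map Q Z f' g' \<and>
        (\<forall>a \<in> states A. f' (fst (rst A (\<lambda>a. pr (fst h a, rep A a)) (snd h)) a) = k a)"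
      using m by (intro exI conjI) (assumption, simp)
  next
    fix Z k l k' l' q
    assume Z: "Z \<in> Zs" and k: "is_map Q Z k l" "is_map Q Z k' l'"
      and e: "\<And>a. a \<in> states A \<Longrightarrow> k (fst (rst A (\<lambda>a. pr (fst h a, rep A a)) (snd h)) a) =
        k' (fst (rst A (\<lambda>a. pr (fst h a, rep A a)) (snd h)) a)"
      and q: "q \<in> states Q"
    define S' where "S' = {p \<in> S. k (pr p) = k' (pr p)}"
    have "S \<subseteq> S'"
    proof (rule S_least)
      show "S' \<subseteq> S" by (auto simp: S'_def)
      show "im \<subseteq> S'"
      proof
        fix p assume p: "p \<in> im"
        then obtain a where a: "a \<in> states A" "p = (fst h a, rep A a)" unfolding im_def by blast
        show "p \<in> S'" using S_im p e[OF a(1)] a unfolding S'_def by auto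
      qed
      show "orth_closed A B S'"
        unfolding orth_closed_def
      proof (intro allI impI ballI, elim conjE)
        fix X i Y f g m n y
        assume w: "(X, i, Y) \<in> W" and f: "is_map Y B f g" and m: "is_map Y (reflection A) m n"
          and y: "y \<in> states Y" and S': "\<forall>x \<in> states X. (f (fst i x), m (fst i x)) \<in> S'"
        have Y: "Y \<in> Obs" using subsetD[OF ts.orth_arr w] by simp
        have "\<forall>x \<in> states X. (f (fst i x), m (fst i x)) \<in> S" using S' by (simp add: S'_def)
        then have yS: "(f y, m y) \<in> S" if "y \<in> states Y" for y
          using S_closed w f m that unfolding orth_closed_def by blast
        note q = Q_in[OF Y f m yS]
        have "k (pr (f y, m y)) = k' (pr (f y, m y))"
          by (rule W_unique[OF w Z is_map_comp[OF q k(1)] is_map_comp[OF q k(2)] _ y])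
            (use S' in \<open>simp_all add: S'_def\<close>)
        then show "(f y, m y) \<in> S'" using yS[OF y] by (simp add: S'_def)
      qed
    qed
    then show "k q = k' q" using q unfolding Q_states S'_def by blast
  qed
  moreover have "?p \<in> rlp K W"
    unfolding rlp_def
  proof (intro CollectI conjI pa ballI)
    fix j assume j: "j \<in> W"
    obtain X j' Y where j': "j = (X, j', Y)" by (cases j)
    have ja: "(X, j', Y) \<in> arr K" using j j' subsetD[OF ts.orth_arr] by blast
    then have X: "X \<in> Obs" and Y: "Y \<in> Obs" and jm: "is_map X Y (fst j') (snd j')" by (simp_all add: ts_mapsD)
    show "has_lifting K j ?p"
      unfolding j' has_lifting_lifts[OF ja pa] lifts_def
    proof (intro allI impI, elim conjE)
      fix us ua vs va
      assume u: "is_map X Q us ua" and v: "is_map Y B vs va"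
        and e1: "\<forall>a \<in> states X. fst (rst Q (\<lambda>p. fst (inv pr p)) (\<lambda>u. u)) (us a) = vs (fst j' a)"
        and e2: "\<forall>w \<in> acts X. snd (rst Q (\<lambda>p. fst (inv pr p)) (\<lambda>u. u)) (ua w) = va (snd j' w)"
      have e1': "fst (inv pr (us a)) = vs (fst j' a)" if "a \<in> states X" for a
        using bspec[OF e1 that] is_mapD(1)[OF u that] by simp
      have e2': "ua w = va (snd j' w)" if "w \<in> acts X" for w
        using bspec[OF e2 that] is_mapD(2)[OF u that] by simp
      \<comment> \<open>The second coordinate of the lift: the reflection is label-injective, so the
        projected map extends along the given element of \<open>W\<close>.\<close>
      obtain k l where k: "is_map Y (reflection A) k l" "\<And>a. a \<in> states X \<Longrightarrow> k (fst j' a) = snd (inv pr (us a))"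
        using W_extend[OF j[unfolded j'] reflection_Zs[OF A] is_map_comp[OF u Qsnd]] by blast
      have us: "us a = pr (vs (fst j' a), k (fst j' a)) \<and> (vs (fst j' a), k (fst j' a)) \<in> S" if a: "a \<in> states X" for a
      proof -
        obtain p where p: "us a = pr p" "p \<in> S" using is_mapD(1)[OF u a] unfolding Q_states by blast
        moreover have "p = (vs (fst j' a), k (fst j' a))"
          using e1'[OF a] k(2)[OF a] p(1) by (intro prod_eqI) simp_all
        ultimately show ?thesis by simp
      qed
      then have "(vs y, k y) \<in> S" if "y \<in> states Y" for y
        using S_closed j[unfolded j'] v k(1) that unfolding orth_closed_def by blast
      from Q_in[OF Y v k(1) this]
      have l: "is_map Y Q (\<lambda>y. pr (vs y, k y)) va" .
      show "\<exists>ls la. is_map Y Q ls la \<and>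
           (\<forall>a \<in> states X. ls (fst j' a) = us a) \<and> (\<forall>u \<in> acts X. la (snd j' u) = ua u) \<and>
           (\<forall>b \<in> states Y. fst (rst Q (\<lambda>p. fst (inv pr p)) (\<lambda>u. u)) (ls b) = vs b) \<and>
           (\<forall>u \<in> acts Y. snd (rst Q (\<lambda>p. fst (inv pr p)) (\<lambda>u. u)) (la u) = va u)"
        using l us e2' is_mapD(1,2)[OF l] by (intro exI[of _ "\<lambda>y. pr (vs y, k y)"] exI[of _ va]) simp
    qed
  qed
  moreover have "f = cmp K ?p ?i"
  proof -
    have "ts_comp A (rst Q (\<lambda>p. fst (inv pr p)) (\<lambda>u. u)) (rst A (\<lambda>a. pr (fst h a, rep A a)) (snd h)) = h"
      unfolding ts_comp_eq_map_iff[OF h(2)] using is_mapD(1,2)[OF i] by simp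
    then show ?thesis using h(1) by simp
  qed
  moreover have "?i \<in> homs K A Q" "?p \<in> homs K Q B" using ia pa by simp_all
  ultimately show ?thesis by blast
qed

end

section \<open>Cubes and trivial fibrations\<close>

text \<open>One construction covers the cubes and, from dimension 2 on, their boundaries, so that
  the axioms are checked only once.\<close>

definition trunc_cube :: "'x list \<Rightarrow> nat \<Rightarrow> (bool list, 'x \<times> nat, 'x) wts" where
  "trunc_cube xs m = cube xs \<lparr> transitions := {(e, us, e') \<in> transitions (cube xs). length us \<le> m} \<rparr>"

lemma cube_simps [simp]:
  "states (cube xs) = {e. length e = length xs}"
  "acts (cube xs) = {(xs ! i, i) | i. i < length xs}"
  "lab (cube xs) = restrict fst {(xs ! i, i) | i. i < length xs}"
  by (simp_all add: cube_def)

text \<open>The index list of the definition is recovered as \<open>map snd us\<close>. For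
  booleans, \<open>\<le>\<close> together with \<open>\<noteq>\<close> says that a coordinate is
  switched on.\<close>

lemma cube_transitions:
  "(e, us, e') \<in> transitions (cube xs) \<longleftrightarrow>
     length e = length xs \<and> length e' = length xs \<and> us \<noteq> [] \<and> distinct us \<and> set us \<subseteq> acts (cube xs) \<and>
     (\<forall>i < length xs. if (xs ! i, i) \<in> set us then \<not> e ! i \<and> e' ! i else e' ! i = e ! i)"
  (is "?L \<longleftrightarrow> ?R")
proof
  assume ?L
  then obtain "is" where i: "us = map (\<lambda>i. (xs ! i, i)) is" "length e = length xs" "length e' = length xs"
    "is \<noteq> []" "distinct is" "set is \<subseteq> {..<length xs}"
    "\<forall>i < length xs. e ! i \<le> e' ! i \<and> (e ! i \<noteq> e' ! i \<longleftrightarrow> i \<in> set is)"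
    unfolding cube_def by auto
  have "distinct us" using i(1,5) by (auto simp: distinct_map inj_on_def)
  moreover have "(xs ! i, i) \<in> set us \<longleftrightarrow> i \<in> set is" for i using i(1) by auto
  ultimately show ?R using i by auto
next
  assume R: ?R
  define "is" where "is = map snd us"
  have us: "us = map (\<lambda>i. (xs ! i, i)) is"
    unfolding is_def map_map using R by (intro map_idI[symmetric]) auto
  have mem: "(xs ! i, i) \<in> set us \<longleftrightarrow> i \<in> set is" for i using us by auto
  have "distinct is" using R us by (metis distinct_map)
  moreover have "set is \<subseteq> {..<length xs}" using R unfolding is_def by auto
  moreover have "\<forall>i < length xs. e ! i \<le> e' ! i \<and> (e ! i \<noteq> e' ! i \<longleftrightarrow> i \<in> set is)"
    using R mem by (metis le_boolI)
  moreover have "is \<noteq> []" using R us by auto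
  ultimately show ?L unfolding cube_def using us R by auto
qed

lemma trunc_cube_simps [simp]:
  "states (trunc_cube xs m) = states (cube xs)" "acts (trunc_cube xs m) = acts (cube xs)"
  "lab (trunc_cube xs m) = lab (cube xs)"
  by (simp_all add: trunc_cube_def)

lemma trunc_cube_transitions:
  "(e, us, e') \<in> transitions (trunc_cube xs m) \<longleftrightarrow> (e, us, e') \<in> transitions (cube xs) \<and> length us \<le> m"
  by (auto simp: trunc_cube_def)

lemma cube_transitions_mset:
  assumes "(e, us, e') \<in> transitions (cube xs)" "mset vs = mset us"
  shows "(e, vs, e') \<in> transitions (cube xs)"
proof -
  have "set vs = set us" "distinct vs \<longleftrightarrow> distinct us" "vs = [] \<longleftrightarrow> us = []"
    using assms(2) mset_eq_setD mset_eq_imp_distinct_iff by (blast, blast, auto)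
  then show ?thesis using assms(1) unfolding cube_transitions by simp
qed

lemma cube_transitions_compose:
  assumes "vs \<noteq> []" "(\<alpha>, us, \<nu>1) \<in> transitions (cube xs)" "(\<alpha>, us @ vs, \<nu>2) \<in> transitions (cube xs)"
  shows "(\<nu>1, vs, \<nu>2) \<in> transitions (cube xs)"
  unfolding cube_transitions
proof (intro conjI allI impI)
  fix i assume i: "i < length xs"
  have "set us \<inter> set vs = {}" using assms(3) unfolding cube_transitions by simp
  moreover have "if (xs ! i, i) \<in> set us then \<not> \<alpha> ! i \<and> \<nu>1 ! i else \<nu>1 ! i = \<alpha> ! i"
    using assms(2) i unfolding cube_transitions by blast
  moreover have "if (xs ! i, i) \<in> set (us @ vs) then \<not> \<alpha> ! i \<and> \<nu>2 ! i else \<nu>2 ! i = \<alpha> ! i"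
    using assms(3) i unfolding cube_transitions by blast
  ultimately show "if (xs ! i, i) \<in> set vs then \<not> \<nu>1 ! i \<and> \<nu>2 ! i else \<nu>2 ! i = \<nu>1 ! i"
    by (auto split: if_splits)
qed (use assms in \<open>simp_all add: cube_transitions del: cube_simps\<close>)

lemma cube_intermediate:
  assumes "us \<noteq> []" "vs \<noteq> []" "(\<alpha>, us @ vs, \<beta>) \<in> transitions (cube xs)"
  shows "\<exists>\<nu>. (\<alpha>, us, \<nu>) \<in> transitions (cube xs)"
proof -
  \<comment> \<open>The source vertex with the coordinates of \<open>us\<close> switched on.\<close>
  define \<nu> where "\<nu> = map (\<lambda>i. \<alpha> ! i \<or> (xs ! i, i) \<in> set us) [0..<length xs]"
  have "(\<alpha>, us, \<nu>) \<in> transitions (cube xs)"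
    unfolding cube_transitions
  proof (intro conjI allI impI)
    fix i assume i: "i < length xs"
    have "if (xs ! i, i) \<in> set (us @ vs) then \<not> \<alpha> ! i \<and> \<beta> ! i else \<beta> ! i = \<alpha> ! i"
      using assms(3) i unfolding cube_transitions by blast
    then show "if (xs ! i, i) \<in> set us then \<not> \<alpha> ! i \<and> \<nu> ! i else \<nu> ! i = \<alpha> ! i"
      using i by (auto simp: \<nu>_def split: if_splits)
  qed (use assms in \<open>simp_all add: cube_transitions \<nu>_def del: cube_simps\<close>)
  then show ?thesis by blast
qed

lemma cube_transitions_functional:
  assumes "(\<alpha>, us, \<nu>) \<in> transitions (cube xs)" "(\<alpha>, us, \<nu>') \<in> transitions (cube xs)"
  shows "\<nu> = \<nu>'"
proof (rule nth_equalityI)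
  show "length \<nu> = length \<nu>'" using assms by (simp add: cube_transitions)
  fix i assume "i < length \<nu>"
  then have i: "i < length xs" using assms(1) by (simp add: cube_transitions)
  have "if (xs ! i, i) \<in> set us then \<not> \<alpha> ! i \<and> \<nu> ! i else \<nu> ! i = \<alpha> ! i"
    "if (xs ! i, i) \<in> set us then \<not> \<alpha> ! i \<and> \<nu>' ! i else \<nu>' ! i = \<alpha> ! i"
    using assms i unfolding cube_transitions by blast+
  then show "\<nu> ! i = \<nu>' ! i" by (simp split: if_splits)
qed

lemma cube_edge:
  assumes "i < length xs"
  shows "((replicate (length xs) False), [(xs ! i, i)], (replicate (length xs) False)[i := True]) \<in> transitions (cube xs)"
  unfolding cube_transitions using assms by (auto simp: nth_list_update)

text \<open>The pieces of a transition are shorter than the transition itself, so the bound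
  \<open>m\<close> interferes neither with intermediate states nor with the composition axiom.
  Positivity of \<open>m\<close> keeps the edges, on which every action has to occur.\<close>

lemma cub_or_reg_trunc_cube:
  assumes "m > 0"
  shows "cub_or_reg r (trunc_cube xs m)"
proof (rule cub_or_regI)
  show "weak_ts (trunc_cube xs m)"
  proof (rule weak_tsI)
    fix \<alpha> us \<beta> vs assume "(\<alpha>, us, \<beta>) \<in> transitions (trunc_cube xs m)" "mset vs = mset us"
    then show "(\<alpha>, vs, \<beta>) \<in> transitions (trunc_cube xs m)"
      unfolding trunc_cube_transitions using cube_transitions_mset mset_eq_length by metis
  next
    fix \<alpha> us vs ws \<beta> \<nu>1 \<nu>2 assume a: "vs \<noteq> []"
      "(\<alpha>, us, \<nu>1) \<in> transitions (trunc_cube xs m)" "(\<alpha>, us @ vs, \<nu>2) \<in> transitions (trunc_cube xs m)"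
    then show "(\<nu>1, vs, \<nu>2) \<in> transitions (trunc_cube xs m)"
      unfolding trunc_cube_transitions using cube_transitions_compose[OF a(1)] by simp
  qed (auto simp: trunc_cube_transitions cube_transitions)
  fix u assume "u \<in> acts (trunc_cube xs m)"
  then obtain i where "u = (xs ! i, i)" "i < length xs" by auto
  then show "\<exists>\<alpha> \<beta>. (\<alpha>, [u], \<beta>) \<in> transitions (trunc_cube xs m)"
    using cube_edge[of i xs] assms unfolding trunc_cube_transitions by auto
next
  fix \<alpha> us vs \<beta> assume a: "us \<noteq> []" "vs \<noteq> []" "(\<alpha>, us @ vs, \<beta>) \<in> transitions (trunc_cube xs m)"
  then have t: "(\<alpha>, us @ vs, \<beta>) \<in> transitions (cube xs)" by (simp add: trunc_cube_transitions)
  obtain \<nu> where "(\<alpha>, us, \<nu>) \<in> transitions (cube xs)" using cube_intermediate[OF a(1,2) t] by blast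
  then show "\<exists>\<nu>. (\<alpha>, us, \<nu>) \<in> transitions (trunc_cube xs m) \<and> (\<nu>, vs, \<beta>) \<in> transitions (trunc_cube xs m)"
    using cube_transitions_compose[OF a(2) _ t] a(3) by (auto simp: trunc_cube_transitions)
next
  fix \<alpha> us \<nu> \<nu>' assume "(\<alpha>, us, \<nu>) \<in> transitions (trunc_cube xs m)" "(\<alpha>, us, \<nu>') \<in> transitions (trunc_cube xs m)"
  then show "\<nu> = \<nu>'" unfolding trunc_cube_transitions using cube_transitions_functional by blast
qed

lemma length_le_of_cube_transition:
  assumes "(e, us, e') \<in> transitions (cube xs)"
  shows "length us \<le> length xs"
proof -
  have acts: "acts (cube xs) = (\<lambda>i. (xs ! i, i)) ` {..<length xs}" by auto
  have "length us = card (set us)" using assms unfolding cube_transitions by (simp add: distinct_card)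
  also have "\<dots> \<le> card (acts (cube xs))"
    using assms unfolding cube_transitions acts by (intro card_mono) auto
  also have "\<dots> \<le> length xs" unfolding acts using card_image_le[of "{..<length xs}"] by simp
  finally show ?thesis .
qed

text \<open>No transition is longer than \<open>length xs\<close>; the extra \<open>Suc\<close>
  keeps the bound positive for the empty list, as \<open>cub_or_reg_trunc_cube\<close>
  requires.\<close>

lemma cube_eq_trunc: "cube xs = trunc_cube xs (Suc (length xs))"
  unfolding trunc_cube_def using length_le_of_cube_transition[of _ _ _ xs]
  by (intro wts.equality) (auto intro: le_SucI)

lemma cub_or_reg_cube: "cub_or_reg r (cube xs)"
  by (subst cube_eq_trunc) (simp add: cub_or_reg_trunc_cube)

lemma cub_or_reg_discrete: "cub_or_reg r (discrete_ts A)"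
  by (rule cub_or_regI) (auto simp: discrete_ts_def intro!: weak_tsI)

lemma cube_boundary_trunc: "length xs \<ge> 2 \<Longrightarrow> cube_boundary xs = trunc_cube xs (length xs - 1)"
proof -
  assume n: "length xs \<ge> 2"
  have "{(e, us, e') \<in> transitions (cube xs). length us \<noteq> length xs} =
      {(e, us, e') \<in> transitions (cube xs). length us \<le> length xs - 1}"
    using length_le_of_cube_transition[of _ _ _ xs] n by fastforce
  then show ?thesis using n unfolding cube_boundary_def trunc_cube_def by simp
qed

lemma cub_or_reg_cube_boundary:
  assumes "length xs \<ge> 1"
  shows "cub_or_reg r (cube_boundary xs)"
proof (cases "length xs = 1")
  case True
  then show ?thesis by (simp add: cube_boundary_def cub_or_reg_discrete)
next
  case False
  then show ?thesis using assms by (simp add: cube_boundary_trunc cub_or_reg_trunc_cube)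
qed

lemma cub_or_reg_length1:
  assumes "weak_ts X" "\<And>\<alpha> us \<beta>. (\<alpha>, us, \<beta>) \<in> transitions X \<Longrightarrow> length us = 1"
    "\<And>u. u \<in> acts X \<Longrightarrow> \<exists>\<alpha> \<beta>. (\<alpha>, [u], \<beta>) \<in> transitions X"
  shows "cub_or_reg r X"
proof (rule cub_or_regI[OF assms(1,3)])
  fix \<alpha> us vs \<beta> assume a: "us \<noteq> []" "vs \<noteq> []" "(\<alpha>, us @ vs, \<beta>) \<in> transitions X"
  have "length us + length vs = 1" using assms(2)[OF a(3)] by simp
  then have "length us = 0 \<or> length vs = 0" by arith
  then have False using a(1,2) by simp
  then show "\<exists>\<nu>. (\<alpha>, us, \<nu>) \<in> transitions X \<and> (\<nu>, vs, \<beta>) \<in> transitions X" "\<nu> = \<nu>'" for \<nu> \<nu>' by blast+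
qed

lemma weak_ts_length1:
  assumes "lab X \<in> extensional (acts X)"
    "\<And>\<alpha> us \<beta>. (\<alpha>, us, \<beta>) \<in> transitions X \<Longrightarrow> \<alpha> \<in> states X \<and> \<beta> \<in> states X \<and> length us = 1 \<and> set us \<subseteq> acts X"
  shows "weak_ts X"
proof (rule weak_tsI[OF assms(1)])
  fix \<alpha> us \<beta> assume t: "(\<alpha>, us, \<beta>) \<in> transitions X"
  then show "\<alpha> \<in> states X \<and> \<beta> \<in> states X \<and> us \<noteq> [] \<and> set us \<subseteq> acts X" using assms(2) by fastforce
  fix vs assume "mset vs = mset us"
  moreover obtain u where "us = [u]" using assms(2)[OF t] by (auto simp: length_Suc_conv)
  ultimately show "(\<alpha>, vs, \<beta>) \<in> transitions X" using t by simp
next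
  fix \<alpha> us vs ws \<beta> \<nu>1 \<nu>2 assume a: "us \<noteq> []" "vs \<noteq> []" and t: "(\<alpha>, us @ vs @ ws, \<beta>) \<in> transitions X"
  have "length us + (length vs + length ws) = 1" using assms(2)[OF t] by simp
  then have "length us = 0 \<or> length vs = 0" by arith
  then show "(\<nu>1, vs, \<nu>2) \<in> transitions X" using a by simp
qed

lemma cub_or_reg_double_transition: "cub_or_reg r (double_transition x)"
proof (rule cub_or_reg_length1)
  show "weak_ts (double_transition x)"
    by (rule weak_ts_length1) (auto simp: double_transition_def)
qed (auto simp: double_transition_def)

text \<open>Every transition of a cubical system is the image of the longest transition of a cube.
  Intermediate states may be chosen vertex by vertex: any two choices split one and the same
  transition, and the composition axiom then provides the transitions between them.\<close>

lemma cube_map_exists: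
  assumes F: "cubical_ts F" and t: "(\<alpha>, us, \<beta>) \<in> transitions F"
  obtains \<nu> where "is_map (cube (map (lab F) us)) F \<nu> (\<lambda>w. us ! snd w)"
    "\<nu> (replicate (length us) False) = \<alpha>" "\<nu> (replicate (length us) True) = \<beta>"
proof -
  define n where "n = length us"
  \<comment> \<open>\<open>I e\<close> lists the actions already performed at the vertex
    \<open>e\<close>, \<open>J e\<close> those still to come.\<close>
  define I J where "I e = map (\<lambda>i. us ! i) (filter (\<lambda>i. e ! i) [0..<n])"
    and "J e = map (\<lambda>i. us ! i) (filter (\<lambda>i. \<not> e ! i) [0..<n])" for e :: "bool list"
  have F': "weak_ts F" using F by (simp add: cubical_ts_def)
  note d = weak_tsD[OF F' t]
  have us: "map (\<lambda>i. us ! i) [0..<n] = us" unfolding n_def by (rule map_nth)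
  have IJ: "mset (I e @ J e) = mset us" for e
  proof -
    have "mset (I e @ J e) = image_mset (\<lambda>i. us ! i) (mset [0..<n])"
      unfolding I_def J_def mset_append mset_map mset_filter image_mset_union[symmetric] multiset_partition[symmetric] ..
    then show ?thesis using us by (metis mset_map)
  qed
  \<comment> \<open>The two extreme vertices are fixed to be the ends of the transition; every other
    vertex gets its own intermediate state, without regard to its neighbours.\<close>
  define \<nu> where "\<nu> e = (if I e = [] then \<alpha> else if J e = [] then \<beta> else
    (SOME \<nu>. (\<alpha>, I e, \<nu>) \<in> transitions F \<and> (\<nu>, J e, \<beta>) \<in> transitions F))" for e
  have mid: "(\<alpha>, I e, \<nu> e) \<in> transitions F \<and> (\<nu> e, J e, \<beta>) \<in> transitions F" if "I e \<noteq> []" "J e \<noteq> []" for e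
  proof -
    have "\<exists>\<nu>. (\<alpha>, I e, \<nu>) \<in> transitions F \<and> (\<nu>, J e, \<beta>) \<in> transitions F"
      using intermediate_state[OF F transition_mset_cong[OF F' t IJ] that] by blast
    from someI_ex[OF this] show ?thesis using that by (simp add: \<nu>_def)
  qed
  have nI: "(\<alpha>, I e, \<nu> e) \<in> transitions F" if "I e \<noteq> []" for e
  proof (cases "J e = []")
    case True
    then show ?thesis using that transition_mset_cong[OF F' t, of "I e"] IJ[of e] by (simp add: \<nu>_def)
  next
    case False
    then show ?thesis using mid that by blast
  qed
  have nJ: "(\<nu> e, J e, \<beta>) \<in> transitions F" if "J e \<noteq> []" for e
  proof (cases "I e = []")
    case True
    then show ?thesis using that transition_mset_cong[OF F' t, of "J e"] IJ[of e] by (simp add: \<nu>_def)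
  next
    case False
    then show ?thesis using mid that by blast
  qed
  have n0: "\<nu> e = \<alpha>" if "I e = []" for e using that by (simp add: \<nu>_def)
  have n1: "\<nu> e = \<beta>" if "J e = []" for e
  proof -
    have "I e \<noteq> []" using IJ[of e] that d(3) by auto
    then show ?thesis using that by (simp add: \<nu>_def)
  qed
  let ?C = "cube (map (lab F) us)"
  have "is_map ?C F \<nu> (\<lambda>w. us ! snd w)"
  proof (rule is_mapI)
    fix e assume "e \<in> states ?C"
    show "\<nu> e \<in> states F"
      using n0[of e] d(1) weak_tsD(2)[OF F' nI[of e]] by (cases "I e = []") simp_all
  next
    fix w assume "w \<in> acts ?C"
    then obtain i where "w = (map (lab F) us ! i, i)" "i < length us" by auto
    then show "us ! snd w \<in> acts F" "lab F (us ! snd w) = lab ?C w" using d(4) nth_mem by auto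
  next
    fix e ws e' assume t': "(e, ws, e') \<in> transitions ?C"
    define "is" where "is = map snd ws"
    let ?M = "\<lambda>js. map (\<lambda>i. us ! i) js"
    have ws: "map (\<lambda>w. us ! snd w) ws = ?M is" by (simp add: is_def)
    have acts: "w = (map (lab F) us ! snd w, snd w) \<and> snd w < n" if "w \<in> set ws" for w
      using t' that unfolding cube_transitions n_def by auto
    have mem: "(map (lab F) us ! i, i) \<in> set ws \<longleftrightarrow> i \<in> set is" for i
      using acts unfolding is_def by force
    have "inj_on snd (set ws)" using acts by (metis inj_onI)
    then have dis: "distinct is" using t' unfolding cube_transitions is_def by (simp add: distinct_map)
    have step: "if i \<in> set is then \<not> e ! i \<and> e' ! i else e' ! i = e ! i" if "i < n" for i
      using t' that mem[of i] unfolding cube_transitions n_def by (auto split: if_splits)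
    have isn: "set is \<subseteq> {..<n}" using acts unfolding is_def by auto
    have ne: "is \<noteq> []" using t' unfolding cube_transitions is_def by simp
    have *: "mset (?M xs) = mset (?M ys)" if "distinct xs" "distinct ys" "set xs = set ys" for xs ys
      using that by (metis mset_map set_eq_iff_mset_eq_distinct)
    have s1: "set (is @ filter (\<lambda>i. e ! i) [0..<n]) = set (filter (\<lambda>i. e' ! i) [0..<n])"
    proof (rule set_eqI)
      fix i show "i \<in> set (is @ filter (\<lambda>i. e ! i) [0..<n]) \<longleftrightarrow> i \<in> set (filter (\<lambda>i. e' ! i) [0..<n])"
        using step[of i] isn by (auto split: if_splits)
    qed
    have s2: "set (is @ filter (\<lambda>i. \<not> e' ! i) [0..<n]) = set (filter (\<lambda>i. \<not> e ! i) [0..<n])"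
    proof (rule set_eqI)
      fix i show "i \<in> set (is @ filter (\<lambda>i. \<not> e' ! i) [0..<n]) \<longleftrightarrow> i \<in> set (filter (\<lambda>i. \<not> e ! i) [0..<n])"
        using step[of i] isn by (auto split: if_splits)
    qed
    have d1: "distinct (is @ filter (\<lambda>i. e ! i) [0..<n])" "distinct (is @ filter (\<lambda>i. \<not> e' ! i) [0..<n])"
      using dis step by (auto split: if_splits)
    have Ie': "mset (?M is) + mset (I e) = mset (I e')"
    proof -
      have "mset (?M (is @ filter (\<lambda>i. e ! i) [0..<n])) = mset (I e')"
        unfolding I_def by (rule *[OF d1(1) _ s1]) simp
      then show ?thesis by (simp add: I_def)
    qed
    have Je: "mset (?M is) + mset (J e') = mset (J e)"
    proof -
      have "mset (?M (is @ filter (\<lambda>i. \<not> e' ! i) [0..<n])) = mset (J e)"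
        unfolding J_def by (rule *[OF d1(2) _ s2]) simp
      then show ?thesis by (simp add: J_def)
    qed
    have Ie'_ne: "I e' \<noteq> []" using Ie' ne by auto
    have Je_ne: "J e \<noteq> []" using Je ne by auto
    have "(\<nu> e, ?M is, \<nu> e') \<in> transitions F"
    proof (cases "I e = []")
      case True
      then show ?thesis using transition_mset_cong[OF F' nI[OF Ie'_ne]] Ie' n0 by simp
    next
      case I: False
      show ?thesis
      proof (cases "J e' = []")
        case True
        then show ?thesis using transition_mset_cong[OF F' nJ[OF Je_ne]] Je n1 by simp
      next
        case J: False
        \<comment> \<open>The states at \<open>e\<close> and \<open>e'\<close> split the same long
          transition, after \<open>I e\<close> and after \<open>I e @ ?M is\<close>, which is a
          rearrangement of \<open>I e'\<close>. The composition axiom supplies the piece in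
          between.\<close>
        have "(\<alpha>, I e @ ?M is @ J e', \<beta>) \<in> transitions F"
          by (rule transition_mset_cong[OF F' t]) (use Je IJ[of e] in simp)
        moreover have "(\<nu> e, ?M is @ J e', \<beta>) \<in> transitions F"
          by (rule transition_mset_cong[OF F' nJ[OF Je_ne]]) (use Je in simp)
        moreover have "(\<alpha>, I e @ ?M is, \<nu> e') \<in> transitions F"
          by (rule transition_mset_cong[OF F' nI[OF Ie'_ne]]) (use Ie' in \<open>simp add: add.commute\<close>)
        ultimately show ?thesis
          using weak_ts_compose[OF F' I _ J] nI[OF I] nJ[OF J] ne by blast
      qed
    qed
    then show "(\<nu> e, map (\<lambda>w. us ! snd w) ws, \<nu> e') \<in> transitions F" using ws by simp
  qed
  moreover have "\<nu> (replicate n False) = \<alpha>" by (rule n0) (simp add: I_def filter_empty_conv)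
  moreover have "\<nu> (replicate n True) = \<beta>" by (rule n1) (simp add: J_def filter_empty_conv)
  ultimately show ?thesis using that unfolding n_def by blast
qed

section \<open>The generating cofibrations as concrete maps\<close>

lemma discrete_simps [simp]:
  "states (discrete_ts S) = S" "acts (discrete_ts S) = {}" "transitions (discrete_ts S) = {}"
  by (simp_all add: discrete_ts_def)

lemma cube_boundary_sub:
  "states (cube_boundary xs) = states (cube xs)" "acts (cube_boundary xs) \<subseteq> acts (cube xs)"
  "transitions (cube_boundary xs) \<subseteq> transitions (cube xs)"
  "u \<in> acts (cube_boundary xs) \<Longrightarrow> lab (cube_boundary xs) u = lab (cube xs) u"
  "(e, us, e') \<in> transitions (cube_boundary xs) \<Longrightarrow> length us < length xs"
proof -
  show "(e, us, e') \<in> transitions (cube_boundary xs) \<Longrightarrow> length us < length xs"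
    using length_le_of_cube_transition[of e us e' xs] unfolding cube_boundary_def
    by (auto split: if_splits)
qed (auto simp: cube_boundary_def simp del: cube_simps)

lemma finite_cube: "finite (states (cube xs))" "finite (acts (cube xs))"
proof -
  have "states (cube xs) = {e :: bool list. set e \<subseteq> UNIV \<and> length e = length xs}" by simp
  then show "finite (states (cube xs))" using finite_lists_length_eq[of "UNIV :: bool set"] by simp
  have "acts (cube xs) = (\<lambda>i. (xs ! i, i)) ` {..<length xs}" by auto
  then show "finite (acts (cube xs))" by simp
qed

lemma is_map_boundary:
  fixes xs :: "'y list"
  assumes that: "length xs \<ge> 1"
  shows "is_map (cube_boundary xs) (cube xs) (fst (ts_id (cube_boundary xs))) (snd (ts_id (cube_boundary xs)))"
proof -
  have "is_map (cube_boundary xs) (cube xs) (\<lambda>a. a) (\<lambda>u. u)"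
    by (rule is_mapI) (use cube_boundary_sub[where xs = xs] in auto)
  moreover have "weak_ts (cube_boundary xs)" using cub_or_regD(1)[OF cub_or_reg_cube_boundary[OF that]] .
  ultimately have "ts_id (cube_boundary xs) \<in> ts_maps (cube_boundary xs) (cube xs)"
    unfolding ts_id_rst by (simp add: rst_ts_maps)
  then show ?thesis by (rule ts_mapsD)
qed

lemma cube1_transitions: "transitions (cube [x]) = {([False], [(x, 0)], [True])}"
proof -
  have "(e, us, e') \<in> transitions (cube [x]) \<longleftrightarrow> (e, us, e') = ([False], [(x, 0)], [True])" for e us e'
  proof
    assume t: "(e, us, e') \<in> transitions (cube [x])"
    have "length us \<le> 1" using length_le_of_cube_transition[OF t] by simp
    then obtain u where u: "us = [u]" using t by (cases us) (auto simp: cube_transitions)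
    then have "u = (x, 0)" using t by (simp add: cube_transitions)
    moreover obtain a b where "e = [a]" "e' = [b]" using t by (auto simp: cube_transitions length_Suc_conv)
    ultimately show "(e, us, e') = ([False], [(x, 0)], [True])" using t u by (simp add: cube_transitions)
  qed (auto simp: cube_transitions)
  then show ?thesis by auto
qed

lemma cube1_states: "states (cube [x]) = {[False], [True]}"
  by (auto simp: length_Suc_conv)

lemma is_map_cube_double:
  "is_map (cube [x]) (double_transition x)
    (fst (\<lambda>e \<in> states (cube [x]). if e = [False] then 1 else 2, \<lambda>u \<in> acts (cube [x]). x))
    (snd (\<lambda>e \<in> states (cube [x]). if e = [False] then 1 else (2::nat), \<lambda>u \<in> acts (cube [x]). x))"
  by (rule is_mapI) (auto simp: cube1_transitions double_transition_def)

lemma cube0: "states (cube []) = {[]}" "acts (cube []) = {}" "transitions (cube []) = {}"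
proof -
  show "transitions (cube []) = {}" by (auto simp: cube_def)
qed auto

lemma weak_ts_cube: "weak_ts (cube xs)"
  using cub_or_regD(1)[OF cub_or_reg_cube] .

lemma cube_top:
  assumes "us \<noteq> []"
  shows "(replicate (length us) False, map (\<lambda>i. (us ! i, i)) [0..<length us], replicate (length us) True) \<in> transitions (cube us)"
  unfolding cube_transitions using assms by (auto simp: distinct_map inj_on_def)

section \<open>Transport of finite systems into the universe\<close>

definition relabel_states :: "('s, 'a, 'x) wts \<Rightarrow> 't set \<Rightarrow> ('t \<Rightarrow> 's) \<Rightarrow> ('t, 'a, 'x) wts" where
  "relabel_states X S f = \<lparr> states = S, acts = acts X, lab = lab X,
     transitions = {(\<alpha>, us, \<beta>). \<alpha> \<in> S \<and> \<beta> \<in> S \<and> (f \<alpha>, us, f \<beta>) \<in> transitions X} \<rparr>"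

lemma relabel_states_simps [simp]:
  "states (relabel_states X S f) = S" "acts (relabel_states X S f) = acts X" "lab (relabel_states X S f) = lab X"
  "(\<alpha>, us, \<beta>) \<in> transitions (relabel_states X S f) \<longleftrightarrow> \<alpha> \<in> S \<and> \<beta> \<in> S \<and> (f \<alpha>, us, f \<beta>) \<in> transitions X"
  by (auto simp: relabel_states_def)

lemma cub_or_reg_relabel_states:
  assumes X: "cub_or_reg r X" and f: "bij_betw f S (states X)"
  shows "cub_or_reg r (relabel_states X S f)"
proof (rule cub_or_regI)
  note WX = cub_or_regD(1)[OF X]
  show "weak_ts (relabel_states X S f)"
  proof (rule weak_tsI)
    fix \<alpha> us \<beta> assume t: "(\<alpha>, us, \<beta>) \<in> transitions (relabel_states X S f)"
    then show "\<alpha> \<in> states (relabel_states X S f) \<and> \<beta> \<in> states (relabel_states X S f) \<and> us \<noteq> [] \<and>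
        set us \<subseteq> acts (relabel_states X S f)"
      using weak_tsD(3,4)[OF WX, of "f \<alpha>" us "f \<beta>"] by simp
    fix vs assume m: "mset vs = mset us"
    show "(\<alpha>, vs, \<beta>) \<in> transitions (relabel_states X S f)"
      using t transition_mset_cong[OF WX _ m, of "f \<alpha>" "f \<beta>"] by simp
  next
    fix \<alpha> us vs ws \<beta> \<nu>1 \<nu>2
    assume a: "us \<noteq> []" "vs \<noteq> []" "ws \<noteq> []" "(\<alpha>, us @ vs @ ws, \<beta>) \<in> transitions (relabel_states X S f)"
      "(\<alpha>, us, \<nu>1) \<in> transitions (relabel_states X S f)" "(\<nu>1, vs @ ws, \<beta>) \<in> transitions (relabel_states X S f)"
      "(\<alpha>, us @ vs, \<nu>2) \<in> transitions (relabel_states X S f)" "(\<nu>2, ws, \<beta>) \<in> transitions (relabel_states X S f)"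
    then show "(\<nu>1, vs, \<nu>2) \<in> transitions (relabel_states X S f)"
      using weak_ts_compose[OF WX a(1-3), of "f \<alpha>" "f \<beta>" "f \<nu>1" "f \<nu>2"] by simp
  qed (use WX in \<open>simp add: weak_ts_def\<close>)
  have lift: "\<exists>a \<in> S. f a = s" if "s \<in> states X" for s using bij_betw_imp_surj_on[OF f] that by (metis imageE)
  fix u assume "u \<in> acts (relabel_states X S f)"
  then have "u \<in> acts X" by simp
  then obtain \<alpha> \<beta> where "(\<alpha>, [u], \<beta>) \<in> transitions X" using cub_or_regD(3)[OF X] by blast
  then show "\<exists>\<alpha> \<beta>. (\<alpha>, [u], \<beta>) \<in> transitions (relabel_states X S f)"
    using lift weak_tsD(1,2)[OF WX] unfolding relabel_states_simps by metis
next
  note WX = cub_or_regD(1)[OF X]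
  have lift: "\<exists>a \<in> S. f a = s" if "s \<in> states X" for s using bij_betw_imp_surj_on[OF f] that by (metis imageE)
  fix \<alpha> us vs \<beta> assume a: "us \<noteq> []" "vs \<noteq> []" "(\<alpha>, us @ vs, \<beta>) \<in> transitions (relabel_states X S f)"
  then obtain \<nu> where n: "(f \<alpha>, us, \<nu>) \<in> transitions X" "(\<nu>, vs, f \<beta>) \<in> transitions X"
    using cub_or_regD(4)[OF X a(1,2), of "f \<alpha>" "f \<beta>"] by auto
  obtain \<nu>' where "\<nu>' \<in> S" "f \<nu>' = \<nu>" using lift weak_tsD(2)[OF WX n(1)] by blast
  then show "\<exists>\<nu>. (\<alpha>, us, \<nu>) \<in> transitions (relabel_states X S f) \<and> (\<nu>, vs, \<beta>) \<in> transitions (relabel_states X S f)"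
    using n a(3) by (intro exI[of _ \<nu>']) simp
next
  fix \<alpha> us vs \<beta> \<nu> \<nu>'
  assume a: r "us \<noteq> []" "vs \<noteq> []" "(\<alpha>, us @ vs, \<beta>) \<in> transitions (relabel_states X S f)"
    "(\<alpha>, us, \<nu>) \<in> transitions (relabel_states X S f)" "(\<nu>, vs, \<beta>) \<in> transitions (relabel_states X S f)"
    "(\<alpha>, us, \<nu>') \<in> transitions (relabel_states X S f)" "(\<nu>', vs, \<beta>) \<in> transitions (relabel_states X S f)"
  then have "f \<nu> = f \<nu>'"
    using cub_or_regD(5)[OF X a(1-3), of "f \<alpha>" "f \<beta>" "f \<nu>" "f \<nu>'"] by simp
  moreover have "\<nu> \<in> S" "\<nu>' \<in> S" using a(5,7) by simp_all
  ultimately show "\<nu> = \<nu>'" using f unfolding bij_betw_def by (metis inj_onD)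
qed

lemma lifts_iso:
  assumes A: "weak_ts A" and B: "weak_ts B"
    and i: "i \<in> ts_isos A A'" and j: "j \<in> ts_isos B B'" and e: "ts_comp A k i = ts_comp A j h"
    and l: "lifts A' B' E F (fst k) (snd k) ps pa" and h: "is_map A B (fst h) (snd h)"
  shows "lifts A B E F (fst h) (snd h) ps pa"
  unfolding lifts_def
proof (intro allI impI, elim conjE)
  fix us ua vs va
  assume u: "is_map A E us ua" and v: "is_map B F vs va"
    and e1: "\<forall>a \<in> states A. ps (us a) = vs (fst h a)" and e2: "\<forall>u \<in> acts A. pa (ua u) = va (snd h u)"
  obtain i' where i': "i \<in> ts_maps A A'" "i' \<in> ts_maps A' A" "ts_comp A i' i = ts_id A" "ts_comp A' i i' = ts_id A'"
    using i unfolding ts_isos_def by blast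
  obtain j' where j': "j \<in> ts_maps B B'" "j' \<in> ts_maps B' B" "ts_comp B j' j = ts_id B" "ts_comp B' j j' = ts_id B'"
    using j unfolding ts_isos_def by blast
  have ii: "fst i (fst i' a) = a" if "a \<in> states A'" for a
    using i'(4) that by (simp add: ts_comp_rst ts_id_rst rst_eq_iff)
  have iia: "snd i (snd i' a) = a" if "a \<in> acts A'" for a
    using i'(4) that by (simp add: ts_comp_rst ts_id_rst rst_eq_iff)
  have i'i: "fst i' (fst i a) = a" if "a \<in> states A" for a
    using i'(3) that by (simp add: ts_comp_rst ts_id_rst rst_eq_iff)
  have i'ia: "snd i' (snd i a) = a" if "a \<in> acts A" for a
    using i'(3) that by (simp add: ts_comp_rst ts_id_rst rst_eq_iff)
  have jj: "fst j' (fst j a) = a" if "a \<in> states B" for a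
    using j'(3) that by (simp add: ts_comp_rst ts_id_rst rst_eq_iff)
  have jja: "snd j' (snd j a) = a" if "a \<in> acts B" for a
    using j'(3) that by (simp add: ts_comp_rst ts_id_rst rst_eq_iff)
  have k: "fst k (fst i a) = fst j (fst h a)" if "a \<in> states A" for a
    using e that unfolding ts_comp_eq_iff by blast
  have ka: "snd k (snd i a) = snd j (snd h a)" if "a \<in> acts A" for a
    using e that unfolding ts_comp_eq_iff by blast
  note im = ts_mapsD[OF i'(1)] and i'm = ts_mapsD[OF i'(2)] and jm = ts_mapsD[OF j'(1)] and j'm = ts_mapsD[OF j'(2)]
  have 1: "ps (us (fst i' a)) = vs (fst j' (fst k a))" if a: "a \<in> states A'" for a
  proof -
    have "fst k a = fst j (fst h (fst i' a))"
      using k[OF is_mapD(1)[OF i'm a]] ii[OF a] by simp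
    then show ?thesis using e1 jj is_mapD(1)[OF i'm a] is_mapD(1)[OF h] by simp
  qed
  have 2: "pa (ua (snd i' a)) = va (snd j' (snd k a))" if a: "a \<in> acts A'" for a
  proof -
    have "snd k a = snd j (snd h (snd i' a))"
      using ka[OF is_mapD(2)[OF i'm a]] iia[OF a] by simp
    then show ?thesis using e2 jja is_mapD(2)[OF i'm a] is_mapD(2)[OF h] by simp
  qed
  obtain ls la where l: "is_map B' E ls la"
    "\<forall>a \<in> states A'. ls (fst k a) = us (fst i' a)" "\<forall>a \<in> acts A'. la (snd k a) = ua (snd i' a)"
    "\<forall>b \<in> states B'. ps (ls b) = vs (fst j' b)" "\<forall>b \<in> acts B'. pa (la b) = va (snd j' b)"
    using l[unfolded lifts_def, rule_format, of "\<lambda>a. us (fst i' a)" "\<lambda>a. ua (snd i' a)"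
        "\<lambda>b. vs (fst j' b)" "\<lambda>b. va (snd j' b)"] is_map_comp[OF i'm u] is_map_comp[OF j'm v] 1 2 by blast
  have "is_map B E (\<lambda>b. ls (fst j b)) (\<lambda>b. la (snd j b))" by (rule is_map_comp[OF jm l(1)])
  moreover have "ls (fst j (fst h a)) = us a" if a: "a \<in> states A" for a
    using l(2) k[OF a] i'i[OF a] is_mapD(1)[OF im a] by metis
  moreover have "la (snd j (snd h a)) = ua a" if a: "a \<in> acts A" for a
    using l(3) ka[OF a] i'ia[OF a] is_mapD(2)[OF im a] by metis
  moreover have "ps (ls (fst j b)) = vs b" if b: "b \<in> states B" for b
    using l(4) jj[OF b] is_mapD(1)[OF jm b] by metis
  moreover have "pa (la (snd j b)) = va b" if b: "b \<in> acts B" for b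
    using l(5) jja[OF b] is_mapD(2)[OF jm b] by metis
  ultimately show "\<exists>ls la. is_map B E ls la \<and>
           (\<forall>a \<in> states A. ls (fst h a) = us a) \<and> (\<forall>u \<in> acts A. la (snd h u) = ua u) \<and>
           (\<forall>b \<in> states B. ps (ls b) = vs b) \<and> (\<forall>u \<in> acts B. pa (la u) = va u)"
    by blast
qed

context ts_universe
begin

text \<open>A finite system over any types is transported along bijections between its carriers and
  finite subsets of the infinite type \<open>'u\<close>.\<close>

lemma copy_exists:
  fixes A :: "('s, 'a, 'x) wts"
  assumes A: "cub_or_reg r A" and fin: "finite (states A)" "finite (acts A)"
  shows "\<exists>X \<in> Obs. \<exists>i. i \<in> ts_isos A X"
proof -
  obtain S :: "'u set" where S: "card S = card (states A)" "finite S"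
    using infinite_arbitrarily_large[OF infinite_univ] by blast
  obtain M :: "'u set" where M: "card M = card (acts A)" "finite M"
    using infinite_arbitrarily_large[OF infinite_univ] by blast
  obtain f where f: "bij_betw f S (states A)"
    using finite_same_card_bij[OF S(2) fin(1)] S(1) by blast
  obtain g where g: "bij_betw g M (acts A)"
    using finite_same_card_bij[OF M(2) fin(2)] M(1) by blast
  define X where "X = pullback_acts (relabel_states A S f) M g"
  have "cub_or_reg r X" unfolding X_def
    using g by (intro cub_or_reg_pullback_acts cub_or_reg_relabel_states A f) (simp add: bij_betw_def)
  then have X: "X \<in> Obs" using S(2) M(2) by (intro ObsI) (simp_all add: X_def small_finite)
  note WA = cub_or_regD(1)[OF A] and WX = ObsD(1)[OF X]
  define f' where "f' = inv_into S f"
  define g' where "g' = inv_into M g"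
  have f': "f (f' a) = a" "f' a \<in> S" if "a \<in> states A" for a
    using f that unfolding f'_def bij_betw_def by (auto simp: f_inv_into_f inv_into_into)
  have g': "g (g' a) = a" "g' a \<in> M" if "a \<in> acts A" for a
    using g that unfolding g'_def bij_betw_def by (auto simp: f_inv_into_f inv_into_into)
  have f'f: "f' (f a) = a" if "a \<in> S" for a using f that unfolding f'_def by (rule bij_betw_inv_into_left)
  have g'g: "g' (g a) = a" if "a \<in> M" for a using g that unfolding g'_def by (rule bij_betw_inv_into_left)
  have bck: "is_map X A f g"
    by (rule is_mapI) (use f g in \<open>auto simp: X_def bij_betw_def\<close>)
  have forth: "is_map A X f' g'"
  proof (rule is_mapI)
    fix \<alpha> us \<beta> assume t: "(\<alpha>, us, \<beta>) \<in> transitions A"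
    note d = weak_tsD[OF WA t]
    have "map g (map g' us) = us" using d(4) g'(1) by (auto intro!: map_idI)
    moreover have "set (map g' us) \<subseteq> M" using d(4) g'(2) by auto
    ultimately show "(f' \<alpha>, map g' us, f' \<beta>) \<in> transitions X"
      unfolding X_def pullback_acts_simps relabel_states_simps using f' d(1,2) t by metis
  qed (use f' g' in \<open>simp_all add: X_def\<close>)
  have "rst A f' g' \<in> ts_isos A X"
    unfolding ts_isos_def
  proof (intro CollectI conjI bexI[of _ "rst X f g"])
    show "rst A f' g' \<in> ts_maps A X" "rst X f g \<in> ts_maps X A"
      using forth bck by (simp_all add: rst_ts_maps WA WX)
    show "ts_comp A (rst X f g) (rst A f' g') = ts_id A"
      using f' g' by (simp add: ts_comp_rst ts_id_rst rst_eq_iff X_def)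
    show "ts_comp X (rst A f' g') (rst X f g) = ts_id X"
      using f'f g'g is_mapD(1,2)[OF bck] by (simp add: ts_comp_rst ts_id_rst rst_eq_iff X_def)
  qed
  then show ?thesis using X by blast
qed

text \<open>A generator enters the category only through its isomorphic copies. Choosing one copy
  and conjugating by the isomorphisms turns lifting against copies into lifting against the
  generator itself.\<close>

lemma rlp_copies_lifts:
  fixes A :: "('s, 'a, 'x) wts" and B :: "('t, 'b, 'x) wts"
  assumes p: "(E, p, F) \<in> rlp K M" and sub: "copies A h B \<subseteq> M"
    and A: "cub_or_reg r A" "finite (states A)" "finite (acts A)"
    and B: "cub_or_reg r B" "finite (states B)" "finite (acts B)" and h: "is_map A B (fst h) (snd h)"
  shows "lifts A B E F (fst h) (snd h) (fst p) (snd p)"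
proof -
  obtain A' i where i: "A' \<in> Obs" "i \<in> ts_isos A A'" using copy_exists[OF A] by blast
  obtain B' j where j: "B' \<in> Obs" "j \<in> ts_isos B B'" using copy_exists[OF B] by blast
  obtain i' where i': "i \<in> ts_maps A A'" "i' \<in> ts_maps A' A" "ts_comp A i' i = ts_id A"
    using i(2) unfolding ts_isos_def by blast
  have jm: "j \<in> ts_maps B B'" using j(2) unfolding ts_isos_def by blast
  define k where "k = rst A' (\<lambda>a. fst j (fst h (fst i' a))) (\<lambda>a. snd j (snd h (snd i' a)))"
  have km: "k \<in> ts_maps A' B'"
    unfolding k_def rst_ts_maps[OF ObsD(1)[OF i(1)]]
    by (rule is_map_comp[OF is_map_comp[OF ts_mapsD[OF i'(2)] h] ts_mapsD[OF jm]])
  have i'i: "fst i' (fst i a) = a" if "a \<in> states A" for a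
    using i'(3) that by (simp add: ts_comp_rst ts_id_rst rst_eq_iff)
  have i'ia: "snd i' (snd i a) = a" if "a \<in> acts A" for a
    using i'(3) that by (simp add: ts_comp_rst ts_id_rst rst_eq_iff)
  have e: "ts_comp A k i = ts_comp A j h"
    unfolding ts_comp_eq_iff k_def using i'i i'ia is_mapD(1,2)[OF ts_mapsD[OF i'(1)]] by simp
  have "(A', k, B') \<in> arr WTS"
    using i(1) j(1) km unfolding WTS_def by (simp add: ts_objs_def)
  then have "(A', k, B') \<in> copies A h B" unfolding copies_def using i(2) j(2) e by blast
  then have "has_lifting K (A', k, B') (E, p, F)" using p sub unfolding rlp_def by blast
  moreover have "(A', k, B') \<in> arr K" "(E, p, F) \<in> arr K"
    using i(1) j(1) km p unfolding rlp_def by simp_all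
  ultimately have "lifts A' B' E F (fst k) (snd k) (fst p) (snd p)" by (simp add: has_lifting_lifts)
  then show ?thesis
    by (rule lifts_iso[OF cub_or_regD(1)[OF A(1)] cub_or_regD(1)[OF B(1)] i(2) j(2) e _ h])
qed

lemma inj_acts_copies:
  assumes "(X, k, Y) \<in> copies A h B" "inj_on (snd h) (acts A)" "is_map A B (fst h) (snd h)"
  shows "inj_on (snd k) (acts X)"
proof -
  obtain i j where i: "i \<in> ts_isos A X" and j: "j \<in> ts_isos B Y" and e: "ts_comp A k i = ts_comp A j h"
    using assms(1) unfolding copies_def by blast
  obtain i' where i': "i' \<in> ts_maps X A" "ts_comp X i i' = ts_id X" using i unfolding ts_isos_def by blast
  obtain j' where j': "ts_comp B j' j = ts_id B" using j unfolding ts_isos_def by blast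
  have ii: "snd i (snd i' a) = a" if "a \<in> acts X" for a
    using i'(2) that by (simp add: ts_comp_rst ts_id_rst rst_eq_iff)
  have jj: "snd j' (snd j a) = a" if "a \<in> acts B" for a
    using j' that by (simp add: ts_comp_rst ts_id_rst rst_eq_iff)
  have i'm: "snd i' a \<in> acts A" if "a \<in> acts X" for a using is_mapD(2)[OF ts_mapsD[OF i'(1)] that] .
  have k: "snd k a = snd j (snd h (snd i' a))" if a: "a \<in> acts X" for a
    using e ii[OF a] i'm[OF a] unfolding ts_comp_eq_iff by metis
  have *: "snd h (snd i' a) = snd j' (snd k a)" if "a \<in> acts X" for a
    using k[OF that] jj is_mapD(2)[OF assms(3) i'm[OF that]] by simp
  show ?thesis
  proof (rule inj_onI)
    fix a b assume ab: "a \<in> acts X" "b \<in> acts X" "snd k a = snd k b"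
    then have "snd h (snd i' a) = snd h (snd i' b)" using *[OF ab(1)] *[OF ab(2)] by simp
    then have "snd i' a = snd i' b" by (rule inj_onD[OF assms(2) _ i'm[OF ab(1)] i'm[OF ab(2)]])
    then have "snd i (snd i' a) = snd i (snd i' b)" by (rule arg_cong)
    then show "a = b" unfolding ii[OF ab(1)] ii[OF ab(2)] .
  qed
qed

section \<open>Identification of the trivial fibrations\<close>

abbreviation gens :: "('u, 'x) ts_arrow set" where
  "gens \<equiv> gen_cofs"

lemma gen_cofs_inj_acts:
  assumes "(X, k, Y) \<in> gens"
  shows "inj_on (snd k) (acts X)"
  using assms unfolding gen_cofs_def
proof (elim UnE UN_E)
  assume "(X, k, Y) \<in> copies (discrete_ts {} :: (nat, nat, 'x) wts) (ts_id (discrete_ts {} :: (nat, nat, 'x) wts))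
            (discrete_ts {0} :: (nat, nat, 'x) wts)"
  then show ?thesis by (rule inj_acts_copies) (simp_all add: is_map_def)
next
  assume "(X, k, Y) \<in> copies (discrete_ts {0, 1} :: (nat, nat, 'x) wts) (\<lambda>e \<in> {0, 1}. 0, \<lambda>_. undefined)
            (discrete_ts {0} :: (nat, nat, 'x) wts)"
  then show ?thesis by (rule inj_acts_copies) (simp_all add: is_map_def)
next
  fix xs :: "'x list"
  assume xs: "xs \<in> {xs. 1 \<le> length xs}" and "(X, k, Y) \<in> copies (cube_boundary xs) (ts_id (cube_boundary xs)) (cube xs)"
  from this(2) show ?thesis
    by (rule inj_acts_copies) (use xs is_map_boundary[of xs] in \<open>simp_all add: ts_id_rst inj_on_def\<close>)
next
  fix x :: 'x
  assume "(X, k, Y) \<in> copies (cube [x])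
             (\<lambda>e \<in> states (cube [x]). if e = [False] then 1 else 2, \<lambda>u \<in> acts (cube [x]). x)
             (double_transition x)"
  then show ?thesis by (rule inj_acts_copies[OF _ _ is_map_cube_double]) (simp add: inj_on_def)
qed

lemma nice_rlp: "nice_arrs \<subseteq> rlp K gens"
proof
  fix p assume p: "p \<in> nice_arrs"
  then have pa: "p \<in> arr K" using nice_arrs_arr by blast
  have "has_lifting K i p" if i: "i \<in> gens" for i
  proof (cases "i \<in> arr K")
    case True
    obtain X k Y where i': "i = (X, k, Y)" by (cases i)
    have "i \<in> llp K nice_arrs" using inj_acts_llp gen_cofs_inj_acts True i unfolding i' by blast
    then show ?thesis using p unfolding llp_def by blast
  next
    case False
    obtain X k Y where i': "i = (X, k, Y)" by (cases i)
    have "(X, k, Y) \<in> arr WTS" using i unfolding i' gen_cofs_def copies_def by blast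
    \<comment> \<open>An arrow with an end outside the category admits no lifting problems, so the
      property holds vacuously.\<close>
    then have "X \<notin> Obs \<or> Y \<notin> Obs" using False unfolding i' WTS_def by (simp add: ts_objs_def)
    then show ?thesis unfolding has_lifting_def i' by (auto simp: ts_homs)
  qed
  then show "p \<in> rlp K gens" using pa unfolding rlp_def by blast
qed

text \<open>Each generator tests one clause of \<open>nice\<close>. The inclusion of the empty set
  gives surjectivity on states, the folding of two points injectivity, the boundary of a 1-cube
  surjectivity on actions, the double transition reflection of 1-transitions, and the boundaries of
  higher cubes reflection of longer transitions.\<close>

lemma rlp_nice: "rlp K gens \<subseteq> nice_arrs"
proof
  fix q assume q': "q \<in> rlp K gens"
  obtain E p F where q_eq: "q = (E, p, F)" by (cases q)
  note q = q'[unfolded q_eq]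
  have arr: "(E, p, F) \<in> arr K" using q unfolding rlp_def by blast
  then have E: "E \<in> Obs" and F: "F \<in> Obs" and pm: "is_map E F (fst p) (snd p)" by (simp_all add: ts_mapsD)
  note WE = ObsD(1)[OF E] and WF = ObsD(1)[OF F]
  let ?d0 = "discrete_ts {} :: (nat, nat, 'x) wts" and ?d1 = "discrete_ts {0} :: (nat, nat, 'x) wts"
    and ?d2 = "discrete_ts {0, 1} :: (nat, nat, 'x) wts"
  have l1: "lifts ?d0 ?d1 E F (fst (ts_id ?d0)) (snd (ts_id ?d0)) (fst p) (snd p)"
    by (rule rlp_copies_lifts[OF q]) (auto simp: gen_cofs_def cub_or_reg_discrete is_map_def)
  let ?c = "(\<lambda>e \<in> {0 :: nat, 1}. 0 :: nat, \<lambda>_ :: nat. undefined :: nat)"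
  have l2: "lifts ?d2 ?d1 E F (fst ?c) (snd ?c) (fst p) (snd p)"
    by (rule rlp_copies_lifts[OF q]) (auto simp: gen_cofs_def cub_or_reg_discrete is_map_def)
  have l3: "lifts (cube_boundary xs) (cube xs) E F (fst (ts_id (cube_boundary xs))) (snd (ts_id (cube_boundary xs))) (fst p) (snd p)"
    if xs: "length xs \<ge> 1" for xs
  proof (rule rlp_copies_lifts[OF q])
    show "copies (cube_boundary xs) (ts_id (cube_boundary xs)) (cube xs) \<subseteq> gens"
      using xs unfolding gen_cofs_def by blast
    show "finite (states (cube_boundary xs))"
      unfolding cube_boundary_sub(1) by (rule finite_cube(1))
    show "finite (acts (cube_boundary xs))"
      by (rule finite_subset[OF cube_boundary_sub(2) finite_cube(2)])
  qed (use xs finite_cube in \<open>simp_all add: cub_or_reg_cube cub_or_reg_cube_boundary is_map_boundary\<close>)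
  have l4: "lifts (cube [x]) (double_transition x) E F
    (fst (\<lambda>e \<in> states (cube [x]). if e = [False] then 1 else (2 :: nat), \<lambda>u \<in> acts (cube [x]). x))
    (snd (\<lambda>e \<in> states (cube [x]). if e = [False] then 1 else (2 :: nat), \<lambda>u \<in> acts (cube [x]). x)) (fst p) (snd p)" for x
  proof (rule rlp_copies_lifts[OF q])
    show "copies (cube [x]) (\<lambda>e \<in> states (cube [x]). if e = [False] then 1 else 2, \<lambda>u \<in> acts (cube [x]). x)
      (double_transition x) \<subseteq> gens"
      unfolding gen_cofs_def by blast
    show "finite (states (double_transition x))" "finite (acts (double_transition x))"
      by (simp_all add: double_transition_def)
  qed (rule cub_or_reg_cube finite_cube cub_or_reg_double_transition is_map_cube_double)+
  have surj: "\<exists>a \<in> states E. fst p a = b" if b: "b \<in> states F" for b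
  proof -
    have "is_map ?d1 F (\<lambda>_. b) undefined" using b by (simp add: is_map_def)
    moreover have "is_map ?d0 E undefined undefined" by (simp add: is_map_def)
    ultimately obtain ls la where "is_map ?d1 E ls la" "fst p (ls 0) = b"
      using l1[unfolded lifts_def, rule_format, of undefined undefined "\<lambda>_. b" undefined] by auto
    then show ?thesis using is_mapD(1)[of ?d1 E ls la 0] by auto
  qed
  have inj: "inj_on (fst p) (states E)"
  proof (rule inj_onI)
    fix a b assume ab: "a \<in> states E" "b \<in> states E" "fst p a = fst p b"
    have "is_map ?d2 E (\<lambda>n. if n = 0 then a else b) undefined" using ab by (simp add: is_map_def)
    moreover have "is_map ?d1 F (\<lambda>_. fst p a) undefined" using is_mapD(1)[OF pm ab(1)] by (simp add: is_map_def)
    ultimately obtain ls :: "nat \<Rightarrow> 'u" where "ls 0 = a" "ls 0 = b"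
      using l2[unfolded lifts_def, rule_format, of "\<lambda>n. if n = 0 then a else b" undefined "\<lambda>_. fst p a" undefined] ab by auto
    then show "a = b" by simp
  qed
  have bij: "bij_betw (fst p) (states E) (states F)"
    using inj surj is_mapD(1)[OF pm] by (auto simp: bij_betw_def)
  define s where "s = inv_into (states E) (fst p)"
  have s: "s b \<in> states E" "fst p (s b) = b" if "b \<in> states F" for b
    using bij that unfolding s_def bij_betw_def by (auto simp: inv_into_into f_inv_into_f)
  have sp: "s (fst p a) = a" if "a \<in> states E" for a
    using bij that unfolding s_def by (rule bij_betw_inv_into_left)
  have acts: "\<exists>w \<in> acts E. snd p w = v" if v: "v \<in> acts F" for v
  proof -
    obtain \<beta> \<beta>' where t: "(\<beta>, [v], \<beta>') \<in> transitions F" using cub_or_regD(3)[OF ObsD(2)[OF F] v] by blast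
    let ?x = "lab F v"
    \<comment> \<open>The boundary of a 1-cube carries no action, so a lift of the edge in
      \<open>F\<close> produces an action over \<open>v\<close>.\<close>
    have bd: "cube_boundary [?x] = discrete_ts (states (cube [?x]))" by (simp add: cube_boundary_def)
    have m: "is_map (cube [?x]) F (\<lambda>e. if e = [False] then \<beta> else \<beta>') (\<lambda>_. v)"
      by (rule is_mapI) (use t weak_tsD[OF WF t] in \<open>auto simp: cube1_transitions\<close>)
    have m': "is_map (cube_boundary [?x]) E (\<lambda>e. s (if e = [False] then \<beta> else \<beta>')) undefined"
      unfolding bd by (rule is_mapI) (use s weak_tsD[OF WF t] in auto)
    obtain ls la where l: "is_map (cube [?x]) E ls la" "\<forall>u \<in> acts (cube [?x]). snd p (la u) = v"
      using l3[of "[?x]", unfolded lifts_def, rule_format, OF _ conjI[OF m' conjI[OF m]]] s weak_tsD(1,2)[OF WF t]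
      by (auto simp: bd ts_id_rst)
    have "(?x, 0) \<in> acts (cube [?x])" by simp
    then show ?thesis using l is_mapD(2)[OF l(1)] by blast
  qed
  \<comment> \<open>Induction on the length, since the boundary of a cube contains only transitions
    shorter than its dimension.\<close>
  have tr: "\<forall>\<alpha> \<beta>. length us = n \<longrightarrow> \<alpha> \<in> states E \<longrightarrow> \<beta> \<in> states E \<longrightarrow> set us \<subseteq> acts E \<longrightarrow>
      (fst p \<alpha>, map (snd p) us, fst p \<beta>) \<in> transitions F \<longrightarrow> (\<alpha>, us, \<beta>) \<in> transitions E" for n us
  proof (induction n arbitrary: us rule: less_induct)
    case (less n)
    show ?case
    proof (intro allI impI)
      fix \<alpha> \<beta> assume n: "length us = n" and a: "\<alpha> \<in> states E" "\<beta> \<in> states E" and us: "set us \<subseteq> acts E"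
        and t: "(fst p \<alpha>, map (snd p) us, fst p \<beta>) \<in> transitions F"
      have ne: "us \<noteq> []" using weak_tsD(3)[OF WF t] by simp
      show "(\<alpha>, us, \<beta>) \<in> transitions E"
      proof (cases "length us = 1")
        case True
        then obtain u where u: "us = [u]" by (auto simp: length_Suc_conv)
        let ?x = "lab E u"
        have uE: "u \<in> acts E" using us u by simp
        obtain \<gamma> \<delta> where g: "(\<gamma>, [u], \<delta>) \<in> transitions E" using cub_or_regD(3)[OF ObsD(2)[OF E] uE] by blast
        note dg = weak_tsD[OF WE g]
        have m: "is_map (cube [?x]) E (\<lambda>e. if e = [False] then \<gamma> else \<delta>) (\<lambda>_. u)"
          by (rule is_mapI) (use g dg uE in \<open>auto simp: cube1_transitions\<close>)
        \<comment> \<open>The transition from \<open>1\<close> to \<open>2\<close> carries an edge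
          of \<open>u\<close> already present in \<open>E\<close>, the one from \<open>3\<close> to
          \<open>4\<close> the edge to be reflected. Both have the same action, so a lift that
          extends the first must put \<open>u\<close> on the second.\<close>
        let ?v = "\<lambda>i :: nat. if i = 1 then fst p \<gamma> else if i = 2 then fst p \<delta> else if i = 3 then fst p \<alpha> else fst p \<beta>"
        have m': "is_map (double_transition ?x) F ?v (\<lambda>_. snd p u)"
          by (rule is_mapI)
            (use is_mapD(1)[OF pm] a dg is_mapD(2,3)[OF pm uE] t u is_mapD(4)[OF pm g] in \<open>auto simp: double_transition_def\<close>)
        let ?H = "(\<lambda>e \<in> states (cube [?x]). if e = [False] then 1 else (2 :: nat), \<lambda>u \<in> acts (cube [?x]). ?x)"
        have c1: "\<forall>a \<in> states (cube [?x]). fst p (if a = [False] then \<gamma> else \<delta>) = ?v (fst ?H a)"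
          by (simp add: cube1_states del: cube_simps)
        have c2: "\<forall>w \<in> acts (cube [?x]). snd p u = snd p u" by simp
        obtain ls la where l: "is_map (double_transition ?x) E ls la"
          "\<forall>w \<in> acts (cube [?x]). la (snd ?H w) = u" "\<forall>b \<in> states (double_transition ?x). fst p (ls b) = ?v b"
          using l4[of ?x, unfolded lifts_def, rule_format, OF conjI[OF m conjI[OF m' conjI[OF c1 c2]]]] by blast
        have "(?x, 0) \<in> acts (cube [?x])" by simp
        from bspec[OF l(2) this] have lx: "la ?x = u" by simp
        have st: "states (double_transition ?x) = {1, 2, 3, 4}" by (simp add: double_transition_def)
        have "ls 3 \<in> states E" "ls 4 \<in> states E" "fst p (ls 3) = fst p \<alpha>" "fst p (ls 4) = fst p \<beta>"
          using is_mapD(1)[OF l(1)] l(3) unfolding st by auto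
        then have "ls 3 = \<alpha>" "ls 4 = \<beta>" using inj a by (auto dest: inj_onD)
        moreover have "(3, [?x], 4) \<in> transitions (double_transition ?x)" by (simp add: double_transition_def)
        ultimately show ?thesis using is_mapD(4)[OF l(1), of 3 "[?x]" 4] lx u by simp
      next
        case False
        then have n2: "length us \<ge> 2" using ne by (cases us; cases "tl us") auto
        let ?xs = "map (lab E) us"
        have xs: "map (lab F) (map (snd p) us) = ?xs"
          using is_mapD(3)[OF pm] us by auto
        \<comment> \<open>The given transition is the longest one of a cube in \<open>F\<close>. The
          boundary of this cube lifts to \<open>E\<close> by the induction hypothesis, and a lift of
          the full cube returns the transition in \<open>E\<close>.\<close>
        obtain \<nu> where nu: "is_map (cube ?xs) F \<nu> (\<lambda>w. map (snd p) us ! snd w)"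
          "\<nu> (replicate n False) = fst p \<alpha>" "\<nu> (replicate n True) = fst p \<beta>"
          using cube_map_exists[OF ObsD(3)[OF F] t] unfolding xs using n by auto
        have len: "length ?xs \<ge> 1" using n2 by simp
        have bacts: "acts (cube_boundary ?xs) = acts (cube ?xs)" using n2 by (simp add: cube_boundary_def)
        have actsD: "us ! snd w \<in> acts E \<and> snd w < length us \<and> lab E (us ! snd w) = fst w" if "w \<in> acts (cube ?xs)" for w
          using that us nth_mem by auto
        have m: "is_map (cube_boundary ?xs) E (\<lambda>e. s (\<nu> e)) (\<lambda>w. us ! snd w)"
        proof (rule is_mapI)
          fix e assume "e \<in> states (cube_boundary ?xs)"
          then show "s (\<nu> e) \<in> states E" using s(1) is_mapD(1)[OF nu(1)] by (simp only: cube_boundary_sub)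
        next
          fix w assume w: "w \<in> acts (cube_boundary ?xs)"
          then have w': "w \<in> acts (cube ?xs)" unfolding bacts .
          show "us ! snd w \<in> acts E" using actsD[OF w'] by blast
          show "lab E (us ! snd w) = lab (cube_boundary ?xs) w"
            using actsD[OF w'] w' cube_boundary_sub(4)[OF w] by simp
        next
          fix e ws e' assume w: "(e, ws, e') \<in> transitions (cube_boundary ?xs)"
          have w': "(e, ws, e') \<in> transitions (cube ?xs)" using w cube_boundary_sub(3) by blast
          have lw: "length ws < n" using cube_boundary_sub(5)[OF w] n by simp
          have aw: "set ws \<subseteq> acts (cube ?xs)" using w' unfolding cube_transitions by blast
          have ee: "e \<in> states (cube ?xs)" "e' \<in> states (cube ?xs)" using w' unfolding cube_transitions by simp_all
          have nE: "\<nu> e \<in> states F" "\<nu> e' \<in> states F" using is_mapD(1)[OF nu(1)] ee by blast+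
          have "map (snd p) (map (\<lambda>w. us ! snd w) ws) = map (\<lambda>w. map (snd p) us ! snd w) ws"
            using aw actsD by auto
          then have "(fst p (s (\<nu> e)), map (snd p) (map (\<lambda>w. us ! snd w) ws), fst p (s (\<nu> e'))) \<in> transitions F"
            using is_mapD(4)[OF nu(1) w'] s(2) nE by metis
          moreover have "set (map (\<lambda>w. us ! snd w) ws) \<subseteq> acts E" using aw actsD by auto
          ultimately show "(s (\<nu> e), map (\<lambda>w. us ! snd w) ws, s (\<nu> e')) \<in> transitions E"
            using less.IH[OF lw, of "map (\<lambda>w. us ! snd w) ws"] s(1) nE by simp
        qed
        have e1: "\<forall>a \<in> states (cube_boundary ?xs). fst p (s (\<nu> a)) = \<nu> (fst (ts_id (cube_boundary ?xs)) a)"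
          using s(2) is_mapD(1)[OF nu(1)] by (simp add: ts_id_rst cube_boundary_sub(1) del: cube_simps)
        have e2: "\<forall>u \<in> acts (cube_boundary ?xs). snd p (us ! snd u) = map (snd p) us ! snd (snd (ts_id (cube_boundary ?xs)) u)"
          using actsD unfolding bacts[symmetric] by (simp add: ts_id_rst)
        obtain ls la where l: "is_map (cube ?xs) E ls la"
          "\<forall>a \<in> states (cube_boundary ?xs). ls (fst (ts_id (cube_boundary ?xs)) a) = s (\<nu> a)"
          "\<forall>u \<in> acts (cube_boundary ?xs). la (snd (ts_id (cube_boundary ?xs)) u) = us ! snd u"
          using l3[OF len, unfolded lifts_def, rule_format, OF conjI[OF m conjI[OF nu(1) conjI[OF e1 e2]]]] by blast
        have ls: "ls e = s (\<nu> e)" if "e \<in> states (cube ?xs)" for e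
          using l(2) that by (simp add: ts_id_rst cube_boundary_sub(1) del: cube_simps)
        have la: "la w = us ! snd w" if "w \<in> acts (cube ?xs)" for w
          using l(3) that unfolding bacts[symmetric] by (simp add: ts_id_rst)
        define top where "top = map (\<lambda>i. (?xs ! i, i)) [0..<n]"
        have topT: "(replicate n False, top, replicate n True) \<in> transitions (cube ?xs)"
          unfolding cube_transitions using n n2 by (auto simp: top_def distinct_map inj_on_def)
        have "map la top = us"
        proof (rule nth_equalityI)
          show "length (map la top) = length us" by (simp add: top_def n)
          fix i assume "i < length (map la top)"
          then have "i < length us" by (simp add: top_def n)
          moreover from this have "(?xs ! i, i) \<in> acts (cube ?xs)" by auto
          ultimately show "map la top ! i = us ! i" using la by (simp add: top_def n)
        qed
        moreover have "ls (replicate n False) = \<alpha>" "ls (replicate n True) = \<beta>"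
          using ls nu(2,3) sp a n by simp_all
        ultimately show ?thesis using is_mapD(4)[OF l(1) topT] by simp
      qed
    qed
  qed
  have sa: "snd p ` acts E = acts F" using acts is_mapD(2)[OF pm] by blast
  have "nice E F (fst p) (snd p)" unfolding nice_def using pm bij sa tr by blast
  then show "q \<in> nice_arrs" unfolding q_eq nice_arrs_iff using arr by blast
qed

lemma rlp_gens: "rlp K gens = nice_arrs"
  using nice_rlp rlp_nice by blast

lemma ts_cofs_eq: "ts_cofs K = llp K nice_arrs"
  unfolding ts_cofs_def cof_def rlp_gens ..

section \<open>Cubification\<close>

lemma has_lifting_not_arr:
  assumes "(X, k, Y) \<in> arr WTS" "(X, k, Y) \<notin> arr K"
  shows "has_lifting K (X, k, Y) p"
proof -
  have "X \<notin> Obs \<or> Y \<notin> Obs" using assms unfolding WTS_def by (simp add: ts_objs_def)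
  then show ?thesis unfolding has_lifting_def by (auto simp: ts_homs)
qed

lemma gens_WTS: "gens \<subseteq> arr WTS"
  unfolding gen_cofs_def copies_def by blast

text \<open>Generators outside the category impose no condition, so \<open>gens\<close> may be cut
  down to arrows of \<open>K\<close>; a class given by right lifting against arrows of
  \<open>K\<close> is closed under retracts.\<close>

lemma retract_closed_nice: "retract_closed K nice_arrs"
proof -
  have "rlp K gens = rlp K (gens \<inter> arr K)"
  proof
    show "rlp K gens \<subseteq> rlp K (gens \<inter> arr K)" unfolding rlp_def by blast
    show "rlp K (gens \<inter> arr K) \<subseteq> rlp K gens"
    proof
      fix p assume p: "p \<in> rlp K (gens \<inter> arr K)"
      have "has_lifting K i p" if i: "i \<in> gens" for i
      proof (cases "i \<in> arr K")
        case True
        then show ?thesis using p i unfolding rlp_def by blast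
      next
        case False
        obtain X k Y where i': "i = (X, k, Y)" by (cases i)
        show ?thesis using has_lifting_not_arr subsetD[OF gens_WTS i] False unfolding i' by blast
      qed
      then show "p \<in> rlp K gens" using p unfolding rlp_def by blast
    qed
  qed
  then show ?thesis using ts.retract_closed_rlp[of "gens \<inter> arr K"] unfolding rlp_gens by simp
qed

section \<open>The model structure with weak equivalences \<open>W\<close>\<close>

sublocale loc: localization K "llp K nice_arrs" nice_arrs W
proof
  show "llp K nice_arrs = llp K nice_arrs" ..
  show "nice_arrs \<subseteq> arr K" by (rule nice_arrs_arr)
  show "retract_closed K nice_arrs" by (rule retract_closed_nice)
  show "W \<subseteq> arr K" by (rule ts.orth_arr)
  show "two_out_of_three K W" by (rule ts.two_out_of_three_orth)
  show "retract_closed K W" by (rule ts.retract_closed_orth)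
  show "nice_arrs \<subseteq> W" by (rule nice_W)
qed (rule cofibration_factorization, assumption, rule orth_factorization, assumption)

lemma ts_weqs_W: "ts_weqs K \<subseteq> W"
proof -
  have "grothendieck_localizer K (small_ordinals :: 'u rel set) (ts_cofs K) W"
    unfolding ts_cofs_eq by (rule loc.localizer) (auto simp: small_ordinals_def)
  then show ?thesis unfolding ts_weqs_def least_localizer_def by blast
qed

lemma nice_ts_weqs: "nice_arrs \<subseteq> ts_weqs K"
proof -
  have "nice_arrs \<subseteq> rlp K (ts_cofs K)"
    unfolding ts_cofs_eq rlp_def llp_def using nice_arrs_arr by blast
  then show ?thesis
    unfolding ts_weqs_def least_localizer_def grothendieck_localizer_def by blast
qed

section \<open>Cocones of cubes\<close>

definition point :: "'u \<Rightarrow> (bool list, 'x \<times> nat, 'u, 'u) ts_map" where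
  "point y = rst (cube []) (\<lambda>_. y) undefined"

lemma point_ts_maps: "y \<in> states Y \<Longrightarrow> point y \<in> ts_maps (cube []) Y"
  unfolding point_def rst_ts_maps[OF weak_ts_cube] by (rule is_mapI) (simp_all add: cube0 del: cube_simps)

lemma point_eval [simp]: "fst (point y) [] = y"
  unfolding point_def by simp

lemma ts_comp_point:
  assumes "y \<in> states Y"
  shows "ts_comp (cube []) h (point y) = point (fst h y)"
  unfolding ts_comp_rst point_def rst_eq_iff by (simp add: cube0 del: cube_simps)

lemma cocone_of_map:
  assumes Q: "a \<in> ts_maps Q Z" and k: "cube_cocone Y Q k"
  shows "cube_cocone Y Z (\<lambda>xs c. ts_comp (cube xs) a (k xs c))"
  unfolding cube_cocone_def
proof (intro conjI allI ballI)
  fix xs h assume "h \<in> ts_maps (cube xs) Y"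
  then have "k xs h \<in> ts_maps (cube xs) Q" using k unfolding cube_cocone_def by blast
  then show "ts_comp (cube xs) a (k xs h) \<in> ts_maps (cube xs) Z" by (rule ts_comp_maps[OF weak_ts_cube _ Q])
next
  fix xs ys c h assume c: "c \<in> ts_maps (cube xs) (cube ys)" and h: "h \<in> ts_maps (cube ys) Y"
  have e: "ts_comp (cube xs) (k ys h) c = k xs (ts_comp (cube xs) h c)"
    using k c h unfolding cube_cocone_def by blast
  note m = is_mapD(1,2)[OF ts_mapsD[OF c]]
  show "ts_comp (cube xs) (ts_comp (cube ys) a (k ys h)) c = ts_comp (cube xs) a (k xs (ts_comp (cube xs) h c))"
    unfolding e[symmetric] using m by (simp add: ts_comp_rst rst_eq_iff del: cube_simps)
qed

lemma cube_cocone_id: "cube_cocone Y Y (\<lambda>xs c. c)"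
  unfolding cube_cocone_def by blast

text \<open>Compatibility with the inclusion of the vertex \<open>e\<close> as a 0-cube. The values
  of a cocone on vertices thus define a single function on the states of \<open>Y\<close>.\<close>

lemma cocone_eval:
  assumes k: "cube_cocone Y Z k" and c: "c \<in> ts_maps (cube xs) Y" and e: "e \<in> states (cube xs)"
  shows "fst (k xs c) e = fst (k [] (point (fst c e))) []"
proof -
  define v :: "(bool list, 'x \<times> nat, bool list, 'x \<times> nat) ts_map" where "v = rst (cube []) (\<lambda>_. e) undefined"
  have v: "v \<in> ts_maps (cube []) (cube xs)"
    unfolding v_def rst_ts_maps[OF weak_ts_cube] by (rule is_mapI) (use e in \<open>simp_all add: cube0 del: cube_simps\<close>)
  have "ts_comp (cube []) (k xs c) v = k [] (ts_comp (cube []) c v)"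
    using k v c unfolding cube_cocone_def by blast
  moreover have "ts_comp (cube []) c v = point (fst c e)"
    unfolding ts_comp_rst point_def v_def rst_eq_iff by (simp add: cube0 del: cube_simps)
  moreover have "fst (ts_comp (cube []) (k xs c) v) [] = fst (k xs c) e"
    by (simp add: ts_comp_rst v_def)
  ultimately show ?thesis by simp
qed

text \<open>States are covered by 0-cubes and transitions by \<open>cube_map_exists\<close>. On
  actions, different cubes could disagree in general; into a label-injective \<open>Z\<close> the
  label leaves no choice, so the cocone descends from the cubification to \<open>Y\<close>
  itself.\<close>

lemma is_map_of_cocone:
  assumes Y: "Y \<in> Obs" and Z: "Z \<in> Zs" and k: "cube_cocone Y Z k"
  shows "is_map Y Z (\<lambda>y. fst (k [] (point y)) []) (\<lambda>u. act_of Z (lab Y u))"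
proof -
  have km: "k xs c \<in> ts_maps (cube xs) Z" if "c \<in> ts_maps (cube xs) Y" for xs c
    using k that unfolding cube_cocone_def by blast
  have kact: "snd (k xs c) w = act_of Z (lab Y (snd c w))"
    if c: "c \<in> ts_maps (cube xs) Y" and w: "w \<in> acts (cube xs)" for xs c w
    using act_of_is_map[OF Z ts_mapsD[OF km[OF c]] w] is_mapD(3)[OF ts_mapsD[OF c] w] by simp
  have tr: "(fst (k [] (point \<alpha>)) [], map (\<lambda>u. act_of Z (lab Y u)) us, fst (k [] (point \<beta>)) []) \<in> transitions Z"
    if t: "(\<alpha>, us, \<beta>) \<in> transitions Y" for \<alpha> us \<beta>
  proof -
    let ?xs = "map (lab Y) us"
    obtain \<nu> where n: "is_map (cube ?xs) Y \<nu> (\<lambda>w. us ! snd w)"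
      "\<nu> (replicate (length us) False) = \<alpha>" "\<nu> (replicate (length us) True) = \<beta>"
      using cube_map_exists[OF ObsD(3)[OF Y] t] by blast
    let ?c = "rst (cube ?xs) \<nu> (\<lambda>w. us ! snd w)"
    have c: "?c \<in> ts_maps (cube ?xs) Y" using n(1) by (simp add: rst_ts_maps[OF weak_ts_cube] del: cube_simps)
    let ?top = "map (\<lambda>i. (?xs ! i, i)) [0..<length us]"
    have top: "(replicate (length us) False, ?top, replicate (length us) True) \<in> transitions (cube ?xs)"
      using cube_top[of ?xs] weak_tsD(3)[OF ObsD(1)[OF Y] t] by simp
    note d = weak_tsD[OF weak_ts_cube top]
    have "map (snd (k ?xs ?c)) ?top = map (\<lambda>u. act_of Z (lab Y u)) us"
    proof (rule nth_equalityI)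
      fix i assume "i < length (map (snd (k ?xs ?c)) ?top)"
      then have i: "i < length us" by simp
      then have w: "(?xs ! i, i) \<in> acts (cube ?xs)" by auto
      show "map (snd (k ?xs ?c)) ?top ! i = map (\<lambda>u. act_of Z (lab Y u)) us ! i"
        using kact[OF c w] rst_simps(2)[OF w, of \<nu> "\<lambda>w. us ! snd w"] i by (simp del: cube_simps rst_simps)
    qed simp
    moreover have "fst (k ?xs ?c) (replicate (length us) False) = fst (k [] (point \<alpha>)) []"
      "fst (k ?xs ?c) (replicate (length us) True) = fst (k [] (point \<beta>)) []"
      using cocone_eval[OF k c d(1)] cocone_eval[OF k c d(2)] d(1,2) n(2,3) by (simp_all del: cube_simps)
    ultimately show ?thesis using is_mapD(4)[OF ts_mapsD[OF km[OF c]] top] by simp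
  qed
  show ?thesis
  proof (rule is_mapI)
    fix y assume "y \<in> states Y"
    then show "fst (k [] (point y)) [] \<in> states Z"
      using is_mapD(1)[OF ts_mapsD[OF km[OF point_ts_maps]], of y "[]"] by (simp add: cube0 del: cube_simps)
  next
    fix u assume u: "u \<in> acts Y"
    obtain \<alpha> \<beta> where t: "(\<alpha>, [u], \<beta>) \<in> transitions Y" using cub_or_regD(3)[OF ObsD(2)[OF Y] u] by blast
    let ?x = "lab Y u"
    have "is_map (cube [?x]) Y (\<lambda>e. if e = [False] then \<alpha> else \<beta>) (\<lambda>_. u)"
      by (rule is_mapI) (use t weak_tsD[OF ObsD(1)[OF Y] t] in \<open>auto simp: cube1_transitions\<close>)
    then have c: "rst (cube [?x]) (\<lambda>e. if e = [False] then \<alpha> else \<beta>) (\<lambda>_. u) \<in> ts_maps (cube [?x]) Y"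
      by (simp add: rst_ts_maps[OF weak_ts_cube])
    have w: "(?x, 0) \<in> acts (cube [?x])" by simp
    have e: "snd (k [?x] (rst (cube [?x]) (\<lambda>e. if e = [False] then \<alpha> else \<beta>) (\<lambda>_. u))) (?x, 0) = act_of Z ?x"
      using kact[OF c w] rst_simps(2)[OF w] by simp
    show "act_of Z (lab Y u) \<in> acts Z" "lab Z (act_of Z (lab Y u)) = lab Y u"
      using is_mapD(2,3)[OF ts_mapsD[OF km[OF c]] w] unfolding e by simp_all
  qed (rule tr)
qed

lemma cubification_extend:
  assumes "is_cubification X Q q" "Z \<in> Obs" "cube_cocone X Z k"
  shows "\<exists>g \<in> ts_maps Q Z. \<forall>xs. \<forall>h \<in> ts_maps (cube xs) X. ts_comp (cube xs) g (q xs h) = k xs h"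
proof -
  have "Z \<in> obj WTS" using assms(2) unfolding WTS_def by (simp add: ts_objs_def)
  then show ?thesis using assms(1,3) unfolding is_cubification_def by blast
qed

lemma cubification_unique:
  assumes "is_cubification X Q q" "Z \<in> Obs" "cube_cocone X Z k" "g \<in> ts_maps Q Z" "g' \<in> ts_maps Q Z"
    "\<And>xs h. h \<in> ts_maps (cube xs) X \<Longrightarrow> ts_comp (cube xs) g (q xs h) = k xs h"
    "\<And>xs h. h \<in> ts_maps (cube xs) X \<Longrightarrow> ts_comp (cube xs) g' (q xs h) = k xs h"
  shows "g = g'"
proof -
  have "Z \<in> obj WTS" using assms(2) unfolding WTS_def by (simp add: ts_objs_def)
  then have "\<exists>!g. g \<in> ts_maps Q Z \<and> (\<forall>xs. \<forall>h \<in> ts_maps (cube xs) X. ts_comp (cube xs) g (q xs h) = k xs h)"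
    using assms(1,3) unfolding is_cubification_def by blast
  then show ?thesis using assms(4-7) by blast
qed

text \<open>Maps from \<open>X\<close> to an object of \<open>Zs\<close> amount to cocones on the
  cubes of \<open>X\<close>, hence to maps out of its cubification \<open>Q\<close>, and likewise
  for \<open>Y\<close> and \<open>R\<close>. Orthogonality of \<open>g\<close> therefore transfers
  to \<open>h\<close>.\<close>

lemma cub_local_W: "cub_local_maps K \<subseteq> W"
proof
  fix f assume f: "f \<in> cub_local_maps K"
  obtain X h Y where f_eq: "f = (X, h, Y)" by (cases f)
  obtain f' where f': "is_cub_of_map f f'" "f' \<in> ts_weqs K" and fa: "f \<in> arr K"
    using f unfolding cub_local_maps_def by blast
  obtain Q g R where f'_eq: "f' = (Q, g, R)" by (cases f')
  have X: "X \<in> Obs" and Y: "Y \<in> Obs" and h: "h \<in> ts_maps X Y" using fa unfolding f_eq by simp_all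
  have w: "(Q, g, R) \<in> W" using ts_weqs_W f'(2) unfolding f'_eq by blast
  have Q: "Q \<in> Obs" and R: "R \<in> Obs" using subsetD[OF ts.orth_arr w] by simp_all
  obtain q r' where g: "g \<in> ts_maps Q R" and q: "is_cubification X Q q" and r': "is_cubification Y R r'"
    and nat: "\<And>xs c. c \<in> ts_maps (cube xs) X \<Longrightarrow> ts_comp (cube xs) g (q xs c) = r' xs (ts_comp (cube xs) h c)"
    using f'(1) unfolding is_cub_of_map_def f_eq f'_eq by auto
  have qc: "cube_cocone X Q q" and rc: "cube_cocone Y R r'"
    using q r' unfolding is_cubification_def by blast+
  have qm: "q xs c \<in> ts_maps (cube xs) Q" if "c \<in> ts_maps (cube xs) X" for xs c
    using qc that unfolding cube_cocone_def by blast
  note hm = ts_mapsD[OF h]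
  show "f \<in> W"
    unfolding f_eq
  proof (rule W_I[OF X Y h])
    fix Z a b assume Z: "Z \<in> Zs" and a: "is_map X Z a b"
    have am: "rst X a b \<in> ts_maps X Z" using a by (simp add: rst_ts_maps[OF ObsD(1)[OF X]])
    obtain m where m: "m \<in> ts_maps Q Z"
      "\<And>xs c. c \<in> ts_maps (cube xs) X \<Longrightarrow> ts_comp (cube xs) m (q xs c) = ts_comp (cube xs) (rst X a b) c"
      using cubification_extend[OF q Zs_Obs[OF Z] cocone_of_map[OF am cube_cocone_id]] by blast
    obtain ns na where n: "is_map R Z ns na" "\<And>s. s \<in> states Q \<Longrightarrow> ns (fst g s) = fst m s"
      using W_extend[OF w Z ts_mapsD[OF m(1)]] by blast
    have nm: "rst R ns na \<in> ts_maps R Z" using n(1) by (simp add: rst_ts_maps[OF ObsD(1)[OF R]])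
    \<comment> \<open>The extension to \<open>Y\<close> is read off from the 0-cubes of
      \<open>Y\<close>: \<open>r'\<close> sends each to \<open>R\<close>, and the extension over
      \<open>R\<close> sends it on to \<open>Z\<close>.\<close>
    let ?F = "\<lambda>y. fst (ts_comp (cube []) (rst R ns na) (r' [] (point y))) []"
    have "is_map Y Z ?F (\<lambda>u. act_of Z (lab Y u))"
      by (rule is_map_of_cocone[OF Y Z cocone_of_map[OF nm rc]])
    moreover have "?F (fst h x) = a x" if x: "x \<in> states X" for x
    proof -
      have p: "point x \<in> ts_maps (cube []) X" by (rule point_ts_maps[OF x])
      have e: "[] \<in> states (cube ([] :: 'x list))" by simp
      let ?s = "fst (q [] (point x)) []"
      have s: "?s \<in> states Q" using is_mapD(1)[OF ts_mapsD[OF qm[OF p]] e] .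
      have "fst (r' [] (point (fst h x))) [] = fst g ?s"
      proof -
        have "fst (ts_comp (cube []) g (q [] (point x))) [] = fst g ?s" using e by (simp add: ts_comp_rst)
        then show ?thesis unfolding nat[OF p] ts_comp_point[OF x] .
      qed
      moreover have "fst m ?s = a x"
      proof -
        have "fst (ts_comp (cube []) m (q [] (point x))) [] = fst (ts_comp (cube []) (rst X a b) (point x)) []"
          using m(2)[OF p] by simp
        then show ?thesis using e x by (simp add: ts_comp_rst)
      qed
      ultimately have "ns (fst (r' [] (point (fst h x))) []) = a x" using n(2)[OF s] by simp
      moreover have "fst (r' [] (point (fst h x))) [] \<in> states R"
        using \<open>fst (r' [] (point (fst h x))) [] = fst g ?s\<close> is_mapD(1)[OF ts_mapsD[OF g] s] by simp
      ultimately show ?thesis using e by (simp add: ts_comp_rst)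
    qed
    ultimately show "\<exists>f' g'. is_map Y Z f' g' \<and> (\<forall>x \<in> states X. f' (fst h x) = a x)" by blast
  next
    fix Z a b a' b' y
    assume Z: "Z \<in> Zs" and a: "is_map Y Z a b" and a': "is_map Y Z a' b'"
      and e: "\<And>x. x \<in> states X \<Longrightarrow> a (fst h x) = a' (fst h x)" and y: "y \<in> states Y"
    have am: "rst Y a b \<in> ts_maps Y Z" "rst Y a' b' \<in> ts_maps Y Z"
      using a a' by (simp_all add: rst_ts_maps[OF ObsD(1)[OF Y]])
    obtain m where m: "m \<in> ts_maps R Z"
      "\<And>xs c. c \<in> ts_maps (cube xs) Y \<Longrightarrow> ts_comp (cube xs) m (r' xs c) = ts_comp (cube xs) (rst Y a b) c"
      using cubification_extend[OF r' Zs_Obs[OF Z] cocone_of_map[OF am(1) cube_cocone_id]] by blast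
    obtain m' where m': "m' \<in> ts_maps R Z"
      "\<And>xs c. c \<in> ts_maps (cube xs) Y \<Longrightarrow> ts_comp (cube xs) m' (r' xs c) = ts_comp (cube xs) (rst Y a' b') c"
      using cubification_extend[OF r' Zs_Obs[OF Z] cocone_of_map[OF am(2) cube_cocone_id]] by blast
    have ah: "ts_comp X (rst Y a b) h = ts_comp X (rst Y a' b') h"
      unfolding ts_comp_eq_iff
      using e is_mapD(1,2)[OF hm] Zs_acts_unique[OF Z a a'] by simp
    have ahm: "ts_comp X (rst Y a b) h \<in> ts_maps X Z" by (rule ts_comp_maps[OF ObsD(1)[OF X] h am(1)])
    have WQ: "weak_ts Q" by (rule ObsD(1)[OF Q])
    \<comment> \<open>Both sides induce the same cocone on the cubes of \<open>X\<close>, because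
      the two maps on \<open>Y\<close> agree after \<open>h\<close>. Orthogonality of
      \<open>g\<close> then makes \<open>m\<close> and \<open>m'\<close> agree on the states of
      \<open>R\<close>.\<close>
    have "ts_comp Q m g = ts_comp Q m' g"
    proof (rule cubification_unique[OF q Zs_Obs[OF Z] cocone_of_map[OF ahm cube_cocone_id]])
      show "ts_comp Q m g \<in> ts_maps Q Z" "ts_comp Q m' g \<in> ts_maps Q Z"
        using ts_comp_maps[OF WQ g] m(1) m'(1) by blast+
      fix xs c assume c: "c \<in> ts_maps (cube xs) X"
      have hc: "ts_comp (cube xs) h c \<in> ts_maps (cube xs) Y" by (rule ts_comp_maps[OF weak_ts_cube c h])
      show "ts_comp (cube xs) (ts_comp Q m g) (q xs c) = ts_comp (cube xs) (ts_comp X (rst Y a b) h) c"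
        unfolding ts_comp_assoc[OF qm[OF c]] nat[OF c] m(2)[OF hc] ts_comp_assoc[OF c] ..
      show "ts_comp (cube xs) (ts_comp Q m' g) (q xs c) = ts_comp (cube xs) (ts_comp X (rst Y a b) h) c"
        unfolding ah ts_comp_assoc[OF qm[OF c]] nat[OF c] m'(2)[OF hc] ts_comp_assoc[OF c] ..
    qed
    then have "fst m (fst g s) = fst m' (fst g s)" if "s \<in> states Q" for s
      using that unfolding ts_comp_eq_iff by blast
    then have mm: "fst m s = fst m' s" if "s \<in> states R" for s
      using W_unique[OF w Z ts_mapsD[OF m(1)] ts_mapsD[OF m'(1)] _ that] by blast
    have p: "point y \<in> ts_maps (cube []) Y" by (rule point_ts_maps[OF y])
    have e: "[] \<in> states (cube ([] :: 'x list))" by simp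
    have rp: "r' [] (point y) \<in> ts_maps (cube []) R" using rc p unfolding cube_cocone_def by blast
    have "fst m (fst (r' [] (point y)) []) = a y"
      using m(2)[OF p] e y unfolding ts_comp_rst rst_eq_iff by simp
    moreover have "fst m' (fst (r' [] (point y)) []) = a' y"
      using m'(2)[OF p] e y unfolding ts_comp_rst rst_eq_iff by simp
    ultimately show "a y = a' y" using mm[OF is_mapD(1)[OF ts_mapsD[OF rp] e]] by simp
  qed
qed

lemma LCub_weqs_W: "LCub_weqs K \<subseteq> W"
proof -
  have "model_structure K (ts_cofs K) W loc.F" unfolding ts_cofs_eq by (rule loc.model)
  then show ?thesis
    unfolding LCub_weqs_def left_bousfield_weqs_def using ts_weqs_W cub_local_W by blast
qed

section \<open>Saturated systems are fibrant\<close>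

definition saturated :: "('u, 'x) ts \<Rightarrow> bool" where
  "saturated X \<longleftrightarrow> (\<forall>\<alpha> us vs \<beta>. (\<alpha>, us, \<beta>) \<in> transitions X \<and> set vs \<subseteq> acts X \<and>
     map (lab X) vs = map (lab X) us \<longrightarrow> (\<alpha>, vs, \<beta>) \<in> transitions X)"

text \<open>The actions are the coded labels, a small set because there are fewer labels than
  elements of \<open>'u\<close>; \<open>undefined\<close> merely names one element of
  \<open>'u\<close>.\<close>

definition terminal_ts :: "('u, 'x) ts" where
  "terminal_ts = \<lparr> states = {undefined}, acts = range lb, lab = restrict (inv lb) (range lb),
     transitions = {(\<alpha>, us, \<beta>). \<alpha> = undefined \<and> \<beta> = undefined \<and> us \<noteq> [] \<and> set us \<subseteq> range lb} \<rparr>"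

lemma terminal_ts_simps [simp]:
  "states terminal_ts = {undefined}" "acts terminal_ts = range lb"
  "lab terminal_ts = restrict (inv lb) (range lb)"
  "(\<alpha>, us, \<beta>) \<in> transitions terminal_ts \<longleftrightarrow> \<alpha> = undefined \<and> \<beta> = undefined \<and> us \<noteq> [] \<and> set us \<subseteq> range lb"
  by (simp_all add: terminal_ts_def)

lemma terminal_ts_Obs: "terminal_ts \<in> Obs"
proof (rule ObsI)
  show "cub_or_reg r terminal_ts"
  proof (rule cub_or_regI)
    show "weak_ts terminal_ts"
    proof (rule weak_tsI)
      fix \<alpha> us \<beta> vs assume t: "(\<alpha>, us, \<beta>) \<in> transitions terminal_ts" and m: "mset vs = mset us"
      have "set vs = set us" "vs = [] \<longleftrightarrow> us = []" using mset_eq_setD[OF m] m by auto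
      then show "(\<alpha>, vs, \<beta>) \<in> transitions terminal_ts" using t by simp
    qed auto
  qed auto
  show "small (states terminal_ts)" by (simp add: small_finite)
  show "small (acts terminal_ts)" by (simp add: small_label_image)
qed

lemma is_map_terminal: "A \<in> Obs \<Longrightarrow> is_map A terminal_ts (\<lambda>_. undefined) (\<lambda>u. lb (lab A u))"
  using weak_tsD(3)[OF ObsD(1)] by (intro is_mapI) auto

lemma terminal_terminal_ts: "terminal K terminal_ts"
  unfolding terminal_def
proof (intro conjI ballI)
  show "terminal_ts \<in> obj K" using terminal_ts_Obs by simp
  fix A assume "A \<in> obj K"
  then have A: "A \<in> Obs" by simp
  show "\<exists>!f. f \<in> homs K A terminal_ts"
  proof (rule ex1I)
    show "(A, rst A (\<lambda>_. undefined) (\<lambda>u. lb (lab A u)), terminal_ts) \<in> homs K A terminal_ts"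
      using A terminal_ts_Obs is_map_terminal[OF A] by (simp add: rst_ts_maps[OF ObsD(1)[OF A]])
    fix f assume "f \<in> homs K A terminal_ts"
    then obtain h where h: "f = (A, h, terminal_ts)" "h \<in> ts_maps A terminal_ts" unfolding ts_homs by blast
    note m = ts_mapsD[OF h(2)]
    have "snd h u = lb (lab A u)" if u: "u \<in> acts A" for u
    proof -
      obtain x where "snd h u = lb x" using is_mapD(2)[OF m u] by auto
      then show ?thesis using is_mapD(3)[OF m u] by simp
    qed
    moreover have "fst h a = undefined" if "a \<in> states A" for a using is_mapD(1)[OF m that] by simp
    ultimately have "rst A (fst h) (snd h) = rst A (\<lambda>_. undefined) (\<lambda>u. lb (lab A u))"
      unfolding rst_eq_iff by blast
    then show "f = (A, rst A (\<lambda>_. undefined) (\<lambda>u. lb (lab A u)), terminal_ts)"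
      using h(1) ts_maps_rst[OF h(2)] by simp
  qed
qed

lemma saturated_fibrant:
  assumes X: "X \<in> Obs" and s: "saturated X"
  shows "LCub_fibrant K X"
proof -
  define M where "M = lb ` lab X ` acts X"
  \<comment> \<open>\<open>c\<close> selects one action of \<open>X\<close> for each coded label
    that occurs, and \<open>Z\<close> acts through these selected actions.\<close>
  define c where "c = inv_into (acts X) (\<lambda>u. lb (lab X u))"
  have c: "c m \<in> acts X" "lb (lab X (c m)) = m" if "m \<in> M" for m
  proof -
    have "m \<in> (\<lambda>u. lb (lab X u)) ` acts X" using that unfolding M_def by blast
    then show "c m \<in> acts X" "lb (lab X (c m)) = m" unfolding c_def by (auto intro: inv_into_into f_inv_into_f)
  qed
  define Z where "Z = pullback_acts X M c"
  have "cub_or_reg r Z" unfolding Z_def using c(1) by (intro cub_or_reg_pullback_acts ObsD(2)[OF X]) auto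
  moreover have "small M" using small_image[OF ObsD(5)[OF X], of "\<lambda>u. lb (lab X u)"] by (simp add: M_def image_image)
  ultimately have ZO: "Z \<in> Obs" using ObsD(4)[OF X] by (intro ObsI) (simp_all add: Z_def)
  have "inj_on (lab Z) (acts Z)"
  proof (rule inj_onI)
    fix u v assume "u \<in> acts Z" "v \<in> acts Z" and e: "lab Z u = lab Z v"
    then have uv: "u \<in> M" "v \<in> M" by (simp_all add: Z_def)
    then have "lb (lab X (c u)) = lb (lab X (c v))" using e by (simp add: Z_def)
    then show "u = v" unfolding c(2)[OF uv(1)] c(2)[OF uv(2)] .
  qed
  then have Z: "Z \<in> Zs" using ZO by (simp add: Zs_def)
  let ?g = "\<lambda>u. lb (lab X u)"
  have gM: "?g ` acts X = M" unfolding M_def by blast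
  have labc: "lab X (c (?g u)) = lab X u" if "u \<in> acts X" for u
  proof -
    have "?g u \<in> M" using that unfolding M_def by blast
    from c(2)[OF this] show ?thesis using inj_lb by (simp add: inj_eq)
  qed
  have mapc: "map (lab X) (map c (map ?g us)) = map (lab X) us" if "set us \<subseteq> acts X" for us
    using labc that by auto
  have setc: "set (map c (map ?g us)) \<subseteq> acts X" if "set us \<subseteq> acts X" for us
    using c(1) gM that by auto
  have m: "is_map X Z (\<lambda>a. a) ?g"
  proof (rule is_mapI)
    fix \<alpha> us \<beta> assume t: "(\<alpha>, us, \<beta>) \<in> transitions X"
    have us: "set us \<subseteq> acts X" using weak_tsD(4)[OF ObsD(1)[OF X] t] .
    have "(\<alpha>, map c (map ?g us), \<beta>) \<in> transitions X"
      using s t mapc[OF us] setc[OF us] unfolding saturated_def by blast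
    moreover have "set (map ?g us) \<subseteq> M" using us gM by auto
    ultimately show "(\<alpha>, map ?g us, \<beta>) \<in> transitions Z" unfolding Z_def pullback_acts_simps by blast
  next
    fix u assume "u \<in> acts X"
    then show "?g u \<in> acts Z" "lab Z (?g u) = lab X u" using gM labc by (auto simp: Z_def)
  qed (simp add: Z_def)
  \<comment> \<open>Saturation enters twice: above, to make the collapse a map although the selected
    actions differ from the given ones, and here, to bring transitions back.\<close>
  have "nice X Z (\<lambda>a. a) ?g"
    unfolding nice_def
  proof (intro conjI m ballI allI impI)
    show "bij_betw (\<lambda>a. a) (states X) (states Z)" by (simp add: Z_def bij_betw_def)
    show "?g ` acts X = acts Z" using gM by (simp add: Z_def)
    fix \<alpha> \<beta> us assume "set us \<subseteq> acts X \<and> (\<alpha>, map ?g us, \<beta>) \<in> transitions Z"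
    then have us: "set us \<subseteq> acts X" and "(\<alpha>, map c (map ?g us), \<beta>) \<in> transitions X"
      unfolding Z_def pullback_acts_simps by blast+
    then show "(\<alpha>, us, \<beta>) \<in> transitions X"
      using s mapc[OF us, symmetric] unfolding saturated_def by blast
  qed
  then have n: "(X, rst X (\<lambda>a. a) ?g, Z) \<in> nice_arrs" by (rule nice_arrsI[OF X ZO])
  let ?n = "(X, rst X (\<lambda>a. a) ?g, Z)"
  have nh: "?n \<in> homs K X Z" using ts.arr_homs[OF subsetD[OF nice_arrs_arr n]] by simp
  obtain t where t: "t \<in> homs K X terminal_ts"
    using terminal_terminal_ts X unfolding terminal_def by auto
  have "t \<in> rlp K (ts_cofs K \<inter> LCub_weqs K)"
    unfolding rlp_def
  proof (intro CollectI conjI ballI)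
    show "t \<in> arr K" using t unfolding homs_def by blast
    fix i assume "i \<in> ts_cofs K \<inter> LCub_weqs K"
    then have iC: "i \<in> llp K nice_arrs" and iW: "i \<in> W" using LCub_weqs_W ts_cofs_eq by blast+
    obtain A B where i: "i \<in> homs K A B" using iW ts.orth_arr ts.arr_homs by blast
    have l: "has_lifting K i ?n" using iC n unfolding llp_def by blast
    show "has_lifting K i t"
    proof (rule ts.has_liftingI[OF i t])
      fix u v assume u: "u \<in> homs K A X" and v: "v \<in> homs K B terminal_ts"
      \<comment> \<open>Orthogonality extends the map to \<open>Z\<close>. This gives the bottom of
        a square against the trivial fibration \<open>?n\<close>, which the cofibration
        \<open>i\<close> lifts.\<close>
      obtain k where k: "k \<in> homs K B Z" "cmp K k i = cmp K ?n u"
        using ts.orthD[OF iW i Z ts.cmp_homs[OF u nh]] by blast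
      obtain h where h: "h \<in> homs K B X" "cmp K h i = u"
        using ts.has_liftingE[OF l i nh u k(1)] k(2) by metis
      have "cmp K t h \<in> homs K B terminal_ts" by (rule ts.cmp_homs[OF h(1) t])
      moreover have "B \<in> obj K" using ts.homs_obj[OF i] by blast
      ultimately have "cmp K t h = v" using v terminal_terminal_ts unfolding terminal_def by blast
      then show "\<exists>h \<in> homs K B X. cmp K h i = u \<and> cmp K t h = v" using h by blast
    qed
  qed
  then show ?thesis
    unfolding LCub_fibrant_def fibrant_def using X terminal_terminal_ts t by auto
qed

section \<open>Fibrant objects\<close>

text \<open>The square over the terminal object commutes automatically, so the lifting property
  becomes an extension property along \<open>h\<close>.\<close>

lemma fibrant_extend:
  assumes X: "LCub_fibrant K X" and C: "(A, h, B) \<in> llp K nice_arrs" and w: "(A, h, B) \<in> LCub_weqs K"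
    and f: "is_map A X f g"
  obtains f' g' where "is_map B X f' g'" "\<And>a. a \<in> states A \<Longrightarrow> f' (fst h a) = f a"
    "\<And>u. u \<in> acts A \<Longrightarrow> g' (snd h u) = g u"
proof -
  obtain T t where T: "terminal K T" "t \<in> homs K X T" "t \<in> rlp K (ts_cofs K \<inter> LCub_weqs K)" and XO: "X \<in> Obs"
    using X unfolding LCub_fibrant_def fibrant_def by auto
  have arr: "(A, h, B) \<in> arr K" using C unfolding llp_def by blast
  then have i: "(A, h, B) \<in> homs K A B" and A: "A \<in> Obs" and B: "B \<in> Obs" by simp_all
  have u: "(A, rst A f g, X) \<in> homs K A X" using A XO f by (simp add: rst_ts_maps[OF ObsD(1)[OF A]])
  obtain v where v: "v \<in> homs K B T" using T(1) B unfolding terminal_def by auto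
  have "cmp K t (A, rst A f g, X) = cmp K v (A, h, B)"
    using T(1) A ts.cmp_homs[OF u T(2)] ts.cmp_homs[OF i v] unfolding terminal_def by auto
  moreover have "has_lifting K (A, h, B) t"
    using T(3) C w unfolding rlp_def ts_cofs_eq by blast
  ultimately obtain k where k: "k \<in> homs K B X" "cmp K k (A, h, B) = (A, rst A f g, X)"
    using ts.has_liftingE[OF _ i T(2) u v] by metis
  then obtain l where l: "k = (B, l, X)" "l \<in> ts_maps B X" unfolding ts_homs by blast
  have e: "ts_comp A l h = rst A f g" using k(2) l by simp
  show ?thesis
    using that[OF ts_mapsD[OF l(2)]] e unfolding ts_comp_rst rst_eq_iff by blast
qed

text \<open>Trivial fibrations are already weak equivalences before localization, so every candidate
  contains them along with the local maps. These two inclusions feed the later two-out-of-three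
  arguments.\<close>

lemma LCub_weqsI:
  assumes "\<And>W' F'. model_structure K (llp K nice_arrs) W' F' \<Longrightarrow> nice_arrs \<subseteq> W' \<Longrightarrow>
    cub_local_maps K \<subseteq> W' \<Longrightarrow> i \<in> W'"
  shows "i \<in> LCub_weqs K"
  unfolding LCub_weqs_def left_bousfield_weqs_def ts_cofs_eq
  using assms nice_ts_weqs by blast

text \<open>Such a system is glued from its vertices and edges. As every action has just one edge,
  the value of a cocone on an action can be read off there. With several edges for one action a
  cocone might give them different values, as happens for \<open>two_edges_glued\<close>.\<close>

lemma cubification_id:
  assumes Q: "Q \<in> Obs" and l1: "\<And>\<alpha> us \<beta>. (\<alpha>, us, \<beta>) \<in> transitions Q \<Longrightarrow> length us = 1"
    and un: "\<And>\<alpha> \<beta> \<alpha>' \<beta>' u. (\<alpha>, [u], \<beta>) \<in> transitions Q \<Longrightarrow> (\<alpha>', [u], \<beta>') \<in> transitions Q \<Longrightarrow> \<alpha> = \<alpha>' \<and> \<beta> = \<beta>'"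
  shows "is_cubification Q Q (\<lambda>xs c. c)"
  unfolding is_cubification_def
proof (intro conjI ballI allI impI)
  show "Q \<in> obj WTS" using Q unfolding WTS_def by (simp add: ts_objs_def)
  show "cube_cocone Q Q (\<lambda>xs c. c)" by (rule cube_cocone_id)
  note WQ = ObsD(1)[OF Q]
  fix Z k assume "Z \<in> obj WTS" and k: "cube_cocone Q Z k"
  have km: "k xs c \<in> ts_maps (cube xs) Z" if "c \<in> ts_maps (cube xs) Q" for xs c
    using k that unfolding cube_cocone_def by blast
  define src' tgt' where "src' u = (SOME \<alpha>. \<exists>\<beta>. (\<alpha>, [u], \<beta>) \<in> transitions Q)"
    and "tgt' u = (SOME \<beta>. (src' u, [u], \<beta>) \<in> transitions Q)" for u
  have st: "(src' u, [u], tgt' u) \<in> transitions Q" if u: "u \<in> acts Q" for u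
  proof -
    have "\<exists>\<alpha>. \<exists>\<beta>. (\<alpha>, [u], \<beta>) \<in> transitions Q" using cub_or_regD(3)[OF ObsD(2)[OF Q] u] .
    from someI_ex[OF this] have "\<exists>\<beta>. (src' u, [u], \<beta>) \<in> transitions Q" unfolding src'_def .
    from someI_ex[OF this] show ?thesis unfolding tgt'_def .
  qed
  define edge where "edge u = rst (cube [lab Q u]) (\<lambda>e. if e = [False] then src' u else tgt' u) (\<lambda>_. u)" for u
  have edge: "edge u \<in> ts_maps (cube [lab Q u]) Q" if u: "u \<in> acts Q" for u
  proof -
    have "is_map (cube [lab Q u]) Q (\<lambda>e. if e = [False] then src' u else tgt' u) (\<lambda>_. u)"
      by (rule is_mapI) (use st[OF u] weak_tsD[OF WQ st[OF u]] in \<open>auto simp: cube1_transitions\<close>)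
    then show ?thesis by (simp add: edge_def rst_ts_maps[OF weak_ts_cube])
  qed
  have edge_unique: "c = edge u" if c: "c \<in> ts_maps (cube [lab Q u]) Q" and cu: "snd c (lab Q u, 0) = u" and u: "u \<in> acts Q" for c u
  proof (rule ts_maps_eqI[OF c edge[OF u]])
    have "([False], [(lab Q u, 0)], [True]) \<in> transitions (cube [lab Q u])" by (simp add: cube1_transitions)
    from is_mapD(4)[OF ts_mapsD[OF c] this] have "(fst c [False], [u], fst c [True]) \<in> transitions Q" using cu by simp
    from un[OF this st[OF u]] have e: "fst c [False] = src' u" "fst c [True] = tgt' u" by simp_all
    fix a assume "a \<in> states (cube [lab Q u])"
    then have "a = [False] \<or> a = [True]" unfolding cube1_states by blast
    then show "fst c a = fst (edge u) a" using e by (auto simp: edge_def)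
  next
    fix w assume "w \<in> acts (cube [lab Q u])"
    moreover from this have "w = (lab Q u, 0)" by simp
    ultimately show "snd c w = snd (edge u) w" using cu by (simp add: edge_def)
  qed
  define F where "F s = fst (k [] (point s)) []" for s
  define G where "G u = snd (k [lab Q u] (edge u)) (lab Q u, 0)" for u
  \<comment> \<open>An action of a cube occurs on the edge leaving the all-\<open>False\<close>
    vertex. Restricted to this edge the cube becomes the unique edge of the action
    \<open>snd c w\<close>, and compatibility of the cocone gives the value
    \<open>G\<close>.\<close>
  have G: "snd (k xs c) w = G (snd c w)" if c: "c \<in> ts_maps (cube xs) Q" and w: "w \<in> acts (cube xs)" for xs c w
  proof -
    obtain i where i: "i < length xs" "w = (xs ! i, i)" using w by auto
    let ?x = "xs ! i" and ?o = "replicate (length xs) False"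
    define v where "v = rst (cube [?x]) (\<lambda>e. if e = [False] then ?o else ?o[i := True]) (\<lambda>_. w)"
    have v: "v \<in> ts_maps (cube [?x]) (cube xs)"
    proof -
      have "is_map (cube [?x]) (cube xs) (\<lambda>e. if e = [False] then ?o else ?o[i := True]) (\<lambda>_. w)"
        by (rule is_mapI) (use cube_edge[OF i(1)] i in \<open>auto simp: cube1_transitions\<close>)
      then show ?thesis by (simp add: v_def rst_ts_maps[OF weak_ts_cube])
    qed
    have sc: "snd c w \<in> acts Q" "lab Q (snd c w) = ?x"
      using is_mapD(2,3)[OF ts_mapsD[OF c] w] w i by simp_all
    have "ts_comp (cube [?x]) c v = edge (snd c w)"
    proof (rule edge_unique[OF _ _ sc(1)])
      show "ts_comp (cube [?x]) c v \<in> ts_maps (cube [lab Q (snd c w)]) Q"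
        unfolding sc(2) by (rule ts_comp_maps[OF weak_ts_cube v c])
      show "snd (ts_comp (cube [?x]) c v) (lab Q (snd c w), 0) = snd c w"
        unfolding sc(2) by (simp add: ts_comp_rst v_def)
    qed
    moreover have "ts_comp (cube [?x]) (k xs c) v = k [?x] (ts_comp (cube [?x]) c v)"
      using k v c unfolding cube_cocone_def by blast
    moreover have "snd (ts_comp (cube [?x]) (k xs c) v) (?x, 0) = snd (k xs c) w"
      by (simp add: ts_comp_rst v_def)
    ultimately show ?thesis unfolding G_def sc(2) by simp
  qed
  have FG: "is_map Q Z F G"
  proof (rule is_mapI)
    fix s assume "s \<in> states Q"
    from is_mapD(1)[OF ts_mapsD[OF km[OF point_ts_maps[OF this]]], of "[]"]
    show "F s \<in> states Z" by (simp add: F_def)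
  next
    fix u assume u: "u \<in> acts Q"
    have w: "(lab Q u, 0) \<in> acts (cube [lab Q u])" by simp
    show "G u \<in> acts Z" "lab Z (G u) = lab Q u"
      using is_mapD(2,3)[OF ts_mapsD[OF km[OF edge[OF u]]] w] unfolding G_def by simp_all
  next
    fix \<alpha> us \<beta> assume t: "(\<alpha>, us, \<beta>) \<in> transitions Q"
    obtain u where u: "us = [u]" using l1[OF t] by (auto simp: length_Suc_conv)
    have uQ: "u \<in> acts Q" using weak_tsD(4)[OF WQ t] u by simp
    have ab: "\<alpha> = src' u" "\<beta> = tgt' u" using un[OF t[unfolded u] st[OF uQ]] by simp_all
    have "([False], [(lab Q u, 0)], [True]) \<in> transitions (cube [lab Q u])" by (simp add: cube1_transitions)
    from is_mapD(4)[OF ts_mapsD[OF km[OF edge[OF uQ]]] this]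
    have "(fst (k [lab Q u] (edge u)) [False], [G u], fst (k [lab Q u] (edge u)) [True]) \<in> transitions Z"
      by (simp add: G_def)
    moreover have "fst (k [lab Q u] (edge u)) [False] = F \<alpha>" "fst (k [lab Q u] (edge u)) [True] = F \<beta>"
      using cocone_eval[OF k edge[OF uQ], of "[False]"] cocone_eval[OF k edge[OF uQ], of "[True]"] ab
      by (simp_all add: F_def edge_def)
    ultimately show "(F \<alpha>, map G us, F \<beta>) \<in> transitions Z" using u by simp
  qed
  show "\<exists>!g. g \<in> ts_maps Q Z \<and> (\<forall>xs. \<forall>h \<in> ts_maps (cube xs) Q. ts_comp (cube xs) g h = k xs h)"
  proof (rule ex1I[of _ "rst Q F G"], intro conjI allI ballI)
    show "rst Q F G \<in> ts_maps Q Z" using FG by (simp add: rst_ts_maps[OF WQ])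
    fix xs h assume h: "h \<in> ts_maps (cube xs) Q"
    note hm = is_mapD(1,2)[OF ts_mapsD[OF h]]
    show "ts_comp (cube xs) (rst Q F G) h = k xs h"
      unfolding ts_comp_eq_map_iff[OF km[OF h]]
      using hm cocone_eval[OF k h] G[OF h] by (simp add: F_def del: cube_simps)
  next
    fix g assume g: "g \<in> ts_maps Q Z \<and> (\<forall>xs. \<forall>h \<in> ts_maps (cube xs) Q. ts_comp (cube xs) g h = k xs h)"
    have "fst g s = F s" if s: "s \<in> states Q" for s
    proof -
      have "ts_comp (cube []) g (point s) = k [] (point s)" using g point_ts_maps[OF s] by blast
      moreover have "fst (ts_comp (cube []) g (point s)) [] = fst g s" by (simp add: ts_comp_rst)
      ultimately show ?thesis by (simp add: F_def)
    qed
    moreover have "snd g u = G u" if u: "u \<in> acts Q" for u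
    proof -
      have "ts_comp (cube [lab Q u]) g (edge u) = k [lab Q u] (edge u)" using g edge[OF u] by blast
      moreover have "snd (ts_comp (cube [lab Q u]) g (edge u)) (lab Q u, 0) = snd g u"
        by (simp add: ts_comp_rst edge_def)
      ultimately show ?thesis by (simp add: G_def)
    qed
    ultimately have "rst Q (fst g) (snd g) = rst Q F G" unfolding rst_eq_iff by blast
    then show "g = rst Q F G" using ts_maps_rst g by metis
  qed
qed

text \<open>Composition with \<open>p\<close> identifies the cubes of \<open>Q\<close> with those of
  \<open>X\<close>, so a colimit of the first diagram is also one of the second. The cocone for
  \<open>X\<close> lifts each cube back along \<open>p\<close>.\<close>

lemma cubification_transfer:
  assumes Q: "is_cubification Q Q (\<lambda>xs c. c)" and p: "p \<in> ts_maps Q X" and WQ: "weak_ts Q"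
    and bij: "\<And>xs. bij_betw (ts_comp (cube xs) p) (ts_maps (cube xs) Q) (ts_maps (cube xs) X)"
  shows "is_cubification X Q (\<lambda>xs. inv_into (ts_maps (cube xs) Q) (ts_comp (cube xs) p))"
proof -
  define q where "q xs = inv_into (ts_maps (cube xs) Q) (ts_comp (cube xs) p)" for xs
  have q: "q xs c \<in> ts_maps (cube xs) Q" "ts_comp (cube xs) p (q xs c) = c" if "c \<in> ts_maps (cube xs) X" for xs c
  proof -
    have c: "c \<in> ts_comp (cube xs) p ` ts_maps (cube xs) Q" using bij[of xs] that unfolding bij_betw_def by simp
    show "q xs c \<in> ts_maps (cube xs) Q" "ts_comp (cube xs) p (q xs c) = c"
      unfolding q_def by (rule inv_into_into[OF c], rule f_inv_into_f[OF c])
  qed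
  have qp: "q xs (ts_comp (cube xs) p c) = c" if "c \<in> ts_maps (cube xs) Q" for xs c
    unfolding q_def by (rule bij_betw_inv_into_left[OF bij that])
  have "cube_cocone X Q q"
    unfolding cube_cocone_def
  proof (intro conjI allI ballI)
    fix xs h assume "h \<in> ts_maps (cube xs) X" then show "q xs h \<in> ts_maps (cube xs) Q" by (rule q)
  next
    fix xs ys c h assume c: "c \<in> ts_maps (cube xs) (cube ys)" and h: "h \<in> ts_maps (cube ys) X"
    have m: "ts_comp (cube xs) (q ys h) c \<in> ts_maps (cube xs) Q" by (rule ts_comp_maps[OF weak_ts_cube c q(1)[OF h]])
    have "ts_comp (cube xs) p (ts_comp (cube xs) (q ys h) c) = ts_comp (cube xs) h c"
      using ts_comp_assoc[OF c, of p "q ys h"] q(2)[OF h] by simp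
    then show "ts_comp (cube xs) (q ys h) c = q xs (ts_comp (cube xs) h c)"
      using qp[OF m] by simp
  qed
  moreover have "\<exists>!g. g \<in> ts_maps Q Z \<and> (\<forall>xs. \<forall>h \<in> ts_maps (cube xs) X. ts_comp (cube xs) g (q xs h) = k xs h)"
    if Z: "Z \<in> obj WTS" and k: "cube_cocone X Z k" for Z k
  proof -
    have "cube_cocone Q Z (\<lambda>xs c. k xs (ts_comp (cube xs) p c))"
      unfolding cube_cocone_def
    proof (intro conjI allI ballI)
      fix xs h assume "h \<in> ts_maps (cube xs) Q"
      then have "ts_comp (cube xs) p h \<in> ts_maps (cube xs) X" by (rule ts_comp_maps[OF weak_ts_cube _ p])
      then show "k xs (ts_comp (cube xs) p h) \<in> ts_maps (cube xs) Z" using k unfolding cube_cocone_def by blast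
    next
      fix xs ys c h assume c: "c \<in> ts_maps (cube xs) (cube ys)" and h: "h \<in> ts_maps (cube ys) Q"
      have ph: "ts_comp (cube ys) p h \<in> ts_maps (cube ys) X" by (rule ts_comp_maps[OF weak_ts_cube h p])
      have "ts_comp (cube xs) (k ys (ts_comp (cube ys) p h)) c = k xs (ts_comp (cube xs) (ts_comp (cube ys) p h) c)"
        using k c ph unfolding cube_cocone_def by blast
      then show "ts_comp (cube xs) (k ys (ts_comp (cube ys) p h)) c = k xs (ts_comp (cube xs) p (ts_comp (cube xs) h c))"
        unfolding ts_comp_assoc[OF c] .
    qed
    then have ex: "\<exists>!g. g \<in> ts_maps Q Z \<and>
        (\<forall>xs. \<forall>c \<in> ts_maps (cube xs) Q. ts_comp (cube xs) g c = k xs (ts_comp (cube xs) p c))"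
      using Q Z unfolding is_cubification_def by blast
    have "(\<forall>xs. \<forall>c \<in> ts_maps (cube xs) Q. ts_comp (cube xs) g c = k xs (ts_comp (cube xs) p c)) \<longleftrightarrow>
        (\<forall>xs. \<forall>h \<in> ts_maps (cube xs) X. ts_comp (cube xs) g (q xs h) = k xs h)" for g
    proof (intro iffI allI ballI)
      fix xs h assume "\<forall>xs. \<forall>c \<in> ts_maps (cube xs) Q. ts_comp (cube xs) g c = k xs (ts_comp (cube xs) p c)"
        and h: "h \<in> ts_maps (cube xs) X"
      then have "ts_comp (cube xs) g (q xs h) = k xs (ts_comp (cube xs) p (q xs h))" using q(1)[OF h] by blast
      then show "ts_comp (cube xs) g (q xs h) = k xs h" unfolding q(2)[OF h] .
    next
      fix xs c assume a: "\<forall>xs. \<forall>h \<in> ts_maps (cube xs) X. ts_comp (cube xs) g (q xs h) = k xs h"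
        and c: "c \<in> ts_maps (cube xs) Q"
      have "ts_comp (cube xs) p c \<in> ts_maps (cube xs) X" by (rule ts_comp_maps[OF weak_ts_cube c p])
      then have "ts_comp (cube xs) g (q xs (ts_comp (cube xs) p c)) = k xs (ts_comp (cube xs) p c)" using a by blast
      then show "ts_comp (cube xs) g c = k xs (ts_comp (cube xs) p c)" unfolding qp[OF c] .
    qed
    then show ?thesis using ex by simp
  qed
  moreover have "Q \<in> obj WTS" using Q unfolding is_cubification_def by blast
  ultimately show ?thesis unfolding is_cubification_def q_def by blast
qed

section \<open>Finite systems of edges with one label\<close>

definition edge_ts :: "'x \<Rightarrow> 'u set \<Rightarrow> 'u set \<Rightarrow> ('u \<times> 'u \<times> 'u) set \<Rightarrow> ('u, 'x) ts" where
  "edge_ts x S M T = \<lparr> states = S, acts = M, lab = restrict (\<lambda>_. x) M,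
     transitions = {(\<alpha>, [u], \<beta>) | \<alpha> u \<beta>. (\<alpha>, u, \<beta>) \<in> T} \<rparr>"

lemma edge_ts_simps [simp]:
  "states (edge_ts x S M T) = S" "acts (edge_ts x S M T) = M" "lab (edge_ts x S M T) = restrict (\<lambda>_. x) M"
  "(\<alpha>, us, \<beta>) \<in> transitions (edge_ts x S M T) \<longleftrightarrow> (\<exists>u. us = [u] \<and> (\<alpha>, u, \<beta>) \<in> T)"
  by (auto simp: edge_ts_def)

lemma edge_ts_Obs:
  assumes "finite S" "finite M" "T \<subseteq> S \<times> M \<times> S" "\<And>u. u \<in> M \<Longrightarrow> \<exists>\<alpha> \<beta>. (\<alpha>, u, \<beta>) \<in> T"
  shows "edge_ts x S M T \<in> Obs"
proof (rule ObsI)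
  show "cub_or_reg r (edge_ts x S M T)"
  proof (rule cub_or_reg_length1)
    show "weak_ts (edge_ts x S M T)" by (rule weak_ts_length1) (use assms(3) in auto)
  qed (use assms(4) in auto)
qed (use assms(1,2) in \<open>simp_all add: small_finite\<close>)

definition en :: "nat \<Rightarrow> 'u" where
  "en = (SOME f. inj f)"

lemma en_eq [simp]: "en m = en n \<longleftrightarrow> m = n"
proof -
  have "\<exists>f :: nat \<Rightarrow> 'u. inj f" using infinite_countable_subset[OF infinite_univ] by blast
  from someI_ex[OF this] show ?thesis unfolding en_def by (rule inj_eq)
qed

definition edge1 where "edge1 x = edge_ts x {en 0, en 1} {en 0} {(en 0, en 0, en 1)}"
definition edge1_doubled where
  "edge1_doubled x = edge_ts x {en 0, en 1} {en 0, en 1} {(en 0, en 0, en 1), (en 0, en 1, en 1)}"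
text \<open>Copies in \<open>'u\<close> of the systems around \<open>p_x\<close>: this is its
  source, \<open>two_edges_glued x\<close> its target, and \<open>fold_edges x\<close> the map
  itself. As \<open>p_x\<close> identifies two actions, it is factored through
  \<open>two_edges_doubled x\<close> into a map injective on actions followed by a nice map.\<close>

definition two_edges where
  "two_edges x = edge_ts x {en 0, en 1, en 2, en 3} {en 0, en 1} {(en 0, en 0, en 1), (en 2, en 1, en 3)}"
definition two_edges_doubled where
  "two_edges_doubled x = edge_ts x {en 0, en 1, en 2, en 3} {en 0, en 1}
     {(en 0, en 0, en 1), (en 2, en 1, en 3), (en 0, en 1, en 1), (en 2, en 0, en 3)}"
definition two_edges_glued where
  "two_edges_glued x = edge_ts x {en 0, en 1, en 2, en 3} {en 0} {(en 0, en 0, en 1), (en 2, en 0, en 3)}"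

lemmas edge_defs = edge1_def edge1_doubled_def two_edges_def two_edges_doubled_def two_edges_glued_def

lemma edges_Obs: "edge1 x \<in> Obs" "edge1_doubled x \<in> Obs" "two_edges x \<in> Obs" "two_edges_doubled x \<in> Obs"
  "two_edges_glued x \<in> Obs"
  unfolding edge_defs by (rule edge_ts_Obs; auto)+

lemma nice_doubled:
  "nice (edge1_doubled x) (edge1 x) (\<lambda>a. a) (\<lambda>_. en 0)"
  "nice (two_edges_doubled x) (two_edges_glued x) (\<lambda>a. a) (\<lambda>_. en 0)"
  unfolding nice_def edge_defs
  by (auto simp: is_map_def bij_betw_def Cons_eq_map_conv map_eq_Cons_conv)

definition fold_edges where "fold_edges x = rst (two_edges x) (\<lambda>a. a) (\<lambda>_. en 0)"
definition double_edges where "double_edges x = rst (two_edges x) (\<lambda>a. a) (\<lambda>u. u)"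
definition double_edge where "double_edge x = rst (edge1 x) (\<lambda>a. a) (\<lambda>u. u)"

lemma edge_maps:
  "fold_edges x \<in> ts_maps (two_edges x) (two_edges_glued x)"
  "double_edges x \<in> ts_maps (two_edges x) (two_edges_doubled x)"
  "double_edge x \<in> ts_maps (edge1 x) (edge1_doubled x)"
  unfolding fold_edges_def double_edges_def double_edge_def
    rst_ts_maps[OF ObsD(1)[OF edges_Obs(1)]] rst_ts_maps[OF ObsD(1)[OF edges_Obs(3)]]
  by (auto simp: is_map_def edge_defs)

text \<open>The two edges have different sources, so the source of an edge in the glued system tells
  which of the two actions lifts it. Cubes of dimension at least 2 do not occur, for want of
  transitions longer than 1.\<close>

lemma bij_fold_edges:
  "bij_betw (ts_comp (cube xs) (fold_edges x)) (ts_maps (cube xs) (two_edges x)) (ts_maps (cube xs) (two_edges_glued x))"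
proof -
  let ?Q = "two_edges x" and ?X = "two_edges_glued x" and ?p = "fold_edges x"
  have pm: "?p \<in> ts_maps ?Q ?X" by (rule edge_maps)
  have ps: "fst ?p s = s" if "s \<in> states ?Q" for s using that by (simp add: fold_edges_def)
  have pa: "snd ?p u = en 0" if "u \<in> acts ?Q" for u using that by (simp add: fold_edges_def)
  have src_act: "u = (if \<alpha> = en 0 then en 0 else en 1)" if "(\<alpha>, [u], \<beta>) \<in> transitions ?Q" for \<alpha> u \<beta>
    using that by (auto simp: two_edges_def)
  have inj: "c = c'" if c: "c \<in> ts_maps (cube xs) ?Q" and c': "c' \<in> ts_maps (cube xs) ?Q"
    and e: "ts_comp (cube xs) ?p c = ts_comp (cube xs) ?p c'" for c c'
  proof (rule ts_maps_eqI[OF c c'])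
    fix s assume s: "s \<in> states (cube xs)"
    have "fst ?p (fst c s) = fst ?p (fst c' s)" using e s unfolding ts_comp_eq_iff by blast
    then show st: "fst c s = fst c' s"
      using ps is_mapD(1)[OF ts_mapsD[OF c] s] is_mapD(1)[OF ts_mapsD[OF c'] s] by simp
  next
    fix w assume "w \<in> acts (cube xs)"
    then obtain i where i: "i < length xs" "w = (xs ! i, i)" by auto
    let ?o = "replicate (length xs) False"
    have o: "?o \<in> states (cube xs)" by simp
    have "fst ?p (fst c ?o) = fst ?p (fst c' ?o)" using e o unfolding ts_comp_eq_iff by blast
    then have st: "fst c ?o = fst c' ?o"
      using ps is_mapD(1)[OF ts_mapsD[OF c] o] is_mapD(1)[OF ts_mapsD[OF c'] o] by simp
    have "(fst c ?o, [snd c w], fst c (?o[i := True])) \<in> transitions ?Q"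
      "(fst c' ?o, [snd c' w], fst c' (?o[i := True])) \<in> transitions ?Q"
      using is_mapD(4)[OF ts_mapsD[OF c] cube_edge[OF i(1)]] is_mapD(4)[OF ts_mapsD[OF c'] cube_edge[OF i(1)]] i by simp_all
    from src_act[OF this(1)] src_act[OF this(2)] show "snd c w = snd c' w" using st by simp
  qed
  have surj: "\<exists>c \<in> ts_maps (cube xs) ?Q. ts_comp (cube xs) ?p c = h" if h: "h \<in> ts_maps (cube xs) ?X" for h
  proof -
    note hm = ts_mapsD[OF h]
    have len: "length xs \<le> 1"
    proof (cases "xs = []")
      case False
      have "length us = 1" if "(\<alpha>, us, \<beta>) \<in> transitions ?X" for \<alpha> us \<beta>
        using that by (auto simp: two_edges_glued_def)
      from this[OF is_mapD(4)[OF hm cube_top[OF False]]] show ?thesis by simp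
    qed simp
    \<comment> \<open>The action of the edge that starts at the image of the initial vertex; for a
      0-cube the value is irrelevant.\<close>
    define a where "a = (if fst h (replicate (length xs) False) = en 0 then en 0 else en 1)"
    have m: "is_map (cube xs) ?Q (fst h) (\<lambda>_. a)"
    proof (rule is_mapI)
      fix s assume "s \<in> states (cube xs)"
      from is_mapD(1)[OF hm this] show "fst h s \<in> states ?Q" by (simp add: two_edges_def two_edges_glued_def)
    next
      fix w assume w: "w \<in> acts (cube xs)"
      show "a \<in> acts ?Q" by (simp add: a_def two_edges_def)
      have "lab ?X (snd h w) = lab (cube xs) w" using is_mapD(3)[OF hm w] .
      moreover have "snd h w = en 0" using is_mapD(2)[OF hm w] by (simp add: two_edges_glued_def)
      ultimately show "lab ?Q a = lab (cube xs) w" by (simp add: a_def two_edges_def two_edges_glued_def del: cube_simps)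
    next
      fix e ws e' assume t: "(e, ws, e') \<in> transitions (cube xs)"
      obtain y where xs: "xs = [y]"
        using len t by (cases xs) (auto simp: cube0(3) simp del: cube_simps)
      then have e: "e = [False]" "ws = [(y, 0)]" "e' = [True]" using t by (simp_all add: cube1_transitions)
      have "(fst h [False], [snd h (y, 0)], fst h [True]) \<in> transitions ?X"
        using is_mapD(4)[OF hm t] e by simp
      then show "(fst h e, map (\<lambda>_. a) ws, fst h e') \<in> transitions ?Q"
        using e xs by (auto simp: two_edges_glued_def two_edges_def a_def)
    qed
    have "ts_comp (cube xs) ?p (rst (cube xs) (fst h) (\<lambda>_. a)) = h"
      unfolding ts_comp_eq_map_iff[OF h]
    proof (intro conjI ballI)
      fix s assume "s \<in> states (cube xs)"
      then show "fst ?p (fst (rst (cube xs) (fst h) (\<lambda>_. a)) s) = fst h s" using ps is_mapD(1)[OF m] by (simp del: cube_simps)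
    next
      fix w assume w: "w \<in> acts (cube xs)"
      have "snd h w = en 0" using is_mapD(2)[OF hm w] by (simp add: two_edges_glued_def)
      then show "snd ?p (snd (rst (cube xs) (fst h) (\<lambda>_. a)) w) = snd h w" using pa is_mapD(2)[OF m] w by (simp del: cube_simps)
    qed
    moreover have "rst (cube xs) (fst h) (\<lambda>_. a) \<in> ts_maps (cube xs) ?Q" using m by (simp add: rst_ts_maps[OF weak_ts_cube])
    ultimately show ?thesis by blast
  qed
  show ?thesis
    unfolding bij_betw_def
  proof
    show "inj_on (ts_comp (cube xs) ?p) (ts_maps (cube xs) ?Q)" using inj by (rule inj_onI)
    show "ts_comp (cube xs) ?p ` ts_maps (cube xs) ?Q = ts_maps (cube xs) ?X"
      using surj ts_comp_maps[OF weak_ts_cube _ pm] by blast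
  qed
qed

lemma id_nice_arrs: "A \<in> Obs \<Longrightarrow> (A, ts_id A, A) \<in> nice_arrs"
  unfolding ts_id_rst by (rule nice_arrsI[OF _ _ nice_id])

text \<open>\<open>two_edges x\<close> is its own cubification and, having the same cubes, also that
  of the glued system. The induced map between them is the identity.\<close>

lemma fold_edges_cub_local: "(two_edges x, fold_edges x, two_edges_glued x) \<in> cub_local_maps K"
proof -
  let ?Q = "two_edges x" and ?X = "two_edges_glued x" and ?p = "fold_edges x"
  have QQ: "is_cubification ?Q ?Q (\<lambda>xs c. c)"
    by (rule cubification_id[OF edges_Obs(3)]) (auto simp: two_edges_def)
  have XQ: "is_cubification ?X ?Q (\<lambda>xs. inv_into (ts_maps (cube xs) ?Q) (ts_comp (cube xs) ?p))"
    by (rule cubification_transfer[OF QQ edge_maps(1) ObsD(1)[OF edges_Obs(3)] bij_fold_edges])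
  have "ts_comp (cube xs) (ts_id ?Q) c =
      inv_into (ts_maps (cube xs) ?Q) (ts_comp (cube xs) ?p) (ts_comp (cube xs) ?p c)"
    if c: "c \<in> ts_maps (cube xs) ?Q" for xs c
  proof -
    have "ts_comp (cube xs) (ts_id ?Q) c = c"
      unfolding ts_comp_eq_map_iff[OF c] ts_id_rst using is_mapD(1,2)[OF ts_mapsD[OF c]] by simp
    then show ?thesis using bij_betw_inv_into_left[OF bij_fold_edges c] by simp
  qed
  moreover have id: "(?Q, ts_id ?Q, ?Q) \<in> nice_arrs" by (rule id_nice_arrs[OF edges_Obs(3)])
  moreover from id have "ts_id ?Q \<in> ts_maps ?Q ?Q" using nice_arrs_arr by auto
  ultimately have "is_cub_of_map (?Q, ?p, ?X) (?Q, ts_id ?Q, ?Q)"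
    unfolding is_cub_of_map_def prod.case using QQ XQ by (intro conjI exI allI ballI)
  moreover have "(?Q, ?p, ?X) \<in> arr K" using edges_Obs edge_maps(1) by simp
  ultimately show ?thesis
    unfolding cub_local_maps_def using nice_ts_weqs id by blast
qed

lemma two_out_of_three_W:
  assumes "two_out_of_three K W'" "(A, h, B) \<in> arr K" "(B, k, D) \<in> arr K"
  shows "(B, k, D) \<in> W' \<Longrightarrow> (A, ts_comp A k h, D) \<in> W' \<Longrightarrow> (A, h, B) \<in> W'"
    "(A, h, B) \<in> W' \<Longrightarrow> (A, ts_comp A k h, D) \<in> W' \<Longrightarrow> (B, k, D) \<in> W'"
  using bspec[OF bspec[OF assms(1)[unfolded two_out_of_three_def] assms(2)] assms(3)] by simp_all

text \<open>Followed by the nice map that collapses the two actions, \<open>double_edges x\<close>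
  becomes the local map \<open>fold_edges x\<close>; two-out-of-three does the rest.\<close>

lemma double_edges_W:
  assumes two: "two_out_of_three K W'" and nice: "nice_arrs \<subseteq> W'" and cub: "cub_local_maps K \<subseteq> W'"
  shows "(two_edges x, double_edges x, two_edges_doubled x) \<in> W'"
proof -
  let ?Q = "two_edges x" and ?D = "two_edges_doubled x" and ?X = "two_edges_glued x"
  let ?k = "rst ?D (\<lambda>a. a) (\<lambda>_. en 0)"
  have k: "(?D, ?k, ?X) \<in> nice_arrs" by (rule nice_arrsI[OF edges_Obs(4,5) nice_doubled(2)])
  have "ts_comp ?Q ?k (double_edges x) = fold_edges x"
    unfolding ts_comp_rst fold_edges_def double_edges_def rst_eq_iff
    by (simp add: two_edges_def two_edges_doubled_def rst_def)
  then have "(?Q, ts_comp ?Q ?k (double_edges x), ?X) \<in> W'"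
    using fold_edges_cub_local cub by auto
  moreover have "(?Q, double_edges x, ?D) \<in> arr K" using edges_Obs edge_maps(2) by simp
  ultimately show ?thesis
    using two_out_of_three_W(1)[OF two _ subsetD[OF nice_arrs_arr k]] subsetD[OF nice k] by blast
qed

text \<open>A section of a nice map is a weak equivalence by two-out-of-three, before any
  localization.\<close>

lemma double_edge_W:
  assumes two: "two_out_of_three K W'" and nice: "nice_arrs \<subseteq> W'"
  shows "(edge1 x, double_edge x, edge1_doubled x) \<in> W'"
proof -
  let ?Q = "edge1 x" and ?D = "edge1_doubled x"
  let ?k = "rst ?D (\<lambda>a. a) (\<lambda>_. en 0)"
  have k: "(?D, ?k, ?Q) \<in> nice_arrs" by (rule nice_arrsI[OF edges_Obs(2,1) nice_doubled(1)])
  have "ts_comp ?Q ?k (double_edge x) = ts_id ?Q"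
    unfolding ts_comp_rst ts_id_rst double_edge_def rst_eq_iff
    by (simp add: edge1_def edge1_doubled_def rst_def)
  then have "(?Q, ts_comp ?Q ?k (double_edge x), ?Q) \<in> W'"
    using id_nice_arrs[OF edges_Obs(1)] nice by auto
  moreover have "(?Q, double_edge x, ?D) \<in> arr K" using edges_Obs edge_maps(3) by simp
  ultimately show ?thesis
    using two_out_of_three_W(1)[OF two _ subsetD[OF nice_arrs_arr k]] subsetD[OF nice k] by blast
qed

lemma edge_llp:
  "(two_edges x, double_edges x, two_edges_doubled x) \<in> llp K nice_arrs"
  "(edge1 x, double_edge x, edge1_doubled x) \<in> llp K nice_arrs"
  using edges_Obs edge_maps by (auto intro!: inj_acts_llp simp: double_edges_def double_edge_def inj_on_def)

section \<open>Saturation of 1-transitions\<close>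

lemma is_map_two_edges:
  assumes X: "weak_ts X" and a: "(\<alpha>, [u], \<beta>) \<in> transitions X" and b: "(\<gamma>, [v], \<delta>) \<in> transitions X"
    and l: "lab X u = x" "lab X v = x"
  defines "f \<equiv> \<lambda>s. if s = en 0 then \<alpha> else if s = en 1 then \<beta> else if s = en 2 then \<gamma> else \<delta>"
    and "g \<equiv> \<lambda>s. if s = en 0 then u else v"
  shows "is_map (two_edges x) X f g"
    and "(\<alpha>, [v], \<beta>) \<in> transitions X \<Longrightarrow> (\<gamma>, [u], \<delta>) \<in> transitions X \<Longrightarrow> is_map (two_edges_doubled x) X f g"
  using weak_tsD[OF X a] weak_tsD[OF X b] a b l
  by (auto simp: is_map_def edge_defs f_def g_def)

text \<open>The action \<open>v\<close> occurs on some edge of the cubical system \<open>X\<close>.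
  This edge and the given one form a copy of \<open>two_edges\<close>, and extending it along
  \<open>double_edges\<close> puts \<open>v\<close> on the given edge.\<close>

lemma fibrant_saturated1:
  assumes X: "LCub_fibrant K X" and t: "(\<alpha>, [u], \<beta>) \<in> transitions X" and v: "v \<in> acts X" "lab X v = lab X u"
  shows "(\<alpha>, [v], \<beta>) \<in> transitions X"
proof -
  have XO: "X \<in> Obs" using X unfolding LCub_fibrant_def fibrant_def by simp
  obtain \<gamma> \<delta> where g: "(\<gamma>, [v], \<delta>) \<in> transitions X" using cub_or_regD(3)[OF ObsD(2)[OF XO] v(1)] by blast
  let ?x = "lab X u"
  have w: "(two_edges ?x, double_edges ?x, two_edges_doubled ?x) \<in> LCub_weqs K"
    by (rule LCub_weqsI, rule double_edges_W) (auto simp: model_structure_def)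
  obtain f' g' where m: "is_map (two_edges_doubled ?x) X f' g'"
    "\<And>a. a \<in> states (two_edges ?x) \<Longrightarrow> f' (fst (double_edges ?x) a) =
      (if a = en 0 then \<alpha> else if a = en 1 then \<beta> else if a = en 2 then \<gamma> else \<delta>)"
    "\<And>a. a \<in> acts (two_edges ?x) \<Longrightarrow> g' (snd (double_edges ?x) a) = (if a = en 0 then u else v)"
    using fibrant_extend[OF X edge_llp(1) w is_map_two_edges(1)[OF ObsD(1)[OF XO] t g refl v(2)]] by blast
  have f': "f' (en 0) = \<alpha>" "f' (en 1) = \<beta>" "g' (en 1) = v"
    using m(2)[of "en 0"] m(2)[of "en 1"] m(3)[of "en 1"] by (simp_all add: double_edges_def two_edges_def rst_def)
  have "(en 0, [en 1], en 1) \<in> transitions (two_edges_doubled ?x)" by (simp add: two_edges_doubled_def)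
  from is_mapD(4)[OF m(1) this] show ?thesis using f' by simp
qed

text \<open>
  \<open>X \<rightarrow> clone X u v\<close> is a section of a trivial fibration, while \<open>X \<rightarrow> clone1 X u v\<close> lifts against
  fibrations by pasting copies of an edge. By two-out-of-three \<open>clone1 X u v \<rightarrow> clone X u v\<close> is a trivial
  cofibration of every localization.
\<close>

definition clone :: "('u, 'x) ts \<Rightarrow> 'u \<Rightarrow> 'u \<Rightarrow> ('u, 'x) ts" where
  "clone X u v = pullback_acts X (insert v (acts X)) (\<lambda>w. if w = v then u else w)"

definition clone1 :: "('u, 'x) ts \<Rightarrow> 'u \<Rightarrow> 'u \<Rightarrow> ('u, 'x) ts" where
  "clone1 X u v = (clone X u v) \<lparr> transitions :=
     {(\<alpha>, us, \<beta>) \<in> transitions (clone X u v). v \<in> set us \<longrightarrow> length us = 1} \<rparr>"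

lemma clone1_simps [simp]:
  "states (clone1 X u v) = states X" "acts (clone1 X u v) = insert v (acts X)"
  "lab (clone1 X u v) = lab (clone X u v)"
  "(\<alpha>, us, \<beta>) \<in> transitions (clone1 X u v) \<longleftrightarrow>
     (\<alpha>, us, \<beta>) \<in> transitions (clone X u v) \<and> (v \<in> set us \<longrightarrow> length us = 1)"
  by (auto simp: clone1_def clone_def)

lemma clone_Obs:
  assumes X: "X \<in> Obs" and u: "u \<in> acts X"
  shows "clone X u v \<in> Obs"
proof (rule ObsI)
  show "cub_or_reg r (clone X u v)"
    unfolding clone_def by (rule cub_or_reg_pullback_acts[OF ObsD(2)[OF X]]) (use u in auto)
  show "small (states (clone X u v))" using ObsD(4)[OF X] by (simp add: clone_def)
  show "small (acts (clone X u v))"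
    using small_Un[OF ObsD(5)[OF X] small_finite[of "{v}"]] by (simp add: clone_def)
qed

text \<open>The new action \<open>v\<close> occurs in no list of length at least 2, hence in no list
  to which the composition or the intermediate state axiom applies nontrivially. There the axioms
  are those of the full clone.\<close>

lemma clone1_Obs:
  assumes X: "X \<in> Obs" and u: "u \<in> acts X"
  shows "clone1 X u v \<in> Obs"
proof (rule ObsI)
  let ?B = "clone X u v" and ?B' = "clone1 X u v"
  note B = clone_Obs[OF X u, of v]
  note WB = ObsD(1)[OF B]
  have acts: "acts ?B = insert v (acts X)" "states ?B = states X" by (simp_all add: clone_def)
  have len: "us = [] \<or> vs = []" if "length (us @ vs) = 1" for us vs :: "'u list"
    using that by (cases us) auto
  show "cub_or_reg r ?B'"
  proof (rule cub_or_regI)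
    show "weak_ts ?B'"
    proof (rule weak_tsI)
      fix \<alpha> us \<beta> vs assume t: "(\<alpha>, us, \<beta>) \<in> transitions ?B'" and m: "mset vs = mset us"
      show "(\<alpha>, vs, \<beta>) \<in> transitions ?B'"
        using t transition_mset_cong[OF WB _ m] mset_eq_setD[OF m] mset_eq_length[OF m] by simp
    next
      fix \<alpha> us vs ws \<beta> \<nu>1 \<nu>2
      assume a: "us \<noteq> []" "vs \<noteq> []" "ws \<noteq> []" and t: "(\<alpha>, us @ vs @ ws, \<beta>) \<in> transitions ?B'"
        "(\<alpha>, us, \<nu>1) \<in> transitions ?B'" "(\<nu>1, vs @ ws, \<beta>) \<in> transitions ?B'"
        "(\<alpha>, us @ vs, \<nu>2) \<in> transitions ?B'" "(\<nu>2, ws, \<beta>) \<in> transitions ?B'"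
      have T: "(\<alpha>, us, \<beta>) \<in> transitions ?B" if "(\<alpha>, us, \<beta>) \<in> transitions ?B'" for \<alpha> us \<beta>
        using that by simp
      have "v \<notin> set (us @ vs @ ws)" using t(1) len[of us "vs @ ws"] a by auto
      then show "(\<nu>1, vs, \<nu>2) \<in> transitions ?B'"
        using weak_ts_compose[OF WB a T[OF t(1)] T[OF t(2)] T[OF t(3)] T[OF t(4)] T[OF t(5)]] by simp
    next
      fix \<alpha> us \<beta> assume t: "(\<alpha>, us, \<beta>) \<in> transitions ?B'"
      then show "\<alpha> \<in> states ?B' \<and> \<beta> \<in> states ?B' \<and> us \<noteq> [] \<and> set us \<subseteq> acts ?B'"
        using weak_tsD[OF WB, of \<alpha> us \<beta>] acts by simp
    qed (use WB acts in \<open>simp add: weak_ts_def\<close>)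
    fix w assume "w \<in> acts ?B'"
    then have "w \<in> acts ?B" using acts by simp
    from cub_or_regD(3)[OF ObsD(2)[OF B] this] show "\<exists>\<alpha> \<beta>. (\<alpha>, [w], \<beta>) \<in> transitions ?B'" by auto
  next
    fix \<alpha> us vs \<beta> assume a: "us \<noteq> []" "vs \<noteq> []" and t: "(\<alpha>, us @ vs, \<beta>) \<in> transitions ?B'"
    have v: "v \<notin> set (us @ vs)" using t len[of us vs] a by auto
    have t': "(\<alpha>, us @ vs, \<beta>) \<in> transitions ?B" using t by simp
    show "\<exists>\<nu>. (\<alpha>, us, \<nu>) \<in> transitions ?B' \<and> (\<nu>, vs, \<beta>) \<in> transitions ?B'"
      using cub_or_regD(4)[OF ObsD(2)[OF B] a t'] v by simp
    fix \<nu> \<nu>' assume r "(\<alpha>, us, \<nu>) \<in> transitions ?B'" "(\<nu>, vs, \<beta>) \<in> transitions ?B'"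
      "(\<alpha>, us, \<nu>') \<in> transitions ?B'" "(\<nu>', vs, \<beta>) \<in> transitions ?B'"
    then show "\<nu> = \<nu>'" using cub_or_regD(5)[OF ObsD(2)[OF B] _ a t', of \<nu> \<nu>'] by simp
  qed
  show "small (states ?B')" using ObsD(4)[OF X] by simp
  show "small (acts ?B')" using ObsD(5)[OF B] acts by simp
qed

lemma clone_transitions:
  assumes X: "X \<in> Obs" and v: "v \<notin> acts X" and t: "(\<alpha>, us, \<beta>) \<in> transitions X"
  shows "(\<alpha>, us, \<beta>) \<in> transitions (clone X u v)" "v \<notin> set us"
proof -
  have us: "set us \<subseteq> acts X" by (rule weak_tsD(4)[OF ObsD(1)[OF X] t])
  then show "v \<notin> set us" using v by blast
  then have "map (\<lambda>w. if w = v then u else w) us = us" by (auto intro!: map_idI)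
  then show "(\<alpha>, us, \<beta>) \<in> transitions (clone X u v)" using us t by (auto simp: clone_def)
qed

lemma clone1_cases:
  assumes t: "(\<alpha>, us, \<beta>) \<in> transitions (clone1 X u v)"
  obtains "us = [v]" "(\<alpha>, [u], \<beta>) \<in> transitions X" | "v \<notin> set us" "(\<alpha>, us, \<beta>) \<in> transitions X"
proof (cases "v \<in> set us")
  case True
  then have "length us = 1" using t by simp
  then have us: "us = [v]" using True by (auto simp: length_Suc_conv)
  then have "(\<alpha>, [u], \<beta>) \<in> transitions X" using t by (simp add: clone_def)
  then show ?thesis using that(1) us by blast
next
  case False
  then have "map (\<lambda>w. if w = v then u else w) us = us" by (auto intro!: map_idI)
  then have "(\<alpha>, us, \<beta>) \<in> transitions X" using t by (simp add: clone_def)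
  then show ?thesis using that(2) False by blast
qed

lemma clone1_lifting:
  assumes X: "X \<in> Obs" and u: "u \<in> acts X" and v: "v \<notin> acts X" and q: "(E, q, F) \<in> arr K"
    and l1: "\<And>x. has_lifting K (edge1 x, double_edge x, edge1_doubled x) (E, q, F)"
    and l2: "\<And>x. has_lifting K (two_edges x, double_edges x, two_edges_doubled x) (E, q, F)"
  shows "lifts X (clone1 X u v) E F (\<lambda>a. a) (\<lambda>w. w) (fst q) (snd q)"
  unfolding lifts_def
proof (intro allI impI, elim conjE)
  fix us ua vs va
  assume um: "is_map X E us ua" and vm: "is_map (clone1 X u v) F vs va"
    and es: "\<forall>a \<in> states X. fst q (us a) = vs a" and ea: "\<forall>w \<in> acts X. snd q (ua w) = va w"
  let ?x = "lab X u"
  have E: "E \<in> Obs" and F: "F \<in> Obs" and qm: "is_map E F (fst q) (snd q)" using q by (simp_all add: ts_mapsD)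
  note WX = ObsD(1)[OF X] and WE = ObsD(1)[OF E] and WF = ObsD(1)[OF F]
  have L1: "lifts (edge1 ?x) (edge1_doubled ?x) E F (fst (double_edge ?x)) (snd (double_edge ?x)) (fst q) (snd q)"
    using l1[of ?x] has_lifting_lifts[OF _ q] edges_Obs edge_maps(3) by simp
  have L2: "lifts (two_edges ?x) (two_edges_doubled ?x) E F (fst (double_edges ?x)) (snd (double_edges ?x)) (fst q) (snd q)"
    using l2[of ?x] has_lifting_lifts[OF _ q] edges_Obs edge_maps(2) by simp
  have lu: "lab E (ua u) = ?x" using is_mapD(3)[OF um u] .
  have lu': "lab F (va u) = ?x" "lab F (va v) = ?x"
    using is_mapD(3)[OF vm, of u] is_mapD(3)[OF vm, of v] u v by (auto simp: clone_def)
  have Fu: "(vs \<alpha>, [va u], vs \<beta>) \<in> transitions F" and Fv: "(vs \<alpha>, [va v], vs \<beta>) \<in> transitions F"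
    and Eu: "(us \<alpha>, [ua u], us \<beta>) \<in> transitions E"
    if t: "(\<alpha>, [u], \<beta>) \<in> transitions X" for \<alpha> \<beta>
  proof -
    have "(\<alpha>, [u], \<beta>) \<in> transitions (clone1 X u v)" "(\<alpha>, [v], \<beta>) \<in> transitions (clone1 X u v)"
      using clone_transitions[OF X v t] t u by (auto simp: clone_def)
    from this[THEN is_mapD(4)[OF vm]]
    show "(vs \<alpha>, [va u], vs \<beta>) \<in> transitions F" "(vs \<alpha>, [va v], vs \<beta>) \<in> transitions F" by simp_all
    show "(us \<alpha>, [ua u], us \<beta>) \<in> transitions E" using is_mapD(4)[OF um t] by simp
  qed
  \<comment> \<open>Any edge of \<open>u\<close> serves as the starting edge; one exists because
    \<open>X\<close> is cubical.\<close>
  obtain \<alpha>0 \<beta>0 where t0: "(\<alpha>0, [u], \<beta>0) \<in> transitions X" using cub_or_regD(3)[OF ObsD(2)[OF X] u] by blast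
  note d0 = weak_tsD[OF WX t0]
  have m1: "is_map (edge1 ?x) E (\<lambda>s. if s = en 0 then us \<alpha>0 else us \<beta>0) (\<lambda>_. ua u)"
    using Eu[OF t0] weak_tsD[OF WE Eu[OF t0]] lu by (auto simp: is_map_def edge_defs)
  have m2: "is_map (edge1_doubled ?x) F (\<lambda>s. if s = en 0 then vs \<alpha>0 else vs \<beta>0) (\<lambda>s. if s = en 0 then va u else va v)"
    using Fu[OF t0] Fv[OF t0] weak_tsD[OF WF Fu[OF t0]] weak_tsD[OF WF Fv[OF t0]] lu'
    by (auto simp: is_map_def edge_defs)
  obtain ls la where l: "is_map (edge1_doubled ?x) E ls la"
    "\<forall>a \<in> states (edge1 ?x). ls (fst (double_edge ?x) a) = (if a = en 0 then us \<alpha>0 else us \<beta>0)"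
    "\<forall>b \<in> acts (edge1_doubled ?x). snd q (la b) = (if b = en 0 then va u else va v)"
  proof -
    have "\<forall>a \<in> states (edge1 ?x). fst q (if a = en 0 then us \<alpha>0 else us \<beta>0) =
        (if fst (double_edge ?x) a = en 0 then vs \<alpha>0 else vs \<beta>0)"
      using es d0(1,2) by (simp add: double_edge_def edge1_def rst_def)
    moreover have "\<forall>w \<in> acts (edge1 ?x). snd q (ua u) = (if snd (double_edge ?x) w = en 0 then va u else va v)"
      using ea u by (simp add: double_edge_def edge1_def rst_def)
    ultimately show ?thesis
      using L1[unfolded lifts_def, rule_format, OF conjI[OF m1 conjI[OF m2 conjI]]] that by blast
  qed
  define w where "w = la (en 1)"
  have ls: "ls (en 0) = us \<alpha>0" "ls (en 1) = us \<beta>0"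
    using l(2) by (simp_all add: double_edge_def edge1_def rst_def)
  have "(en 0, [en 1], en 1) \<in> transitions (edge1_doubled ?x)" by (simp add: edge1_doubled_def)
  from is_mapD(4)[OF l(1) this] have w0: "(us \<alpha>0, [w], us \<beta>0) \<in> transitions E" using ls by (simp add: w_def)
  have wa: "w \<in> acts E" "lab E w = ?x"
    using is_mapD(2,3)[OF l(1), of "en 1"] by (simp_all add: edge1_doubled_def w_def)
  have qw: "snd q w = va v" using l(3) by (simp add: edge1_doubled_def w_def)
  \<comment> \<open>The starting edge with \<open>w\<close> and an arbitrary edge with
    \<open>ua u\<close> form a copy of \<open>two_edges\<close>; the lift places \<open>w\<close> on
    the second edge as well.\<close>
  have wt: "(us \<alpha>, [w], us \<beta>) \<in> transitions E" if t: "(\<alpha>, [u], \<beta>) \<in> transitions X" for \<alpha> \<beta>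
  proof -
    note d = weak_tsD[OF WX t]
    let ?f = "\<lambda>s. if s = en 0 then us \<alpha>0 else if s = en 1 then us \<beta>0 else if s = en 2 then us \<alpha> else us \<beta>"
    let ?f' = "\<lambda>s. if s = en 0 then vs \<alpha>0 else if s = en 1 then vs \<beta>0 else if s = en 2 then vs \<alpha> else vs \<beta>"
    let ?g = "\<lambda>s. if s = en 0 then w else ua u" and ?g' = "\<lambda>s. if s = en 0 then va v else va u"
    have n1: "is_map (two_edges ?x) E ?f ?g"
      by (rule is_map_two_edges(1)[OF WE w0 Eu[OF t] wa(2) lu])
    have n2: "is_map (two_edges_doubled ?x) F ?f' ?g'"
      by (rule is_map_two_edges(2)[OF WF Fv[OF t0] Fu[OF t] lu'(2,1) Fu[OF t0] Fv[OF t]])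
    have c1: "\<forall>a \<in> states (two_edges ?x). fst q (?f a) = ?f' (fst (double_edges ?x) a)"
      using es d0(1,2) d(1,2) by (simp add: double_edges_def two_edges_def rst_def)
    have c2: "\<forall>a \<in> acts (two_edges ?x). snd q (?g a) = ?g' (snd (double_edges ?x) a)"
      using ea u qw by (simp add: double_edges_def two_edges_def rst_def)
    obtain ls la where k: "is_map (two_edges_doubled ?x) E ls la"
      "\<forall>a \<in> states (two_edges ?x). ls (fst (double_edges ?x) a) = ?f a"
      "\<forall>a \<in> acts (two_edges ?x). la (snd (double_edges ?x) a) = ?g a"
      using L2[unfolded lifts_def, rule_format, OF conjI[OF n1 conjI[OF n2 conjI[OF c1 c2]]]] by blast
    have ls: "ls (en 2) = us \<alpha>" "ls (en 3) = us \<beta>" "la (en 0) = w"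
      using k(2,3) by (simp_all add: double_edges_def two_edges_def rst_def)
    have "(en 2, [en 0], en 3) \<in> transitions (two_edges_doubled ?x)" by (simp add: two_edges_doubled_def)
    from is_mapD(4)[OF k(1) this] show ?thesis using ls by simp
  qed
  have "is_map (clone1 X u v) E us (\<lambda>z. if z = v then w else ua z)"
  proof (rule is_mapI)
    fix z assume z: "z \<in> acts (clone1 X u v)"
    show "(if z = v then w else ua z) \<in> acts E" using z wa(1) is_mapD(2)[OF um] by auto
    show "lab E (if z = v then w else ua z) = lab (clone1 X u v) z"
      using z wa(2) is_mapD(3)[OF um] by (auto simp: clone_def)
  next
    fix \<alpha> zs \<beta> assume "(\<alpha>, zs, \<beta>) \<in> transitions (clone1 X u v)"
    then show "(us \<alpha>, map (\<lambda>z. if z = v then w else ua z) zs, us \<beta>) \<in> transitions E"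
    proof (cases rule: clone1_cases)
      case 1
      then show ?thesis using wt by simp
    next
      case 2
      then have "map (\<lambda>z. if z = v then w else ua z) zs = map ua zs" by auto
      then show ?thesis using is_mapD(4)[OF um 2(2)] by metis
    qed
  qed (use is_mapD(1)[OF um] in simp)
  then show "\<exists>ls la. is_map (clone1 X u v) E ls la \<and>
           (\<forall>a \<in> states X. ls a = us a) \<and> (\<forall>w \<in> acts X. la w = ua w) \<and>
           (\<forall>b \<in> states (clone1 X u v). fst q (ls b) = vs b) \<and> (\<forall>w \<in> acts (clone1 X u v). snd q (la w) = va w)"
    using es ea qw v by (intro exI[of _ us] exI[of _ "\<lambda>z. if z = v then w else ua z"]) auto
qed

lemma clone1_clone:
  assumes X: "X \<in> Obs" and u: "u \<in> acts X" and v: "v \<notin> acts X"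
  shows "(clone1 X u v, rst (clone1 X u v) (\<lambda>a. a) (\<lambda>w. w), clone X u v) \<in> llp K nice_arrs \<inter> LCub_weqs K"
proof
  let ?B = "clone X u v" and ?B' = "clone1 X u v"
  note B = clone_Obs[OF X u, of v] and B' = clone1_Obs[OF X u, of v]
  let ?i = "rst ?B' (\<lambda>a. a) (\<lambda>w. w)" and ?j = "rst X (\<lambda>a. a) (\<lambda>w. w)"
    and ?n = "rst ?B (\<lambda>a. a) (\<lambda>w. if w = v then u else w)"
  have "is_map ?B' ?B (\<lambda>a. a) (\<lambda>w. w)"
    by (rule is_mapI) (simp_all add: clone_def)
  then have ia: "(?B', ?i, ?B) \<in> arr K" using B B' by (simp add: rst_ts_maps[OF ObsD(1)[OF B']])
  show "(?B', ?i, ?B) \<in> llp K nice_arrs" by (rule inj_acts_llp[OF ia]) (simp add: inj_on_def)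
  have lv: "lab ?B w = lab X w" if "w \<in> acts X" for w using that v by (auto simp: clone_def)
  have jm: "is_map X ?B' (\<lambda>a. a) (\<lambda>w. w)"
  proof (rule is_mapI)
    fix \<alpha> us \<beta> assume t: "(\<alpha>, us, \<beta>) \<in> transitions X"
    show "(\<alpha>, map (\<lambda>w. w) us, \<beta>) \<in> transitions ?B'"
      using clone_transitions(1)[OF X v t, of u] clone_transitions(2)[OF X v t] by simp
  qed (use lv in simp_all)
  have ja: "(X, ?j, ?B') \<in> arr K" using X B' jm by (simp add: rst_ts_maps[OF ObsD(1)[OF X]])
  have "nice ?B X (\<lambda>a. a) (\<lambda>w. if w = v then u else w)"
    unfolding clone_def by (rule nice_pullback_acts) (use u v in \<open>auto simp: image_iff\<close>)
  then have n: "(?B, ?n, X) \<in> nice_arrs" by (rule nice_arrsI[OF B X])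
  show "(?B', ?i, ?B) \<in> LCub_weqs K"
  proof (rule LCub_weqsI)
    fix W' F' assume ms: "model_structure K (llp K nice_arrs) W' F'" and nice: "nice_arrs \<subseteq> W'"
      and cub: "cub_local_maps K \<subseteq> W'"
    have two: "two_out_of_three K W'" using ms unfolding model_structure_def by blast
    have lift: "has_lifting K i p" if "i \<in> llp K nice_arrs" "i \<in> W'" "p \<in> F'" for i p
      using ms that unfolding model_structure_def by blast
    have "has_lifting K (X, ?j, ?B') q" if q: "q \<in> F'" for q
    proof -
      obtain E p F where q': "q = (E, p, F)" by (cases q)
      have qa: "(E, p, F) \<in> arr K" using ms q unfolding model_structure_def q' by blast
      have "lifts X ?B' E F (\<lambda>a. a) (\<lambda>w. w) (fst p) (snd p)"
        by (rule clone1_lifting[OF X u v qa])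
          (rule lift[OF edge_llp(2) double_edge_W[OF two nice] q, unfolded q'],
           rule lift[OF edge_llp(1) double_edges_W[OF two nice cub] q, unfolded q'])
      then have "lifts X ?B' E F (fst ?j) (snd ?j) (fst p) (snd p)"
        unfolding lifts_def by simp
      then show ?thesis unfolding q' has_lifting_lifts[OF ja qa] .
    qed
    \<comment> \<open>The lifting property holds against all fibrations of the candidate structure,
      so the retract argument applies there.\<close>
    then have jW: "(X, ?j, ?B') \<in> W'" using ts.retract_argument[OF ms ja] by blast
    have ij: "(X, ts_comp X ?i ?j, ?B) \<in> arr K"
      using X B ja ia by (simp add: ts_comp_maps[OF ObsD(1)[OF X], of ?j ?B' ?i ?B])
    \<comment> \<open>Sending the clone back to \<open>u\<close> retracts the full clone onto
      \<open>X\<close> by a nice map, so the inclusion of \<open>X\<close> is a weak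
      equivalence.\<close>
    have "ts_comp X ?n (ts_comp X ?i ?j) = ts_id X"
      unfolding ts_comp_rst ts_id_rst rst_eq_iff using v by (auto simp: rst_def clone_def)
    then have "(X, ts_comp X ?n (ts_comp X ?i ?j), X) \<in> W'" using id_nice_arrs[OF X] nice by auto
    then have "(X, ts_comp X ?i ?j, ?B) \<in> W'"
      using two_out_of_three_W(1)[OF two ij subsetD[OF nice_arrs_arr n]] n nice by blast
    then show "(?B', ?i, ?B) \<in> W'" using two_out_of_three_W(2)[OF two ja ia jW] by blast
  qed
qed

text \<open>Saturation of 1-transitions is exactly what makes sending the clone \<open>v\<close> of
  \<open>u\<close> to \<open>z\<close> a map on \<open>clone1\<close>. Its extension to the full
  clone carries the transition with \<open>v\<close> in place of \<open>u\<close> to the one with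
  \<open>z\<close>.\<close>

lemma fibrant_replace_action:
  assumes fib: "LCub_fibrant K X" and t: "(\<alpha>, ps @ u # qs, \<beta>) \<in> transitions X"
    and z: "z \<in> acts X" "lab X z = lab X u"
  shows "(\<alpha>, ps @ z # qs, \<beta>) \<in> transitions X"
proof -
  have X: "X \<in> Obs" using fib unfolding LCub_fibrant_def fibrant_def by simp
  note WX = ObsD(1)[OF X]
  have us: "set (ps @ u # qs) \<subseteq> acts X" by (rule weak_tsD(4)[OF WX t])
  then have u: "u \<in> acts X" by simp
  \<comment> \<open>A fresh name for the clone exists because the set of actions is small.\<close>
  obtain v where v: "v \<notin> acts X" using small_fresh[OF ObsD(5)[OF X]] by blast
  let ?B = "clone X u v" and ?B' = "clone1 X u v"
  let ?g = "\<lambda>w. if w = v then z else w"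
  have m: "is_map ?B' X (\<lambda>a. a) ?g"
  proof (rule is_mapI)
    fix w assume w: "w \<in> acts ?B'"
    show "?g w \<in> acts X" using w z(1) by auto
    show "lab X (?g w) = lab ?B' w" using w z(2) by (auto simp: clone_def)
  next
    fix \<gamma> ws \<delta> assume "(\<gamma>, ws, \<delta>) \<in> transitions ?B'"
    then show "(\<gamma>, map ?g ws, \<delta>) \<in> transitions X"
    proof (cases rule: clone1_cases)
      case 1
      then show ?thesis using fibrant_saturated1[OF fib 1(2) z] by simp
    next
      case 2
      then have "map ?g ws = ws" by (auto intro!: map_idI)
      then show ?thesis using 2(2) by simp
    qed
  qed simp
  obtain f' g' where m': "is_map ?B X f' g'" and f': "\<And>a. a \<in> states ?B' \<Longrightarrow> f' (fst (rst ?B' (\<lambda>a. a) (\<lambda>w. w)) a) = a"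
    and g': "\<And>w. w \<in> acts ?B' \<Longrightarrow> g' (snd (rst ?B' (\<lambda>a. a) (\<lambda>w. w)) w) = ?g w"
    using fibrant_extend[OF fib _ _ m] clone1_clone[OF X u v] by blast
  have f'': "f' a = a" if "a \<in> states X" for a using f'[of a] that by (simp add: rst_def)
  have g'': "g' w = ?g w" if "w \<in> insert v (acts X)" for w using g'[of w] that by (simp add: rst_def)
  have id: "map (\<lambda>w. if w = v then u else w) ws = ws" "map g' ws = ws" if "set ws \<subseteq> acts X" for ws
  proof -
    show "map (\<lambda>w. if w = v then u else w) ws = ws" using that v by (intro map_idI) auto
    show "map g' ws = ws" using that v g'' by (intro map_idI) auto
  qed
  have "(\<alpha>, ps @ v # qs, \<beta>) \<in> transitions ?B" using us t id(1)[of ps] id(1)[of qs] by (auto simp: clone_def)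
  from is_mapD(4)[OF m' this] show ?thesis
    using f'' weak_tsD(1,2)[OF WX t] id(2)[of ps] id(2)[of qs] us g''[of v] by simp
qed

text \<open>Actions are exchanged one position at a time from the left; the induction keeps a prefix
  of \<open>vs\<close> followed by the remaining suffix of \<open>us\<close>.\<close>

lemma fibrant_saturated:
  assumes fib: "LCub_fibrant K X"
  shows "saturated X"
  unfolding saturated_def
proof (intro allI impI, elim conjE)
  fix \<alpha> us vs \<beta>
  assume t: "(\<alpha>, us, \<beta>) \<in> transitions X" and vs: "set vs \<subseteq> acts X" and e: "map (lab X) vs = map (lab X) us"
  have len: "length vs = length us" using e by (rule map_eq_imp_length_eq)
  have "k \<le> length us \<longrightarrow> (\<alpha>, take k vs @ drop k us, \<beta>) \<in> transitions X" for k
  proof (induction k)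
    case 0
    then show ?case using t by simp
  next
    case (Suc k)
    show ?case
    proof
      assume k: "Suc k \<le> length us"
      then have "(\<alpha>, take k vs @ us ! k # drop (Suc k) us, \<beta>) \<in> transitions X"
        using Suc by (simp add: Cons_nth_drop_Suc)
      moreover have "vs ! k \<in> acts X" using vs k len by auto
      moreover have "lab X (vs ! k) = lab X (us ! k)"
        using arg_cong[OF e, of "\<lambda>l. l ! k"] k len by simp
      ultimately have "(\<alpha>, take k vs @ vs ! k # drop (Suc k) us, \<beta>) \<in> transitions X"
        by (rule fibrant_replace_action[OF fib])
      then show "(\<alpha>, take (Suc k) vs @ drop (Suc k) us, \<beta>) \<in> transitions X"
        using k len by (simp add: take_Suc_conv_app_nth)
    qed
  qed
  from this[of "length us"] show "(\<alpha>, vs, \<beta>) \<in> transitions X" using len by simp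
qed

lemma LCub_fibrant_iff: "X \<in> Obs \<Longrightarrow> LCub_fibrant K X \<longleftrightarrow> saturated X"
  using fibrant_saturated saturated_fibrant by blast

end

theorem proposition6p8:
  fixes X :: "('u, 'x) ts"
  assumes "universe_for_labels TYPE('u) TYPE('x)"
    and "X \<in> obj RTS"
  shows "LCub_fibrant RTS X \<longleftrightarrow> LCub_fibrant CTS X"
proof -
  interpret R: ts_universe True "TYPE('u)" "TYPE('x)" by unfold_locales (rule assms(1))
  interpret C: ts_universe False "TYPE('u)" "TYPE('x)" by unfold_locales (rule assms(1))
  have X: "X \<in> ts_objs (cub_or_reg True)" using assms(2) unfolding RTS_def cub_or_reg_True by simp
  \<comment> \<open>A regular system is cubical, so \<open>X\<close> is an object of both categories
    and both characterizations apply to it.\<close>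
  then have "X \<in> ts_objs (cub_or_reg False)" by (simp add: ts_objs_def cub_or_reg_def)
  then show ?thesis
    using R.LCub_fibrant_iff[OF X] C.LCub_fibrant_iff
    unfolding RTS_def CTS_def cub_or_reg_True cub_or_reg_False by blast
qed

end
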